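(* Let $T,\kappa\in(0,\infty)$, $f\in C(\mathbb R,\mathbb R)$, let $(\mathfrak g_{d,\varepsilon})_{d\in\mathbb N,\varepsilon\in(0,1]}\subseteq\mathbf N$ be a family of neural networks, let $(c_d)_{d\in\mathbb N}\subseteq(0,\infty)$, for every $d\in\mathbb N$ let $g_d\in C(\mathbb R^d,\mathbb R)$ and $u_d\in C^{1,2}([0,T]\times\mathbb R^d,\mathbb R)$, and assume for all $d\in\mathbb N$, $v,w\in\mathbb R$, $x\in\mathbb R^d$, $\varepsilon\in(0,1]$, $t\in(0,T)$ that $|f(v)-f(w)|\le\kappa|v-w|$, $\mathcal R(\mathfrak g_{d,\varepsilon})\in C(\mathbb R^d,\mathbb R)$, $|(\mathcal R(\mathfrak g_{d,\varepsilon}))(x)|\le\kappa d^\kappa(1+\|x\|^\kappa)$, $|g_d(x)-(\mathcal R(\mathfrak g_{d,\varepsilon}))(x)|\le\varepsilon\kappa d^\kappa(1+\|x\|^\kappa)$, $\mathcal P(\mathfrak g_{d,\varepsilon})\le\kappa d^\kappa\varepsilon^{-\kappa}$, $|u_d(t,x)|\le c_d(1+\|x\|^{c_d})$, $u_d(0,x)=g_d(x)$, and $$\left(\tfrac{\partial}{\partial t}u_d\right)(t,x)=(\Delta_xu_d)(t,x)+f(u_d(t,x)).$$ Then there exist $(\Psi_{d,\varepsilon})_{d\in\mathbb N,\varepsilon\in(0,1]}\subseteq\mathbf N$ and $\eta\in(0,\infty)$ such that for all $d\in\mathbb N$, $\varepsilon\in(0,1]$ it holds that $\mathcal R(\Psi_{d,\varepsilon})\in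 C(\mathbb R^d,\mathbb R)$, $\mathcal P(\Psi_{d,\varepsilon})\le\eta d^\eta\varepsilon^{-\eta}$, and $$\left[\int_{[0,1]^d}\left|u_d(T,x)-(\mathcal R(\Psi_{d,\varepsilon}))(x)\right|^2\,dx\right]^{1/2}\le\varepsilon.$$
   Context: $\mathbb N=\{1,2,\ldots\}$. For $x=(x_1,\ldots,x_d)\in\mathbb R^d$, $\|x\|=[\sum_{i=1}^d(x_i)^2]^{1/2}$. For $d\in\mathbb N$, $\mathbf A_d\colon\mathbb R^d\to\mathbb R^d$ is $\mathbf A_d(x)=(\max\{x_1,0\},\ldots,\max\{x_d,0\})$. The set of neural networks is $$\mathbf N=\bigcup_{H\in\mathbb N}\ \bigcup_{(k_0,k_1,\ldots,k_{H+1})\in\mathbb N^{H+2}}\left[\prod_{n=1}^{H+1}\left(\mathbb R^{k_n\times k_{n-1}}\times\mathbb R^{k_n}\right)\right].$$ For $H,k_0,\ldots,k_{H+1}\in\mathbb N$ and $\Phi=((W_1,B_1),\ldots,(W_{H+1},B_{H+1}))\in\prod_{n=1}^{H+1}(\mathbb R^{k_n\times k_{n-1}}\times\mathbb R^{k_n})$, the realization $\mathcal R(\Phi)\in C(\mathbb R^{k_0},\mathbb R^{k_{H+1}})$ is given by $(\mathcal R(\Phi))(x_0)=W_{H+1}x_H+B_{H+1}$ where $x_0\in\mathbb R^{k_0}$ and $x_n=\mathbf A_{k_n}(W_nx_{n-1}+B_n)$ for $n=1,\ldots,H$; the number of parameters is $\mathcal P(\Phi)=\sum_{n=1}^{H+1}k_n(k_{n-1}+1)$.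 *)

theory Defs
  imports "HOL-Analysis.Analysis" "Jordan_Normal_Form.Matrix"
begin

text \<open>
  The dimension is quantified inside the statement, so a point of R^d is a function on the
  natural numbers that is extensional on the 0-based index set \<open>{..<d}\<close>. Such a function takes
  a fixed value outside \<open>{..<d}\<close>, so the product topology of the type \<open>nat \<Rightarrow> real\<close> induces
  the Euclidean topology on \<open>Rd d\<close>. The Euclidean norm is \<open>L2_set x {..<d}\<close>.
\<close>

abbreviation Rd :: "nat \<Rightarrow> (nat \<Rightarrow> real) set" where
  "Rd d \<equiv> {..<d} \<rightarrow>\<^sub>E UNIV"

abbreviation unit_cube :: "nat \<Rightarrow> (nat \<Rightarrow> real) set" where
  "unit_cube d \<equiv> {..<d} \<rightarrow>\<^sub>E {0..1}"

abbreviation lebesgue_Rd :: "nat \<Rightarrow> (nat \<Rightarrow> real) measure" where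
  "lebesgue_Rd d \<equiv> Pi\<^sub>M {..<d} (\<lambda>_. lborel)"

definition relu :: "nat \<Rightarrow> (nat \<Rightarrow> real) \<Rightarrow> (nat \<Rightarrow> real)" where
  "relu d x = (\<lambda>i\<in>{..<d}. max (x i) 0)"

type_synonym layer = "real mat \<times> (nat \<Rightarrow> real)"

text \<open>The list entry \<open>\<Phi> ! n\<close> is the pair \<open>(W_{n+1}, B_{n+1})\<close>.\<close>

definition networks :: "layer list set" where
  "networks = (\<Union>H\<in>{1..}. \<Union>k\<in>{k. \<forall>n\<le>H + 1. k n \<ge> 1}.
     {\<Phi>. length \<Phi> = H + 1 \<and> (\<forall>n<H + 1. \<Phi> ! n \<in> carrier_mat (k (n + 1)) (k n) \<times> Rd (k (n + 1)))})"

definition affine_layer :: "layer \<Rightarrow> (nat \<Rightarrow> real) \<Rightarrow> (nat \<Rightarrow> real)" where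
  "affine_layer = (\<lambda>(W, B) x. \<lambda>i\<in>{..<dim_row W}. (\<Sum>j<dim_col W. W $$ (i, j) * x j) + B i)"

text \<open>The equation for the empty list is only there for totality.\<close>

fun realization :: "layer list \<Rightarrow> (nat \<Rightarrow> real) \<Rightarrow> (nat \<Rightarrow> real)" where
  "realization [] x = x"
| "realization [l] x = affine_layer l x"
| "realization (l # l' # ls) x =
     realization (l' # ls) (relu (dim_row (fst l)) (affine_layer l x))"

definition num_params :: "layer list \<Rightarrow> nat" where
  "num_params \<Phi> = (\<Sum>(W, B)\<leftarrow>\<Phi>. dim_row W * (dim_col W + 1))"

definition in_dim :: "layer list \<Rightarrow> nat" where
  "in_dim \<Phi> = dim_col (fst (hd \<Phi>))"

definition out_dim :: "layer list \<Rightarrow> nat" where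
  "out_dim \<Phi> = dim_row (fst (last \<Phi>))"

text \<open>
  Membership of the realization in \<open>C(R^d, R^m)\<close>. Functions in HOL are total, so domain and
  codomain of the realization have to be read off the network explicitly.
\<close>

definition realization_in_C :: "nat \<Rightarrow> nat \<Rightarrow> layer list \<Rightarrow> bool" where
  "realization_in_C d m \<Phi> \<longleftrightarrow> in_dim \<Phi> = d \<and> out_dim \<Phi> = m \<and>
     realization \<Phi> \<in> Rd d \<rightarrow> Rd m \<and> continuous_on (Rd d) (realization \<Phi>)"

text \<open>R^1 is identified with R through the coordinate 0.\<close>

abbreviation scalar_realization :: "layer list \<Rightarrow> (nat \<Rightarrow> real) \<Rightarrow> real" where
  "scalar_realization \<Phi> x \<equiv> realization \<Phi> x 0"

definition partial_differentiable :: "nat \<Rightarrow> ((nat \<Rightarrow> real) \<Rightarrow> real) \<Rightarrow> (nat \<Rightarrow> real) \<Rightarrow> bool" where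
  "partial_differentiable i h x \<longleftrightarrow> (\<lambda>s. h (x(i := s))) differentiable (at (x i))"

definition partial_deriv :: "nat \<Rightarrow> ((nat \<Rightarrow> real) \<Rightarrow> real) \<Rightarrow> (nat \<Rightarrow> real) \<Rightarrow> real" where
  "partial_deriv i h x = deriv (\<lambda>s. h (x(i := s))) (x i)"

definition laplacian :: "nat \<Rightarrow> ((nat \<Rightarrow> real) \<Rightarrow> real) \<Rightarrow> (nat \<Rightarrow> real) \<Rightarrow> real" where
  "laplacian d h x = (\<Sum>i<d. partial_deriv i (partial_deriv i h) x)"

text \<open>
  \<open>C12 T d u\<close>: \<open>u\<close> belongs to \<open>C^{1,2}([0,T] \<times> R^d, R)\<close>, that is, \<open>u\<close>, its time derivative and its
  space derivatives up to order two exist and are jointly continuous on the closed set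
  \<open>[0,T] \<times> R^d\<close>. Time derivatives are taken within \<open>[0,T]\<close>, hence are one-sided at 0 and \<open>T\<close>.
\<close>

definition C12 :: "real \<Rightarrow> nat \<Rightarrow> (real \<Rightarrow> (nat \<Rightarrow> real) \<Rightarrow> real) \<Rightarrow> bool" where
  "C12 T d u \<longleftrightarrow>
     continuous_on ({0..T} \<times> Rd d) (\<lambda>(t, x). u t x) \<and>
     (\<forall>t\<in>{0..T}. \<forall>x\<in>Rd d. (\<lambda>s. u s x) differentiable (at t within {0..T})) \<and>
     continuous_on ({0..T} \<times> Rd d) (\<lambda>(t, x). vector_derivative (\<lambda>s. u s x) (at t within {0..T})) \<and>
     (\<forall>i<d. (\<forall>t\<in>{0..T}. \<forall>x\<in>Rd d. partial_differentiable i (u t) x) \<and>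
        continuous_on ({0..T} \<times> Rd d) (\<lambda>(t, x). partial_deriv i (u t) x)) \<and>
     (\<forall>i<d. \<forall>j<d. (\<forall>t\<in>{0..T}. \<forall>x\<in>Rd d. partial_differentiable j (partial_deriv i (u t)) x) \<and>
        continuous_on ({0..T} \<times> Rd d) (\<lambda>(t, x). partial_deriv j (partial_deriv i (u t)) x))"

end

theory Submission
  imports Defs
begin

text \<open>
  Replace Brownian motion by the simple random walk with step size \<open>sqrt (2 d h)\<close> along a random
  coordinate axis, and the equation by the scheme \<open>w (k + 1) = Q (w k + h f (w k))\<close> with \<open>Q\<close> the one-step
  average of the walk. A second difference in each coordinate shows that the classical solution
  satisfies the scheme up to \<open>o(h)\<close>, locally uniformly, and a discrete maximum principle with barrier
  \<open>\<Sum>i<d. cosh (2 x_i)\<close>, whose growth rate under \<open>Q\<close> is free of \<open>d\<close>, turns this into convergence.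
  The number of time steps may depend on the solution in an uncontrolled way, since it does not enter
  the size of the networks.

  The scheme is solved by multilevel Picard iteration. Instead of keeping the samples random, at
  every level and every time one fixes samples that are at least as good as the average with respect to
  the squared error at a walk started uniformly in the cube; the Picard iterates are then themselves
  deterministic networks and enter the next level as such. With \<open>n\<close> levels and basis \<open>n\<close> the squared
  error is \<open>O(c^n / n^n)\<close> and the width is \<open>O((3 n)^n)\<close>, so the size is polynomial in the inverse error.
\<close>

section \<open>Functions realized by networks\<close>

text \<open>The exponents \<open>c d\<close> may depend on \<open>d\<close> in any way, so the
  growth bound on the solution must not reach any constant. It enters only the size of the box in
  the maximum principle, hence only the step size; all quantitative bounds rest on growth that the
  scheme inherits from the given networks. Weights of exponential growth dominate every power of the
  norm. Two rates are needed: replacing \<open>f\<close> by a ReLU interpolant costs an error of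
  quadratic growth, and squares of \<open>weight d 1\<close> are dominated by
  \<open>weight d 2\<close> up to the factor \<open>d\<close>. Every expectation of the discrete
  walk is a finite uniform average over translations. A translated network is a network of the same
  size, and averages act as positive linear functionals, so no random variables enter. The error at
  step \<open>k\<close> is measured under the law of the walk after \<open>N - k\<close> steps;
  errors at earlier times, averaged back to \<open>k\<close>, are then of the same kind, which
  closes the recursion. The weights cost powers of \<open>d\<close> on the cube, so the data are
  approximated to an accuracy \<open>\<delta>\<close> that is polynomially smaller than
  \<open>\<epsilon>\<close>.\<close>

definition affs :: "('a \<Rightarrow> real) set \<Rightarrow> ('a \<Rightarrow> real) set" where
  "affs G = {F. \<exists>a b. F = (\<lambda>x. b + (\<Sum>\<phi>\<in>G. a \<phi> * \<phi> x))}"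

lemma affs_mono:
  assumes "finite G'" "G \<subseteq> G'" shows "affs G \<subseteq> affs G'"
proof
  fix F assume "F \<in> affs G"
  then obtain a b where F: "F = (\<lambda>x. b + (\<Sum>\<phi>\<in>G. a \<phi> * \<phi> x))" by (auto simp: affs_def)
  have "(\<Sum>\<phi>\<in>G. a \<phi> * \<phi> x) = (\<Sum>\<phi>\<in>G'. (if \<phi> \<in> G then a \<phi> else 0) * \<phi> x)" for x
    by (rule sum.mono_neutral_cong_left) (use assms in auto)
  then show "F \<in> affs G'" unfolding affs_def F
    by (intro CollectI exI[of _ "\<lambda>\<phi>. if \<phi> \<in> G then a \<phi> else 0"] exI[of _ b]) simp
qed

lemma affs_const [simp]: "(\<lambda>x. c) \<in> affs G"
  unfolding affs_def by (intro CollectI exI[of _ "\<lambda>_. 0"] exI[of _ c]) simp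

lemma affs_generator:
  assumes "finite G" "\<phi> \<in> G" shows "\<phi> \<in> affs G"
  unfolding affs_def using assms
  by (intro CollectI exI[of _ "\<lambda>\<psi>. if \<psi> = \<phi> then 1 else 0"] exI[of _ 0]) (simp add: if_distribR if_distrib sum.delta cong: if_cong)

lemma affs_lin:
  assumes "F \<in> affs G" "F' \<in> affs G" shows "(\<lambda>x. s * F x + t * F' x + c) \<in> affs G"
proof -
  obtain a b where F: "F = (\<lambda>x. b + (\<Sum>\<phi>\<in>G. a \<phi> * \<phi> x))" using assms by (auto simp: affs_def)
  obtain a' b' where F': "F' = (\<lambda>x. b' + (\<Sum>\<phi>\<in>G. a' \<phi> * \<phi> x))" using assms by (auto simp: affs_def)
  show ?thesis unfolding affs_def
    by (intro CollectI exI[of _ "\<lambda>\<phi>. s * a \<phi> + t * a' \<phi>"] exI[of _ "s * b + t * b' + c"])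
       (auto simp: F F' algebra_simps sum.distrib sum_distrib_left)
qed

lemma affs_sum:
  assumes "\<And>i. i \<in> I \<Longrightarrow> F i \<in> affs G" shows "(\<lambda>x. b + (\<Sum>i\<in>I. a i * F i x)) \<in> affs G"
  using assms
proof (induction I rule: infinite_finite_induct)
  case (insert i I)
  show ?case using affs_lin[OF insert.IH insert.prems(1)[of i], of 1 "a i" 0] insert
    by (simp add: algebra_simps)
qed auto

lemma affs_comp:
  assumes "F \<in> affs G" "\<And>\<phi>. \<phi> \<in> G \<Longrightarrow> (\<lambda>x. \<phi> (s x)) \<in> affs G'"
  shows "(\<lambda>x. F (s x)) \<in> affs G'"
proof -
  obtain a b where F: "F = (\<lambda>x. b + (\<Sum>\<phi>\<in>G. a \<phi> * \<phi> x))" using assms by (auto simp: affs_def)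
  show ?thesis unfolding F using affs_sum[of G "\<lambda>\<phi> x. \<phi> (s x)"] assms(2) by auto
qed

abbreviation coords :: "nat \<Rightarrow> ((nat \<Rightarrow> real) \<Rightarrow> real) set" where
  "coords d \<equiv> (\<lambda>i x. x i) ` {..<d}"

text \<open>
  A layer is the set of the functions of the input that its neurons compute, so that networks in parallel
  are unions of such sets.
\<close>

inductive features :: "nat \<Rightarrow> nat \<Rightarrow> nat \<Rightarrow> ((nat \<Rightarrow> real) \<Rightarrow> real) set \<Rightarrow> bool" for d W where
  features_0: "features d W 0 (coords d)"
| features_Suc: "features d W h G \<Longrightarrow> finite G' \<Longrightarrow> card G' \<le> W \<Longrightarrow>
     (\<And>\<psi>. \<psi> \<in> G' \<Longrightarrow> \<exists>\<phi>\<in>affs G. \<psi> = (\<lambda>x. max (\<phi> x) 0)) \<Longrightarrow> features d W (Suc h) G'"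

inductive_cases features_0E: "features d W 0 G"
inductive_cases features_SucE: "features d W (Suc h) G"

text \<open>\<open>W\<close> bounds each hidden layer and \<open>h\<close> counts the hidden layers.
  Input coordinates are not charged to \<open>W\<close>, whence the summand \<open>d\<close> in the
  parameter count of \<open>nn_network\<close>.\<close>

definition nn :: "nat \<Rightarrow> nat \<Rightarrow> nat \<Rightarrow> ((nat \<Rightarrow> real) \<Rightarrow> real) set" where
  "nn d W h = {F. \<exists>G. features d W h G \<and> F \<in> affs G}"

lemma features_finite: "features d W h G \<Longrightarrow> finite G"
  by (induction rule: features.induct) auto

lemma features_mono: "features d W h G \<Longrightarrow> W \<le> W' \<Longrightarrow> features d W' h G"
  by (induction rule: features.induct) (auto intro: features.intros)

lemma nn_mono: "F \<in> nn d W h \<Longrightarrow> W \<le> W' \<Longrightarrow> F \<in> nn d W' h"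
  unfolding nn_def using features_mono by blast

text \<open>Both networks start from the same set \<open>coords d\<close>, so only hidden neurons
  add up; neurons computing the same function merge in the union.\<close>

lemma features_Un:
  "features d W h G \<Longrightarrow> features d W' h G' \<Longrightarrow> features d (W + W') h (G \<union> G')"
proof (induction h arbitrary: G G')
  case 0
  then show ?case by (auto elim!: features_0E intro: features_0)
next
  case (Suc h)
  from Suc.prems(1) obtain G1 where 1: "features d W h G1" "finite G" "card G \<le> W"
    "\<And>\<psi>. \<psi> \<in> G \<Longrightarrow> \<exists>\<phi>\<in>affs G1. \<psi> = (\<lambda>x. max (\<phi> x) 0)" by (auto elim: features_SucE)
  from Suc.prems(2) obtain G2 where 2: "features d W' h G2" "finite G'" "card G' \<le> W'"
    "\<And>\<psi>. \<psi> \<in> G' \<Longrightarrow> \<exists>\<phi>\<in>affs G2. \<psi> = (\<lambda>x. max (\<phi> x) 0)" by (auto elim: features_SucE)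
  have fin: "finite (G1 \<union> G2)" using 1 2 features_finite by blast
  have sub: "affs G1 \<subseteq> affs (G1 \<union> G2)" "affs G2 \<subseteq> affs (G1 \<union> G2)"
    by (rule affs_mono[OF fin]; blast)+
  show ?case
  proof (rule features_Suc[OF Suc.IH[OF 1(1) 2(1)]])
    show "card (G \<union> G') \<le> W + W'" using card_Un_le[of G G'] 1(3) 2(3) by linarith
    show "\<exists>\<phi>\<in>affs (G1 \<union> G2). \<psi> = (\<lambda>x. max (\<phi> x) 0)" if "\<psi> \<in> G \<union> G'" for \<psi>
      using that 1(4)[of \<psi>] 2(4)[of \<psi>] sub by blast
  qed (use 1 2 in auto)
qed

lemma nn_add:
  assumes "F \<in> nn d W h" "F' \<in> nn d W' h"
  shows "(\<lambda>x. s * F x + t * F' x + c) \<in> nn d (W + W') h"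
proof -
  obtain G where G: "features d W h G" "F \<in> affs G" using assms by (auto simp: nn_def)
  obtain G' where G': "features d W' h G'" "F' \<in> affs G'" using assms by (auto simp: nn_def)
  have U: "features d (W + W') h (G \<union> G')" by (rule features_Un[OF G(1) G'(1)])
  have "F \<in> affs (G \<union> G')" "F' \<in> affs (G \<union> G')"
    using G(2) G'(2) affs_mono[OF features_finite[OF U]] by blast+
  with U show ?thesis unfolding nn_def using affs_lin by blast
qed

text \<open>The output map supplies the constant and all hidden layers may be empty; width 0 makes
  this the start of \<open>nn_sum\<close>.\<close>

lemma nn_const: "(\<lambda>x. c) \<in> nn d 0 h"
proof -
  have "\<exists>G. features d 0 h G"
  proof (cases h)
    case (Suc k)
    have "features d 0 h {}" if "h > 0" for h using that
    proof (induction h rule: nat_induct_non_zero)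
      case 1 show ?case using features_Suc[OF features_0, of "{}" 0 d] by simp
    next
      case (Suc n) then show ?case using features_Suc[of d 0 n "{}" "{}"] by simp
    qed
    then show ?thesis using Suc by blast
  qed (auto intro: features_0)
  then show ?thesis by (auto simp: nn_def)
qed

lemma nn_sum:
  assumes "finite I" "\<And>i. i \<in> I \<Longrightarrow> F i \<in> nn d (W i) h"
  shows "(\<lambda>x. c + (\<Sum>i\<in>I. a i * F i x)) \<in> nn d (\<Sum>i\<in>I. W i) h"
  using assms
proof (induction I rule: finite_induct)
  case empty then show ?case using nn_const by simp
next
  case (insert i I)
  have "(\<lambda>x. a i * F i x + 1 * (c + (\<Sum>i\<in>I. a i * F i x)) + 0) \<in> nn d (W i + sum W I) h"
    by (rule nn_add) (use insert in auto)
  then show ?case using insert by (simp add: algebra_simps)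
qed

abbreviation (input) shift :: "(nat \<Rightarrow> real) \<Rightarrow> (nat \<Rightarrow> real) \<Rightarrow> (nat \<Rightarrow> real)" where
  "shift z x \<equiv> (\<lambda>i. x i + z i)"

text \<open>A translation of the input is absorbed into the biases of the first affine map, so it
  costs neither width nor depth. The claim speaks of \<open>affs G'\<close> because at depth 0 a
  shifted coordinate is no longer a generator.\<close>

lemma features_shift:
  assumes "features d W h G"
  shows "\<exists>G'. features d W h G' \<and> (\<forall>\<phi>\<in>G. (\<lambda>x. \<phi> (shift z x)) \<in> affs G')"
  using assms
proof (induction rule: features.induct)
  case features_0
  have "(\<lambda>x. x i + z i) \<in> affs (coords d)" if "i < d" for i
    using affs_lin[of "\<lambda>x. x i" "coords d" "\<lambda>x. x i" 1 0 "z i"] affs_generator[of "coords d" "\<lambda>x. x i"] that by auto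
  then show ?case using features.features_0 by blast
next
  case (features_Suc h G G')
  then obtain H where H: "features d W h H" "\<forall>\<phi>\<in>G. (\<lambda>x. \<phi> (shift z x)) \<in> affs H" by blast
  let ?G = "(\<lambda>\<psi> x. \<psi> (shift z x)) ` G'"
  have "features d W (Suc h) ?G"
  proof (rule features.features_Suc[OF H(1)])
    show "finite ?G" using features_Suc by simp
    show "card ?G \<le> W" using card_image_le[OF features_Suc.hyps(2)] features_Suc.hyps(3) le_trans by blast
    fix \<psi> assume "\<psi> \<in> ?G"
    then obtain \<psi>' where p: "\<psi>' \<in> G'" "\<psi> = (\<lambda>x. \<psi>' (shift z x))" by blast
    then obtain \<phi> where f: "\<phi> \<in> affs G" "\<psi>' = (\<lambda>x. max (\<phi> x) 0)" using features_Suc.hyps(4) by blast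
    show "\<exists>\<phi>\<in>affs H. \<psi> = (\<lambda>x. max (\<phi> x) 0)"
      using affs_comp[OF f(1), of "shift z" H] H(2) p f by auto
  qed
  moreover have "\<forall>\<phi>\<in>G'. (\<lambda>x. \<phi> (shift z x)) \<in> affs ?G"
    using affs_generator[of ?G] features_Suc.hyps(2) by auto
  ultimately show ?case by blast
qed

lemma nn_shift:
  assumes "F \<in> nn d W h" shows "(\<lambda>x. F (shift z x)) \<in> nn d W h"
proof -
  obtain G where G: "features d W h G" "F \<in> affs G" using assms by (auto simp: nn_def)
  obtain G' where G': "features d W h G'" "\<forall>\<phi>\<in>G. (\<lambda>x. \<phi> (shift z x)) \<in> affs G'"
    using features_shift[OF G(1)] by blast
  have "(\<lambda>x. F (shift z x)) \<in> affs G'" by (rule affs_comp[OF G(2)]) (use G' in auto)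
  then show ?thesis using G'(1) by (auto simp: nn_def)
qed

text \<open>Scalar networks with one hidden layer of width \<open>m\<close>, the form in which a
  nonlinearity can be appended to a network.\<close>

definition relu_sum :: "nat \<Rightarrow> (real \<Rightarrow> real) \<Rightarrow> bool" where
  "relu_sum m f \<longleftrightarrow> (\<exists>b a s t. f = (\<lambda>v. b + (\<Sum>i<m. a i * max (s i * v + t i) 0)))"

text \<open>The output map of \<open>F\<close> and the inner maps \<open>s i * v + t i\<close> merge
  into one affine map, so composition costs a single layer.\<close>

lemma nn_compose:
  assumes F: "F \<in> nn d W h" and f: "relu_sum m f" and "m \<le> W"
  shows "(\<lambda>x. f (F x)) \<in> nn d W (Suc h)"
proof -
  obtain G where G: "features d W h G" "F \<in> affs G" using F by (auto simp: nn_def)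
  obtain b a s t where feq: "f = (\<lambda>v. b + (\<Sum>i<m. a i * max (s i * v + t i) 0))"
    using f by (auto simp: relu_sum_def)
  define \<psi> where "\<psi> = (\<lambda>i x. max (s i * F x + t i) 0)"
  have "features d W (Suc h) (\<psi> ` {..<m})"
  proof (rule features_Suc[OF G(1)])
    show "card (\<psi> ` {..<m}) \<le> W" using card_image_le[of "{..<m}" \<psi>] assms(3) by simp
    fix \<psi>' assume "\<psi>' \<in> \<psi> ` {..<m}"
    then obtain i where "\<psi>' = \<psi> i" by auto
    then show "\<exists>\<phi>\<in>affs G. \<psi>' = (\<lambda>x. max (\<phi> x) 0)"
      unfolding \<psi>_def using affs_lin[OF G(2) G(2), of "s i" 0 "t i"] by auto
  qed simp
  moreover have "(\<lambda>x. f (F x)) \<in> affs (\<psi> ` {..<m})"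
    using affs_sum[of "{..<m}" \<psi> "\<psi> ` {..<m}" b a] affs_generator[of "\<psi> ` {..<m}"]
    by (auto simp: feq \<psi>_def)
  ultimately show ?thesis by (auto simp: nn_def)
qed

text \<open>\<open>v\<close> is its positive part minus its negative part; the signs 1 and -1 serve
  both as inner slopes and as outer weights.\<close>

lemma relu_sum_id: "relu_sum 2 (\<lambda>v. v)"
  unfolding relu_sum_def
  by (intro exI[of _ 0] exI[of _ "\<lambda>i. if i = 0 then 1 else -1"] exI[of _ "\<lambda>_. 0"])
     (auto simp: eval_nat_numeral fun_eq_iff max_def)

text \<open>Identity layers of width 2 bring networks to a common depth, which \<open>nn_add\<close>
  and \<open>nn_sum\<close> require.\<close>

lemma nn_pad:
  assumes "F \<in> nn d W h" "2 \<le> W" "h \<le> h'" shows "F \<in> nn d W h'"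
  using assms(3) by (induction rule: dec_induct) (use nn_compose[OF _ relu_sum_id] assms in auto)

lemma nn_continuous:
  assumes "F \<in> nn d W h" shows "continuous_on UNIV F"
proof -
  have aff: "continuous_on UNIV F" if FG: "F \<in> affs G" "\<forall>\<phi>\<in>G. continuous_on UNIV \<phi>"
    for F :: "(nat \<Rightarrow> real) \<Rightarrow> real" and G
  proof -
    obtain a b where F: "F = (\<lambda>x. b + (\<Sum>\<phi>\<in>G. a \<phi> * \<phi> x))" using FG(1) by (auto simp: affs_def)
    show ?thesis unfolding F using FG(2) by (intro continuous_intros) auto
  qed
  have "\<forall>\<phi>\<in>G. continuous_on UNIV \<phi>" if "features d W h G" for G using that
  proof (induction rule: features.induct)
    case features_0 then show ?case by auto
  next
    case (features_Suc h G G')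
    show ?case
    proof
      fix \<psi> assume "\<psi> \<in> G'"
      then obtain \<phi> where "\<phi> \<in> affs G" "\<psi> = (\<lambda>x. max (\<phi> x) 0)" using features_Suc by blast
      then show "continuous_on UNIV \<psi>" using aff[of \<phi> G] features_Suc.IH by (auto intro: continuous_intros)
    qed
  qed
  then show ?thesis using assms aff unfolding nn_def by blast
qed

section \<open>Passage between sets of neurons and lists of layers\<close>

fun hidden :: "layer list \<Rightarrow> (nat \<Rightarrow> real) \<Rightarrow> (nat \<Rightarrow> real)" where
  "hidden [] x = x"
| "hidden (l # ls) x = hidden ls (relu (dim_row (fst l)) (affine_layer l x))"

lemma realization_snoc: "realization (ls @ [l]) x = affine_layer l (hidden ls x)"
proof (induction ls arbitrary: x)
  case (Cons a ls) then show ?case by (cases ls) auto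
qed simp

lemma hidden_snoc:
  "hidden (ls @ [l]) x = relu (dim_row (fst l)) (affine_layer l (hidden ls x))"
  by (induction ls arbitrary: x) auto

lemma layer_dims:
  assumes "l \<in> carrier_mat r c \<times> B" shows "dim_row (fst l) = r" "dim_col (fst l) = c"
  using assms by auto

text \<open>Coefficients indexed by functions become a matrix row indexed by positions in the state
  \<open>st x\<close>; positions that \<open>idx\<close> does not reach get coefficient 0.\<close>

lemma affs_row:
  assumes G: "finite G" "inj_on idx G" "idx ` G \<subseteq> {..<k}" "\<And>\<phi> x. \<phi> \<in> G \<Longrightarrow> \<phi> x = st x (idx \<phi>)"
    and F: "F \<in> affs G"
  shows "\<exists>r b. \<forall>x. F x = (\<Sum>j<(k::nat). r j * st x j) + (b :: real)"
proof -
  obtain a b where Feq: "F = (\<lambda>x. b + (\<Sum>\<phi>\<in>G. a \<phi> * \<phi> x))" using F by (auto simp: affs_def)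
  define r where "r = (\<lambda>j. if j \<in> idx ` G then a (the_inv_into G idx j) else 0)"
  have "(\<Sum>\<phi>\<in>G. a \<phi> * \<phi> x) = (\<Sum>j<k. r j * st x j)" for x
  proof -
    have "(\<Sum>\<phi>\<in>G. a \<phi> * \<phi> x) = (\<Sum>\<phi>\<in>G. r (idx \<phi>) * st x (idx \<phi>))"
      by (rule sum.cong) (simp_all add: G(4)[of _ x, symmetric] r_def the_inv_into_f_f[OF G(2)])
    also have "\<dots> = (\<Sum>j\<in>idx ` G. r j * st x j)"
      using sum.reindex[OF G(2), of "\<lambda>j. r j * st x j"] by simp
    also have "\<dots> = (\<Sum>j<k. r j * st x j)"
      by (rule sum.mono_neutral_left) (use G(3) in \<open>auto simp: r_def\<close>)
    finally show ?thesis .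
  qed
  then show ?thesis unfolding Feq by (intro exI[of _ r] exI[of _ b]) simp
qed

text \<open>All hidden layers are brought to the same width \<open>W\<close>, so that dimensions
  need no bookkeeping; \<open>idx\<close> tells which position of the state carries which
  function.\<close>

lemma features_hidden:
  assumes "features d W h G" "1 \<le> W"
  shows "\<exists>ls idx. length ls = h \<and>
     (\<forall>n<h. ls ! n \<in> carrier_mat W (if n = 0 then d else W) \<times> Rd W) \<and> inj_on idx G \<and>
     idx ` G \<subseteq> {..<(if h = 0 then d else W)} \<and> (\<forall>\<phi>\<in>G. \<forall>x. \<phi> x = hidden ls x (idx \<phi>))"
  using assms(1)
proof (induction rule: features.induct)
  case features_0
  define idx :: "((nat \<Rightarrow> real) \<Rightarrow> real) \<Rightarrow> nat" where "idx \<phi> = (SOME i. i < d \<and> \<phi> = (\<lambda>x. x i))" for \<phi>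
  have idx: "idx \<phi> < d \<and> \<phi> = (\<lambda>x. x (idx \<phi>))" if "\<phi> \<in> coords d" for \<phi>
    using that someI_ex[of "\<lambda>i. i < d \<and> \<phi> = (\<lambda>x. x i)"] unfolding idx_def by blast
  have "inj_on idx (coords d)"
  proof (rule inj_onI)
    fix \<phi> \<psi> assume "\<phi> \<in> coords d" "\<psi> \<in> coords d" "idx \<phi> = idx \<psi>"
    then show "\<phi> = \<psi>" using idx[of \<phi>] idx[of \<psi>] by metis
  qed
  moreover have "\<forall>\<phi>\<in>coords d. \<forall>x. \<phi> x = x (idx \<phi>)" using idx by metis
  ultimately show ?case using idx by (intro exI[of _ "[]"] exI[of _ idx]) (auto simp: image_subset_iff)
next
  case (features_Suc h G G')
  let ?k = "if h = 0 then d else W"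
  from features_Suc.IH obtain ls idx where ls: "length ls = h"
     "\<forall>n<h. ls ! n \<in> carrier_mat W (if n = 0 then d else W) \<times> Rd W" and idx: "inj_on idx G"
     "idx ` G \<subseteq> {..<?k}" "\<forall>\<phi>\<in>G. \<forall>x. \<phi> x = hidden ls x (idx \<phi>)" by blast
  obtain e where e: "bij_betw e G' {0..<card G'}" using ex_bij_betw_finite_nat[OF features_Suc.hyps(2)] by blast
  have "\<exists>r b. \<forall>x. \<psi> x = max ((\<Sum>j<?k. r j * hidden ls x j) + b) 0" if \<psi>: "\<psi> \<in> G'" for \<psi>
  proof -
    obtain \<phi> where p: "\<phi> \<in> affs G" "\<psi> = (\<lambda>x. max (\<phi> x) 0)" using features_Suc.hyps(4)[OF \<psi>] by blast
    have "\<exists>r b. \<forall>x. \<phi> x = (\<Sum>j<?k. r j * hidden ls x j) + b"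
      by (rule affs_row[OF features_finite[OF features_Suc.hyps(1)] idx(1,2) _ p(1)]) (use idx in blast)
    then show ?thesis unfolding p(2) by metis
  qed
  then obtain r b where rb: "\<And>\<psi> x. \<psi> \<in> G' \<Longrightarrow> \<psi> x = max ((\<Sum>j<?k. r \<psi> j * hidden ls x j) + b \<psi>) 0" by metis
  \<comment> \<open>Rows outside the range of \<open>e\<close> are padding with arbitrary entries.
    This is harmless: \<open>e\<close> never points to them, and \<open>affs_row\<close> reads them
    with coefficient 0.\<close>
  define e' where "e' = the_inv_into G' e"
  define A where "A = mat W ?k (\<lambda>(i, j). r (e' i) j)"
  define B where "B = (\<lambda>i\<in>{..<W}. b (e' i))"
  have eW: "e \<psi> < W" if "\<psi> \<in> G'" for \<psi>
    using bij_betwE[OF e] that features_Suc.hyps(3) by fastforce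
  have e': "e' (e \<psi>) = \<psi>" if "\<psi> \<in> G'" for \<psi>
    unfolding e'_def using e that by (simp add: bij_betw_def the_inv_into_f_f)
  have val: "\<psi> x = hidden (ls @ [(A, B)]) x (e \<psi>)" if "\<psi> \<in> G'" for \<psi> x
  proof -
    have "(\<Sum>j<?k. A $$ (e \<psi>, j) * hidden ls x j) = (\<Sum>j<?k. r \<psi> j * hidden ls x j)"
      unfolding A_def using eW[OF that] e'[OF that] by (intro sum.cong) (simp_all split del: if_split)
    moreover have "dim_col A = ?k" "dim_row A = W" "B (e \<psi>) = b \<psi>"
      using eW[OF that] e'[OF that] by (simp_all add: A_def B_def split del: if_split)
    ultimately show ?thesis unfolding hidden_snoc relu_def affine_layer_def rb[OF that, of x]
      using eW[OF that] by (simp split del: if_split)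
  qed
  have carr: "(ls @ [(A, B)]) ! n \<in> carrier_mat W (if n = 0 then d else W) \<times> Rd W" if "n < Suc h" for n
  proof (cases "n = h")
    case True then show ?thesis using ls(1) by (auto simp: A_def B_def nth_append)
  next
    case False
    then have "n < h" "(ls @ [(A, B)]) ! n = ls ! n" using that ls(1) by (simp_all add: nth_append)
    with ls(2)[rule_format, of n] show ?thesis by (simp only:)
  qed
  show ?case
  proof (intro exI[of _ "ls @ [(A, B)]"] exI[of _ e] conjI)
    show "\<forall>\<psi>\<in>G'. \<forall>x. \<psi> x = hidden (ls @ [(A, B)]) x (e \<psi>)" using val by blast
    show "\<forall>n<Suc h. (ls @ [(A, B)]) ! n \<in> carrier_mat W (if n = 0 then d else W) \<times> Rd W"
      using carr by blast
    show "e ` G' \<subseteq> {..<(if Suc h = 0 then d else W)}" using eW by auto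
    show "inj_on e G'" using e by (simp add: bij_betw_def)
  qed (use ls(1) in simp)
qed

lemma continuous_restrict_fun: "continuous_on S (\<lambda>x :: nat \<Rightarrow> real. restrict x A)"
proof (rule continuous_on_coordinatewise_then_product)
  fix i show "continuous_on S (\<lambda>x :: nat \<Rightarrow> real. restrict x A i)"
    by (cases "i \<in> A") (auto intro: continuous_on_product_coordinates continuous_on_subset)
qed

text \<open>There are \<open>h + 1\<close> matrices with at most \<open>W\<close> rows; the first
  has \<open>d\<close> columns and the others have \<open>W\<close>, both at most
  \<open>W + d\<close>.\<close>

lemma nn_network:
  assumes F: "F \<in> nn d W h" and "1 \<le> d" "1 \<le> W" "1 \<le> h"
  shows "\<exists>\<Phi>\<in>networks. realization_in_C d 1 \<Phi> \<and> (\<forall>x. scalar_realization \<Phi> x = F x) \<and>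
     num_params \<Phi> \<le> (h + 1) * (W * (W + d + 1))"
proof -
  obtain G where G: "features d W h G" "F \<in> affs G" using F by (auto simp: nn_def)
  obtain ls idx where ls: "length ls = h"
     "\<forall>n<h. ls ! n \<in> carrier_mat W (if n = 0 then d else W) \<times> Rd W" and idx: "inj_on idx G"
     "idx ` G \<subseteq> {..<(if h = 0 then d else W)}" "\<forall>\<phi>\<in>G. \<forall>x. \<phi> x = hidden ls x (idx \<phi>)"
    using features_hidden[OF G(1) assms(3)] by blast
  have "\<exists>r b. \<forall>x. F x = (\<Sum>j<W. r j * hidden ls x j) + b"
    by (rule affs_row[OF features_finite[OF G(1)] idx(1) _ _ G(2)]) (use idx assms(4) in auto)
  then obtain r b where rb: "\<And>x. F x = (\<Sum>j<W. r j * hidden ls x j) + b" by blast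
  define l where "l = (mat 1 W (\<lambda>(i, j). r j), \<lambda>i\<in>{..<1::nat}. b)"
  define \<Phi> where "\<Phi> = ls @ [l]"
  define k where "k n = (if n = 0 then d else if n \<le> h then W else 1)" for n
  have nth: "\<Phi> ! n \<in> carrier_mat (k (n + 1)) (k n) \<times> Rd (k (n + 1))" if "n < h + 1" for n
  proof (cases "n = h")
    case True then show ?thesis using ls(1) assms(4) by (auto simp: \<Phi>_def k_def nth_append l_def)
  next
    case False
    then have "n < h" using that by simp
    then have "\<Phi> ! n = ls ! n" "k (n + 1) = W" "k n = (if n = 0 then d else W)"
      using ls(1) by (simp_all add: \<Phi>_def k_def nth_append)
    with ls(2)[rule_format, OF \<open>n < h\<close>] show ?thesis by (simp only:)
  qed
  have len: "length \<Phi> = h + 1" using ls(1) by (simp add: \<Phi>_def)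
  have net: "\<Phi> \<in> networks" unfolding networks_def
    using nth len assms by (auto intro!: bexI[of _ h] exI[of _ k] simp: k_def)
  have real: "realization \<Phi> x = (\<lambda>i\<in>{..<1::nat}. F x)" for x
    unfolding \<Phi>_def realization_snoc rb
    by (auto simp: affine_layer_def l_def restrict_def fun_eq_iff)
  have "hd \<Phi> = \<Phi> ! 0" using len by (simp add: hd_conv_nth flip: length_greater_0_conv)
  then have ind: "in_dim \<Phi> = d" using layer_dims(2)[OF nth[of 0]] by (simp add: in_dim_def k_def)
  have outd: "out_dim \<Phi> = 1" by (simp add: out_dim_def \<Phi>_def l_def)
  have "continuous_on (Rd d) (\<lambda>x. F x)" using nn_continuous[OF F] continuous_on_subset by blast
  then have "continuous_on (Rd d) (\<lambda>x. \<lambda>i\<in>{..<1::nat}. F x)"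
    by (intro continuous_on_coordinatewise_then_product, rename_tac i, case_tac "i = 0")
       (auto simp: restrict_def)
  then have inC: "realization_in_C d 1 \<Phi>" unfolding realization_in_C_def using ind outd real by auto
  have "num_params \<Phi> \<le> (\<Sum>l\<leftarrow>\<Phi>. W * (W + d + 1))"
    unfolding num_params_def
  proof (rule sum_list_mono)
    fix l' assume "l' \<in> set \<Phi>"
    then obtain n where n: "n < h + 1" "l' = \<Phi> ! n" using len by (metis in_set_conv_nth)
    have "dim_row (fst l') = k (n + 1)" "dim_col (fst l') = k n"
      using layer_dims[OF nth[OF n(1)]] n(2) by simp_all
    moreover have "k (n + 1) \<le> W" "k n \<le> W + d" using assms by (auto simp: k_def)
    ultimately show "(case l' of (W, B) \<Rightarrow> dim_row W * (dim_col W + 1)) \<le> W * (W + d + 1)"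
      by (auto simp: case_prod_beta simp del: mult_Suc_right intro!: mult_mono)
  qed
  also have "\<dots> = (h + 1) * (W * (W + d + 1))" by (simp add: sum_list_triv len)
  finally show ?thesis using net inC real by (auto intro!: bexI[of _ \<Phi>])
qed

text \<open>Induction from the input side: \<open>st\<close> is the state produced by the
  \<open>h\<close> layers already absorbed, with components in the affine span of their neurons.
  Only the dimensions strictly between the ends of \<open>ls\<close> are charged to
  \<open>W\<close>.\<close>

lemma realization_nn:
  assumes "\<And>n. n < length ls \<Longrightarrow> ls ! n \<in> carrier_mat (k (n + 1)) (k n) \<times> B n" "ls \<noteq> []"
    and "features d W h G" "\<And>j. j < k 0 \<Longrightarrow> (\<lambda>x. st x j) \<in> affs G"
    and "\<And>n. 1 \<le> n \<Longrightarrow> n < length ls \<Longrightarrow> k n \<le> W" "i < k (length ls)"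
  shows "(\<lambda>x. realization ls (st x) i) \<in> nn d W (h + length ls - 1)"
  using assms
proof (induction ls arbitrary: k B st h G)
  case (Cons l ls)
  have l: "fst l \<in> carrier_mat (k 1) (k 0)" using Cons.prems(1)[of 0] by auto
  have aff: "(\<lambda>x. affine_layer l (st x) j) \<in> affs G" if "j < k 1" for j
  proof -
    have "(\<lambda>x. snd l j + (\<Sum>m<k 0. fst l $$ (j, m) * st x m)) \<in> affs G"
      using affs_sum[of "{..<k 0}" "\<lambda>m x. st x m"] Cons.prems(4) by auto
    moreover have "(\<lambda>x. affine_layer l (st x) j) = (\<lambda>x. snd l j + (\<Sum>m<k 0. fst l $$ (j, m) * st x m))"
      using l that by (auto simp: affine_layer_def case_prod_beta fun_eq_iff)
    ultimately show ?thesis by simp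
  qed
  show ?case
  proof (cases ls)
    case Nil
    then show ?thesis using aff[of i] Cons.prems(3,6) by (auto simp: nn_def)
  next
    case (Cons l' ls')
    define st' where "st' x = relu (dim_row (fst l)) (affine_layer l (st x))" for x
    define G' where "G' = (\<lambda>j x. st' x j) ` {..<k 1}"
    have st': "st' x j = max (affine_layer l (st x) j) 0" if "j < k 1" for x j
      using l that by (auto simp: st'_def relu_def)
    have feat: "features d W (Suc h) G'"
    proof (rule features_Suc[OF Cons.prems(3)])
      show "card G' \<le> W" unfolding G'_def using card_image_le[of "{..<k 1}" "\<lambda>j x. st' x j"]
          Cons.prems(5)[of 1] Cons by simp
      show "\<exists>\<phi>\<in>affs G. \<psi> = (\<lambda>x. max (\<phi> x) 0)" if "\<psi> \<in> G'" for \<psi>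
        using that aff st' unfolding G'_def by (auto simp: fun_eq_iff)
    qed (simp add: G'_def)
    have "(\<lambda>x. realization ls (st' x) i) \<in> nn d W (Suc h + length ls - 1)"
    proof (rule Cons.IH[of "\<lambda>n. k (Suc n)" "\<lambda>n. B (Suc n)"])
      show "ls ! n \<in> carrier_mat (k (Suc (n + 1))) (k (Suc n)) \<times> B (Suc n)" if "n < length ls" for n
        using Cons.prems(1)[of "Suc n"] that by auto
      show "(\<lambda>x. st' x j) \<in> affs G'" if "j < k (Suc 0)" for j
        by (rule affs_generator) (use that in \<open>auto simp: G'_def\<close>)
    qed (use Cons feat Cons.prems(5,6) in auto)
    then show ?thesis using Cons by (simp add: st'_def)
  qed
qed simp

text \<open>Crude but sufficient: each summand \<open>k (n + 1) * (k n + 1)\<close> of the parameter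
  count is at least 1 and at least \<open>k (n + 1)\<close>, so the count bounds both depth and
  width.\<close>

lemma network_nn:
  assumes "\<Phi> \<in> networks" "realization_in_C d 1 \<Phi>"
  shows "\<exists>h\<le>num_params \<Phi>. 1 \<le> h \<and> scalar_realization \<Phi> \<in> nn d (num_params \<Phi>) h"
proof -
  obtain H k where H: "1 \<le> H" "\<And>n. n \<le> H + 1 \<Longrightarrow> 1 \<le> k n" "length \<Phi> = H + 1"
    "\<And>n. n < H + 1 \<Longrightarrow> \<Phi> ! n \<in> carrier_mat (k (n + 1)) (k n) \<times> Rd (k (n + 1))"
    using assms(1) unfolding networks_def by auto
  have hd: "hd \<Phi> = \<Phi> ! 0" using H(3) by (simp add: hd_conv_nth flip: length_greater_0_conv)
  have k0: "k 0 = d" using assms(2) layer_dims(2)[OF H(4)[of 0]] hd by (simp add: realization_in_C_def in_dim_def)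
  have last: "last \<Phi> = \<Phi> ! H" using H(3) by (simp add: last_conv_nth flip: length_greater_0_conv)
  have kl: "k (H + 1) = 1" using assms(2) layer_dims(1)[OF H(4)[of H]] last by (simp add: realization_in_C_def out_dim_def)
  have np: "num_params \<Phi> = (\<Sum>n<H + 1. k (n + 1) * (k n + 1))"
    unfolding num_params_def sum_list_sum_nth length_map H(3) atLeast0LessThan
  proof (rule sum.cong)
    fix n assume n: "n \<in> {..<H + 1}"
    then show "map (\<lambda>(W, B). dim_row W * (dim_col W + 1)) \<Phi> ! n = k (n + 1) * (k n + 1)"
      using layer_dims[OF H(4)[of n]] H(3) by (simp add: case_prod_beta)
  qed simp
  have kP: "k n \<le> num_params \<Phi>" if n: "1 \<le> n" "n < H + 1" for n
  proof -
    have "k n \<le> k (n - 1 + 1) * (k (n - 1) + 1)" using n by simp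
    also have "\<dots> \<le> num_params \<Phi>" unfolding np by (rule member_le_sum) (use n in auto)
    finally show ?thesis .
  qed
  have "H \<le> (\<Sum>n<H + 1. 1)" by simp
  also have "\<dots> \<le> num_params \<Phi>" unfolding np
  proof (rule sum_mono)
    fix n assume "n \<in> {..<H + 1}"
    then show "1 \<le> k (n + 1) * (k n + 1)" using H(2)[of "n + 1"] by (simp add: Suc_le_eq)
  qed
  finally have HP: "H \<le> num_params \<Phi>" .
  have "(\<lambda>x. realization \<Phi> x 0) \<in> nn d (num_params \<Phi>) (0 + length \<Phi> - 1)"
  proof (rule realization_nn[of \<Phi> k "\<lambda>n. Rd (k (n + 1))" d _ 0 "coords d"])
    show "(\<lambda>x. x j) \<in> affs (coords d)" if "j < k 0" for j
      using affs_generator[of "coords d" "\<lambda>x. x j"] that k0 by auto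
  qed (use H kP kl features_0 in auto)
  then show ?thesis using HP H(1,3) by (intro exI[of _ H]) auto
qed

section \<open>Piecewise linear interpolation\<close>

lemma relu_sum_Suc:
  assumes "relu_sum m f" shows "relu_sum (Suc m) (\<lambda>v. f v + c * max (p * v + q) 0)"
proof -
  obtain b a s t where f: "f = (\<lambda>v. b + (\<Sum>i<m. a i * max (s i * v + t i) 0))"
    using assms by (auto simp: relu_sum_def)
  show ?thesis unfolding relu_sum_def
    by (intro exI[of _ b] exI[of _ "a(m := c)"] exI[of _ "s(m := p)"] exI[of _ "t(m := q)"])
       (simp add: f fun_eq_iff)
qed

text \<open>Linear interpolation on a grid of mesh \<open>\<delta>\<close> covering
  \<open>[- 1 / \<delta>, 1 / \<delta>]\<close>, continued by constants. Beyond the grid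
  \<open>\<bar>v\<bar> \<le> \<delta> * v\<^sup>2\<close>, so the truncation error is of order
  \<open>\<delta>\<close> as well, at the price of quadratic growth. The unchanged Lipschitz
  constant lets the later stability bounds apply to \<open>f'\<close>.\<close>

lemma relu_interpolation:
  fixes f :: "real \<Rightarrow> real"
  assumes lip: "\<And>v w. \<bar>f v - f w\<bar> \<le> \<kappa> * \<bar>v - w\<bar>" and \<delta>: "0 < \<delta>" "\<delta> \<le> 1"
  shows "\<exists>f' m. relu_sum m f' \<and> real m \<le> 8 / \<delta>\<^sup>2 \<and> (\<forall>v w. \<bar>f' v - f' w\<bar> \<le> \<kappa> * \<bar>v - w\<bar>) \<and>
     (\<forall>v. \<bar>f' v - f v\<bar> \<le> 2 * \<kappa> * \<delta> * (1 + v\<^sup>2))"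
proof -
  have \<kappa>: "0 \<le> \<kappa>" using lip[of 1 0] by simp
  define n where "n = nat \<lceil>1 / \<delta>\<^sup>2\<rceil>"
  have n: "1 / \<delta>\<^sup>2 \<le> real n" "real n \<le> 1 / \<delta>\<^sup>2 + 1"
    unfolding n_def by (simp_all add: \<delta> of_nat_nat) 
  have d2: "1 \<le> 1 / \<delta>\<^sup>2" using \<delta> by (simp add: power_le_one)
  define p where "p i = (real i - real n) * \<delta>" for i
  \<comment> \<open>A ramp that climbs from 0 to \<open>\<delta>\<close> between \<open>p i\<close>
    and \<open>p (Suc i)\<close>; it takes two ReLUs, so \<open>2 * n\<close> ramps need
    \<open>4 * n\<close> of them.\<close>
  define \<phi> where "\<phi> i v = max (v - p i) 0 - max (v - p (Suc i)) 0" for i v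
  define s where "s i = (f (p (Suc i)) - f (p i)) / \<delta>" for i
  define f' where "f' v = f (p 0) + (\<Sum>i<2 * n. s i * \<phi> i v)" for v
  have pS: "p (Suc i) = p i + \<delta>" for i by (simp add: p_def algebra_simps)
  have "relu_sum (2 * k) (\<lambda>v. f (p 0) + (\<Sum>i<k. s i * \<phi> i v))" for k
  proof (induction k)
    case 0 show ?case by (auto simp: relu_sum_def)
  next
    case (Suc k)
    show ?case using relu_sum_Suc[OF relu_sum_Suc[OF Suc, of "s k" 1 "- p k"], of "- s k" 1 "- p (Suc k)"]
      by (simp add: \<phi>_def algebra_simps)
  qed
  then have r: "relu_sum (2 * (2 * n)) f'" unfolding f'_def[abs_def] by blast
  have m: "real (2 * (2 * n)) \<le> 8 / \<delta>\<^sup>2" using n d2 by simp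
  have s: "\<bar>s i\<bar> \<le> \<kappa>" for i
    using lip[of "p (Suc i)" "p i"] \<delta> by (simp add: s_def pS abs_divide divide_le_eq)
  \<comment> \<open>The ramps are nondecreasing and add up, up to a constant, to the identity
    clipped to the grid; slopes bounded by \<open>\<kappa>\<close> therefore give a
    \<open>\<kappa>\<close>-Lipschitz sum.\<close>
  have tel: "(\<Sum>i<k. \<phi> i v) = max (v - p 0) 0 - max (v - p k) 0" for k v
    unfolding \<phi>_def by (rule sum_lessThan_telescope')
  have lip1: "\<bar>f' v - f' w\<bar> \<le> \<kappa> * \<bar>v - w\<bar>" if "w \<le> v" for v w
  proof -
    have mono: "\<phi> i w \<le> \<phi> i v" for i using that \<delta> by (auto simp: \<phi>_def pS max_def)
    have "p 0 \<le> p (2 * n)" using \<delta> by (simp add: p_def)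
    have "f' v - f' w = (\<Sum>i<2 * n. s i * (\<phi> i v - \<phi> i w))"
      by (simp add: f'_def right_diff_distrib sum_subtractf)
    also have "\<bar>\<dots>\<bar> \<le> (\<Sum>i<2 * n. \<bar>s i * (\<phi> i v - \<phi> i w)\<bar>)" by (rule sum_abs)
    also have "\<dots> \<le> (\<Sum>i<2 * n. \<kappa> * (\<phi> i v - \<phi> i w))"
      by (rule sum_mono) (use s mono in \<open>auto simp: abs_mult intro!: mult_right_mono\<close>)
    also have "\<dots> = \<kappa> * ((\<Sum>i<2 * n. \<phi> i v) - (\<Sum>i<2 * n. \<phi> i w))"
      by (simp add: sum_subtractf flip: sum_distrib_left)
    also have "\<dots> \<le> \<kappa> * \<bar>v - w\<bar>"
      unfolding tel by (rule mult_left_mono[OF _ \<kappa>]) (use that \<open>p 0 \<le> p (2 * n)\<close> in auto)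
    finally show ?thesis .
  qed
  have lip': "\<bar>f' v - f' w\<bar> \<le> \<kappa> * \<bar>v - w\<bar>" for v w
    using lip1[of v w] lip1[of w v] by (cases "w \<le> v") (auto simp: abs_minus_commute)
  have grid: "f' (p j) = f (p j)" if "j \<le> 2 * n" for j
  proof -
    have pd: "p j - p i = (real j - real i) * \<delta>" for i by (simp add: p_def algebra_simps)
    have v: "\<phi> i (p j) = (if i < j then \<delta> else 0)" for i
    proof (cases "i < j")
      case True
      have "0 \<le> p j - p i" "0 \<le> p j - p (Suc i)" unfolding pd using True \<delta> by auto
      then show ?thesis using True by (simp add: \<phi>_def pS)
    next
      case False
      then have "p j - p i \<le> 0" "p j - p (Suc i) \<le> 0" unfolding pd using \<delta> by (auto simp: mult_nonpos_nonneg)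
      then show ?thesis using False by (simp add: \<phi>_def)
    qed
    have "(\<Sum>i<2 * n. s i * \<phi> i (p j)) = (\<Sum>i<j. f (p (Suc i)) - f (p i))"
      by (rule sum.mono_neutral_cong_right) (use that \<delta> in \<open>auto simp: v s_def\<close>)
    also have "\<dots> = f (p j) - f (p 0)" by (rule sum_lessThan_telescope)
    finally show ?thesis by (simp add: f'_def)
  qed
  \<comment> \<open>Every \<open>v\<close> is compared with a grid point, where \<open>f'\<close>
    and \<open>f\<close> agree: the next lower one inside the grid, an end point outside.\<close>
  have near: "\<exists>j\<le>2 * n. \<bar>v - p j\<bar> \<le> \<delta> * (1 + v\<^sup>2)" for v
  proof -
    define R where "R = real n * \<delta>"
    have R: "1 \<le> R * \<delta>" "0 \<le> R" using n(1) \<delta> by (auto simp: R_def power2_eq_square field_simps)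
    have far: "\<bar>v\<bar> \<le> \<delta> * v\<^sup>2" if "R < \<bar>v\<bar>"
    proof -
      have "\<bar>v\<bar> * 1 \<le> \<bar>v\<bar> * (R * \<delta>)" by (rule mult_left_mono) (use R in auto)
      also have "\<dots> \<le> \<bar>v\<bar> * (\<bar>v\<bar> * \<delta>)" by (rule mult_left_mono) (use that \<delta> in auto)
      also have "\<dots> = \<delta> * v\<^sup>2" by (simp add: power2_eq_square)
      finally show ?thesis by simp
    qed
    consider "v < - R" | "R < v" | "\<bar>v\<bar> \<le> R" by linarith
    then show ?thesis
    proof cases
      case 1
      have "p 0 = - R" by (simp add: p_def R_def)
      then have "\<bar>v - p 0\<bar> \<le> \<delta> * (1 + v\<^sup>2)"
        using 1 R far \<delta> by (auto simp: distrib_left)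
      then show ?thesis by blast
    next
      case 2
      have "p (2 * n) = R" by (simp add: p_def R_def)
      then have "\<bar>v - p (2 * n)\<bar> \<le> \<delta> * (1 + v\<^sup>2)"
        using 2 R far \<delta> by (auto simp: distrib_left)
      then show ?thesis by blast
    next
      case 3
      define y where "y = v / \<delta> + real n"
      have "- real n \<le> v / \<delta>" "v / \<delta> \<le> real n"
        using 3 \<delta> by (auto simp: R_def field_simps abs_le_iff)
      then have y: "0 \<le> y" "y \<le> 2 * real n" by (auto simp: y_def)
      define j where "j = nat \<lfloor>y\<rfloor>"
      have j: "real j \<le> y" "y \<le> real j + 1" using y(1) unfolding j_def by (simp_all add: of_nat_nat)
      have "j \<le> 2 * n" using j(1) y(2) by linarith
      moreover have "v - p j = (y - real j) * \<delta>" using \<delta> by (simp add: y_def p_def field_simps)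
      then have "\<bar>v - p j\<bar> \<le> \<delta>" using j \<delta> by (simp add: abs_mult)
      then have "\<bar>v - p j\<bar> \<le> \<delta> * (1 + v\<^sup>2)" using \<delta> by (simp add: distrib_left add_increasing2)
      ultimately show ?thesis by blast
    qed
  qed
  have "\<bar>f' v - f v\<bar> \<le> 2 * \<kappa> * \<delta> * (1 + v\<^sup>2)" for v
  proof -
    obtain j where j: "j \<le> 2 * n" "\<bar>v - p j\<bar> \<le> \<delta> * (1 + v\<^sup>2)" using near by blast
    have "\<bar>f' v - f v\<bar> \<le> \<bar>f' v - f' (p j)\<bar> + \<bar>f v - f (p j)\<bar>" using grid[OF j(1)] by linarith
    also have "\<dots> \<le> \<kappa> * (\<delta> * (1 + v\<^sup>2)) + \<kappa> * (\<delta> * (1 + v\<^sup>2))"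
      using lip'[of v "p j"] lip[of v "p j"] mult_left_mono[OF j(2) \<kappa>] by linarith
    finally show ?thesis by (simp add: algebra_simps)
  qed
  then show ?thesis using r m lip' by blast
qed

section \<open>Derandomized Monte Carlo averages\<close>

abbreviation cont :: "((nat \<Rightarrow> real) \<Rightarrow> real) \<Rightarrow> bool" where "cont F \<equiv> continuous_on UNIV F"

text \<open>An expectation, reduced to linearity and monotonicity on continuous functions; the cube
  integral and the walk averages can then be treated alike.\<close>

definition pos_functional :: "(((nat \<Rightarrow> real) \<Rightarrow> real) \<Rightarrow> real) \<Rightarrow> bool" where
  "pos_functional J \<longleftrightarrow>
     (\<forall>F G a b. cont F \<longrightarrow> cont G \<longrightarrow> J (\<lambda>x. a * F x + b * G x) = a * J F + b * J G) \<and>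
     (\<forall>F G. cont F \<longrightarrow> cont G \<longrightarrow> (\<forall>x. F x \<le> G x) \<longrightarrow> J F \<le> J G)"

lemma pos_functional_mono:
  "pos_functional J \<Longrightarrow> cont F \<Longrightarrow> cont G \<Longrightarrow> (\<And>x. F x \<le> G x) \<Longrightarrow> J F \<le> J G"
  by (auto simp: pos_functional_def)

lemma pos_functional_lin:
  "pos_functional J \<Longrightarrow> cont F \<Longrightarrow> cont G \<Longrightarrow> J (\<lambda>x. a * F x + b * G x) = a * J F + b * J G"
  by (auto simp: pos_functional_def)

lemma pos_functional_cmult: "pos_functional J \<Longrightarrow> cont F \<Longrightarrow> J (\<lambda>x. a * F x) = a * J F"
  using pos_functional_lin[of J F F a 0] by simp

lemma pos_functional_zero: "pos_functional J \<Longrightarrow> J (\<lambda>x. 0) = 0"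
  using pos_functional_cmult[of J "\<lambda>_. 0" 0] by simp

lemma pos_functional_nonneg:
  "pos_functional J \<Longrightarrow> cont F \<Longrightarrow> (\<And>x. 0 \<le> F x) \<Longrightarrow> 0 \<le> J F"
  using pos_functional_mono[of J "\<lambda>_. 0" F] pos_functional_zero[of J] by simp

lemma pos_functional_sum:
  assumes J: "pos_functional J" and "finite A" "\<And>i. i \<in> A \<Longrightarrow> cont (F i)"
  shows "J (\<lambda>x. \<Sum>i\<in>A. c i * F i x) = (\<Sum>i\<in>A. c i * J (F i))"
  using assms(2,3)
proof (induction A rule: finite_induct)
  case empty then show ?case using pos_functional_zero[OF J] by simp
next
  case (insert i A)
  have "J (\<lambda>x. c i * F i x + 1 * (\<Sum>i\<in>A. c i * F i x)) = c i * J (F i) + 1 * J (\<lambda>x. \<Sum>i\<in>A. c i * F i x)"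
    by (rule pos_functional_lin[OF J]) (use insert in \<open>auto intro!: continuous_intros\<close>)
  then show ?case using insert by simp
qed

text \<open>The samples are chosen greedily, the cross terms having average zero at every step.\<close>

lemma monte_carlo:
  fixes F :: "'i \<Rightarrow> (nat \<Rightarrow> real) \<Rightarrow> real"
  assumes J: "pos_functional J" and A: "finite A" "\<And>i. i \<in> A \<Longrightarrow> 0 \<le> p i" "sum p A = 1"
    and F: "\<And>i. i \<in> A \<Longrightarrow> cont (F i)" and "0 < m"
  shows "\<exists>\<theta>. (\<forall>i. i < m \<longrightarrow> \<theta> i \<in> A) \<and>
    J (\<lambda>x. ((\<Sum>i<m. F (\<theta> i) x) / real m - (\<Sum>i\<in>A. p i * F i x))\<^sup>2) \<le> J (\<lambda>x. \<Sum>i\<in>A. p i * (F i x)\<^sup>2) / real m"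
proof -
  define E where "E x = (\<Sum>i\<in>A. p i * F i x)" for x
  define V where "V = J (\<lambda>x. \<Sum>i\<in>A. p i * (F i x)\<^sup>2)"
  have E: "cont E" unfolding E_def[abs_def] using F by (intro continuous_intros) auto
  have "\<exists>\<theta>. (\<forall>i<m. \<theta> i \<in> A) \<and> J (\<lambda>x. (\<Sum>i<m. F (\<theta> i) x - E x)\<^sup>2) \<le> real m * V" for m
  proof (induction m)
    case 0 then show ?case using pos_functional_zero[OF J] by simp
  next
    case (Suc m)
    then obtain \<theta> where \<theta>: "\<And>i. i < m \<Longrightarrow> \<theta> i \<in> A" "J (\<lambda>x. (\<Sum>i<m. F (\<theta> i) x - E x)\<^sup>2) \<le> real m * V" by blast
    define S where "S x = (\<Sum>i<m. F (\<theta> i) x - E x)" for x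
    have S: "cont S" unfolding S_def[abs_def] using F \<theta>(1) E by (intro continuous_intros) auto
    define K where "K a = J (\<lambda>x. (S x + (F a x - E x))\<^sup>2)" for a
    have "(\<Sum>a\<in>A. p a * K a) = J (\<lambda>x. \<Sum>a\<in>A. p a * (S x + (F a x - E x))\<^sup>2)"
      unfolding K_def using F S E by (intro pos_functional_sum[OF J A(1), symmetric]) (auto intro!: continuous_intros)
    also have "\<dots> \<le> J (\<lambda>x. 1 * (S x)\<^sup>2 + 1 * (\<Sum>a\<in>A. p a * (F a x)\<^sup>2))"
    proof (rule pos_functional_mono[OF J])
      fix x
      have "(\<Sum>a\<in>A. p a * (S x + (F a x - E x))\<^sup>2) =
          (\<Sum>a\<in>A. p a * (S x)\<^sup>2 + 2 * S x * (p a * F a x) - 2 * S x * E x * p a + p a * (F a x)\<^sup>2 - 2 * E x * (p a * F a x) + p a * (E x)\<^sup>2)"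
        by (rule sum.cong) (auto simp: power2_eq_square algebra_simps)
      also have "\<dots> = (\<Sum>a\<in>A. p a) * (S x)\<^sup>2 + 2 * S x * E x - 2 * S x * E x * (\<Sum>a\<in>A. p a)
         + (\<Sum>a\<in>A. p a * (F a x)\<^sup>2) - 2 * E x * E x + (\<Sum>a\<in>A. p a) * (E x)\<^sup>2"
        by (simp add: sum.distrib sum_subtractf E_def sum_distrib_left sum_distrib_right)
      \<comment> \<open>The cross terms with \<open>S\<close> cancel because \<open>F a\<close> has
        mean \<open>E\<close>; what is dropped is \<open>- (E x)\<^sup>2\<close>, the variance being
        at most the second moment.\<close>
      also have "\<dots> \<le> 1 * (S x)\<^sup>2 + 1 * (\<Sum>a\<in>A. p a * (F a x)\<^sup>2)"
        unfolding A(3) by (simp add: power2_eq_square)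
      finally show "(\<Sum>a\<in>A. p a * (S x + (F a x - E x))\<^sup>2) \<le> 1 * (S x)\<^sup>2 + 1 * (\<Sum>a\<in>A. p a * (F a x)\<^sup>2)" .
    qed (use F S E in \<open>auto intro!: continuous_intros\<close>)
    also have "\<dots> = J (\<lambda>x. (S x)\<^sup>2) + V" unfolding V_def
      by (subst pos_functional_lin[OF J]) (use F S E in \<open>auto intro!: continuous_intros\<close>)
    also have "\<dots> \<le> real (Suc m) * V" using \<theta>(2) by (simp add: S_def algebra_simps)
    finally have le: "(\<Sum>a\<in>A. p a * K a) \<le> real (Suc m) * V" .
    \<comment> \<open>The \<open>p\<close>-average of \<open>K\<close> obeys the bound, hence so
      does some \<open>K a\<close>: this is the derandomization.\<close>
    have "\<exists>a\<in>A. K a \<le> real (Suc m) * V"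
    proof (rule ccontr)
      assume "\<not> ?thesis"
      then have gt: "\<And>a. a \<in> A \<Longrightarrow> real (Suc m) * V < K a" by auto
      obtain a where a: "a \<in> A" "0 < p a"
        using A by (metis less_eq_real_def sum.neutral zero_neq_one)
      have "(\<Sum>a\<in>A. p a * (real (Suc m) * V)) < (\<Sum>a\<in>A. p a * K a)"
      proof (rule sum_strict_mono_ex1[OF A(1)])
        show "\<forall>a\<in>A. p a * (real (Suc m) * V) \<le> p a * K a"
          using A(2) gt[THEN less_imp_le] by (intro ballI mult_left_mono) auto
        show "\<exists>a\<in>A. p a * (real (Suc m) * V) < p a * K a"
          using a gt[OF a(1)] by (intro bexI[of _ a] mult_strict_left_mono) auto
      qed
      then show False using le by (simp add: A(3) flip: sum_distrib_right)
    qed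
    then obtain a where a: "a \<in> A" "K a \<le> real (Suc m) * V" by blast
    show ?case
      by (intro exI[of _ "\<theta>(m := a)"]) (use \<theta>(1) a in \<open>auto simp: K_def S_def less_Suc_eq\<close>)
  qed
  then obtain \<theta> where \<theta>: "\<And>i. i < m \<Longrightarrow> \<theta> i \<in> A" "J (\<lambda>x. (\<Sum>i<m. F (\<theta> i) x - E x)\<^sup>2) \<le> real m * V" by blast
  have "(\<Sum>i<m. F (\<theta> i) x - E x) / real m = (\<Sum>i<m. F (\<theta> i) x) / real m - E x" for x
    using \<open>0 < m\<close> by (simp add: sum_subtractf diff_divide_distrib)
  then have "((\<Sum>i<m. F (\<theta> i) x) / real m - E x)\<^sup>2 = (1 / (real m)\<^sup>2) * (\<Sum>i<m. F (\<theta> i) x - E x)\<^sup>2" for x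
    by (metis mult.commute mult_1 power_divide times_divide_eq_left)
  moreover have "J (\<lambda>x. (1 / (real m)\<^sup>2) * (\<Sum>i<m. F (\<theta> i) x - E x)\<^sup>2) = (1 / (real m)\<^sup>2) * J (\<lambda>x. (\<Sum>i<m. F (\<theta> i) x - E x)\<^sup>2)"
    by (rule pos_functional_cmult[OF J]) (use F E \<theta>(1) in \<open>auto intro!: continuous_intros\<close>)
  moreover have "\<dots> \<le> (1 / (real m)\<^sup>2) * (real m * V)" by (rule mult_left_mono[OF \<theta>(2)]) simp
  moreover have "\<dots> = V / real m" by (simp add: power2_eq_square)
  ultimately show ?thesis using \<theta>(1) by (intro exI[of _ \<theta>]) (simp add: E_def V_def)
qed

text \<open>The transition operator of a walk with finitely many equally likely increments
  \<open>z i\<close>. Uniform averages, with repetitions allowed, are closed under composition, and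
  translations preserve \<open>nn\<close>.\<close>

definition shift_average :: "(((nat \<Rightarrow> real) \<Rightarrow> real) \<Rightarrow> ((nat \<Rightarrow> real) \<Rightarrow> real)) \<Rightarrow> bool" where
  "shift_average Q \<longleftrightarrow> (\<exists>n z. 0 < n \<and> (\<forall>F x. Q F x = (\<Sum>i<n. F (shift (z i) x)) / real n))"

lemma shift_averageE:
  assumes "shift_average Q"
  obtains n z where "0 < n" "\<And>F x. Q F x = (\<Sum>i<n. F (shift (z i) x)) / real n"
  using assms unfolding shift_average_def by blast

lemma shift_averageI:
  assumes A: "finite A" "A \<noteq> {}" and Q: "\<And>F x. Q F x = (\<Sum>i\<in>A. F (shift (z i) x)) / real (card A)"
  shows "shift_average Q"
proof -
  obtain e where e: "bij_betw e {0..<card A} A" using ex_bij_betw_nat_finite[OF A(1)] by blast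
  have "Q F x = (\<Sum>i<card A. F (shift (z (e i)) x)) / real (card A)" for F x
    unfolding Q using sum.reindex_bij_betw[OF e, of "\<lambda>i. F (shift (z i) x)"] by (simp add: atLeast0LessThan)
  then show ?thesis unfolding shift_average_def using A
    by (intro exI[of _ "card A"] exI[of _ "z \<circ> e"]) (simp add: card_gt_0_iff)
qed

lemma cont_shift: "cont F \<Longrightarrow> cont (\<lambda>x. F (shift z x))"
  by (rule continuous_on_compose2[of UNIV F])
     (auto intro!: continuous_on_coordinatewise_then_product continuous_intros)

context
  fixes Q assumes Q: "shift_average Q"
begin

lemma shift_average_cont: assumes "cont F" shows "cont (Q F)"
proof -
  obtain n z where nz: "0 < n" "\<And>F x. Q F x = (\<Sum>i<n. F (shift (z i) x)) / real n"
    using Q unfolding shift_average_def by blast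
  have "Q F = (\<lambda>x. (\<Sum>i<n. F (shift (z i) x)) / real n)" using nz by blast
  then show ?thesis using nz(1) assms by (auto intro!: continuous_intros cont_shift)
qed

lemma shift_average_lin: "Q (\<lambda>x. a * F x + b * G x) x = a * Q F x + b * Q G x"
  by (rule shift_averageE[OF Q]) (simp add: sum.distrib add_divide_distrib flip: sum_distrib_left)

lemma shift_average_const: "Q (\<lambda>x. c) x = c"
  by (rule shift_averageE[OF Q]) simp

lemma shift_average_cmult: "Q (\<lambda>x. a * F x) x = a * Q F x"
  using shift_average_lin[of a F 0 F] by simp

lemma shift_average_add: "Q (\<lambda>x. F x + G x) x = Q F x + Q G x"
  using shift_average_lin[of 1 F 1 G] by simp

lemma shift_average_diff: "Q (\<lambda>x. F x - G x) x = Q F x - Q G x"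
  using shift_average_lin[of 1 F "- 1" G] by simp

lemma shift_average_sum: "Q (\<lambda>x. \<Sum>i\<in>A. F i x) x = (\<Sum>i\<in>A. Q (F i) x)"
  by (rule shift_averageE[OF Q]) (simp add: sum.swap[of _ _ A] flip: sum_divide_distrib)

lemma shift_average_mono: "(\<And>x. F x \<le> G x) \<Longrightarrow> Q F x \<le> Q G x"
  by (rule shift_averageE[OF Q]) (simp add: divide_right_mono sum_mono)

lemma shift_average_abs: "\<bar>Q F x\<bar> \<le> Q (\<lambda>x. \<bar>F x\<bar>) x"
  by (rule shift_averageE[OF Q]) (simp add: abs_divide divide_right_mono sum_abs)

text \<open>Jensen's inequality: the variance about \<open>Q F x\<close> is nonnegative.\<close>

lemma shift_average_square: "(Q F x)\<^sup>2 \<le> Q (\<lambda>x. (F x)\<^sup>2) x"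
proof -
  define c where "c = Q F x"
  have "0 \<le> Q (\<lambda>y. (F y - c)\<^sup>2) x"
    using shift_average_mono[of "\<lambda>_. 0"] shift_average_const[of 0] by simp
  also have "(\<lambda>y. (F y - c)\<^sup>2) = (\<lambda>y. (1 * (F y)\<^sup>2 + (- 2 * c) * F y) + c\<^sup>2)"
    by (auto simp: power2_eq_square algebra_simps)
  also have "Q (\<lambda>y. (1 * (F y)\<^sup>2 + (- 2 * c) * F y) + c\<^sup>2) x =
      Q (\<lambda>y. 1 * (F y)\<^sup>2 + (- 2 * c) * F y) x + Q (\<lambda>y. c\<^sup>2) x"
    by (rule shift_average_add)
  also have "\<dots> = (1 * Q (\<lambda>y. (F y)\<^sup>2) x + (- 2 * c) * Q F x) + c\<^sup>2"
    by (simp only: shift_average_const shift_average_lin[of 1 "\<lambda>y. (F y)\<^sup>2" "- 2 * c" F])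
  also have "\<dots> = Q (\<lambda>x. (F x)\<^sup>2) x - c\<^sup>2" by (simp add: c_def power2_eq_square)
  finally show ?thesis by (simp add: c_def)
qed

lemma shift_average_comp: assumes "shift_average R" shows "shift_average (\<lambda>F. Q (R F))"
proof -
  obtain n z where nz: "0 < n" "\<And>F x. Q F x = (\<Sum>i<n. F (shift (z i) x)) / real n"
    using Q unfolding shift_average_def by blast
  obtain m y where my: "0 < m" "\<And>F x. R F x = (\<Sum>i<m. F (shift (y i) x)) / real m"
    using assms unfolding shift_average_def by blast
  show ?thesis
  proof (rule shift_averageI)
    show "finite ({..<n} \<times> {..<m})" "{..<n} \<times> {..<m} \<noteq> {}" using nz my by auto
    show "Q (R F) x = (\<Sum>p\<in>{..<n} \<times> {..<m}. F (shift (shift (z (fst p)) (y (snd p))) x)) / real (card ({..<n} \<times> {..<m}))"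
      for F x
      unfolding nz(2) my(2)
      by (simp add: sum.cartesian_product' add_ac flip: sum_divide_distrib)
  qed
qed

lemma shift_average_funpow: "shift_average (Q ^^ m)"
proof (induction m)
  case 0
  show ?case by (rule shift_averageI[of "{0::nat}" _ "\<lambda>_ _. 0"]) auto
next
  case (Suc m) then show ?case using shift_average_comp[of "Q ^^ m"] by (simp add: comp_def)
qed

lemma pos_functional_comp:
  assumes I: "pos_functional I" shows "pos_functional (\<lambda>F. I (Q F))"
  unfolding pos_functional_def
proof (intro conjI allI impI)
  fix F G a b assume "cont F" "cont G"
  moreover have "Q (\<lambda>x. a * F x + b * G x) = (\<lambda>x. a * Q F x + b * Q G x)" using shift_average_lin by blast
  ultimately show "I (Q (\<lambda>x. a * F x + b * G x)) = a * I (Q F) + b * I (Q G)"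
    using pos_functional_lin[OF I] shift_average_cont by simp
next
  fix F G assume "cont F" "cont G" "\<forall>x. F x \<le> G x"
  then show "I (Q F) \<le> I (Q G)" using shift_average_mono shift_average_cont
    by (intro pos_functional_mono[OF I]) auto
qed

end

text \<open>The last term is split off repeatedly with
  \<open>(a + b)\<^sup>2 \<le> 2 * a\<^sup>2 + 2 * b\<^sup>2\<close>. The weights decay towards late
  terms, which matches the growth \<open>D ^ i\<close> of the level errors.\<close>

lemma sum_square_le_geometric:
  fixes x :: "nat \<Rightarrow> real"
  shows "(\<Sum>i<m. x i)\<^sup>2 \<le> (\<Sum>i<m. 2 ^ (m - i) * (x i)\<^sup>2)"
proof (induction m)
  case (Suc m)
  have "(\<Sum>i<Suc m. x i)\<^sup>2 \<le> 2 * (\<Sum>i<m. x i)\<^sup>2 + 2 * (x m)\<^sup>2"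
    using zero_le_power2[of "(\<Sum>i<m. x i) - x m"] by (simp add: power2_eq_square algebra_simps)
  also have "\<dots> \<le> 2 * (\<Sum>i<m. 2 ^ (m - i) * (x i)\<^sup>2) + 2 * (x m)\<^sup>2" using Suc by simp
  also have "\<dots> = (\<Sum>i<m. 2 ^ (Suc m - i) * (x i)\<^sup>2) + 2 * (x m)\<^sup>2"
    by (simp add: sum_distrib_left Suc_diff_le mult.assoc)
  finally show ?case by simp
qed simp

text \<open>Discrete form of the fact that \<open>exp (M * s)\<close> integrates over
  \<open>[0, t]\<close> to at most \<open>exp (M * t) / M\<close>; the induction step is
  \<open>1 + M * h \<le> exp (M * h)\<close>.\<close>

lemma sum_exp_le:
  assumes "0 < (M :: real)" "0 < h"
  shows "h * (\<Sum>j<k. exp (M * (h * real j))) \<le> exp (M * (h * real k)) / M"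
proof (induction k)
  case (Suc k)
  have "h * (\<Sum>j<Suc k. exp (M * (h * real j))) \<le> exp (M * (h * real k)) / M * (1 + M * h)"
    using Suc assms by (simp add: field_simps)
  also have "\<dots> \<le> exp (M * (h * real k)) / M * exp (M * h)"
    using assms exp_ge_add_one_self[of "M * h"] by (intro mult_left_mono) auto
  also have "\<dots> = exp (M * (h * real (Suc k))) / M" by (simp add: algebra_simps flip: exp_add)
  finally show ?case .
qed (use assms in simp)

section \<open>Multilevel Picard approximation\<close>

text \<open>In the application \<open>f\<close> is the ReLU interpolant and \<open>g\<close> the
  realization of a given network, not the data of the equation. \<open>I\<close> averages over the
  starting point of the walk.\<close>

locale picard_scheme =
  fixes Q :: "((nat \<Rightarrow> real) \<Rightarrow> real) \<Rightarrow> ((nat \<Rightarrow> real) \<Rightarrow> real)"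
    and I :: "((nat \<Rightarrow> real) \<Rightarrow> real) \<Rightarrow> real"
    and f :: "real \<Rightarrow> real" and g :: "(nat \<Rightarrow> real) \<Rightarrow> real" and \<kappa> h T :: real and N :: nat
  assumes Q: "shift_average Q" and I: "pos_functional I"
    and lip: "\<And>v w. \<bar>f v - f w\<bar> \<le> \<kappa> * \<bar>v - w\<bar>"
    and g: "cont g" and h: "0 < h" and hN: "h * real N = T"
begin

lemma \<kappa>_nonneg: "0 \<le> \<kappa>" using lip[of 1 0] by simp

lemma cont_f: assumes "cont F" shows "cont (\<lambda>x. f (F x))"
proof -
  have "continuous_on UNIV f"
    by (rule lipschitz_on_continuous_on[OF lipschitz_onI[of _ _ \<kappa>]]) (use lip \<kappa>_nonneg in \<open>auto simp: dist_real_def\<close>)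
  then show ?thesis using assms by (auto intro: continuous_on_compose2)
qed

primrec w :: "nat \<Rightarrow> (nat \<Rightarrow> real) \<Rightarrow> real" where
  "w 0 = g"
| "w (Suc k) = Q (\<lambda>x. w k x + h * f (w k x))"

lemma cont_w: "cont (w k)"
  by (induction k) (auto intro!: g shift_average_cont[OF Q] continuous_intros cont_f)

lemma cont_Qpow: "cont F \<Longrightarrow> cont ((Q ^^ m) F)"
  by (rule shift_average_cont[OF shift_average_funpow[OF Q]])

text \<open>Discrete Duhamel formula: the source entering at step \<open>j\<close> is then averaged
  \<open>k - j\<close> times.\<close>

lemma w_mild: "w k x = (Q ^^ k) g x + h * (\<Sum>j<k. (Q ^^ (k - j)) (\<lambda>x. f (w j x)) x)"
proof (induction k arbitrary: x)
  case (Suc k)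
  have "w k = (\<lambda>x. 1 * (Q ^^ k) g x + h * (\<Sum>j<k. (Q ^^ (k - j)) (\<lambda>x. f (w j x)) x))" using Suc by auto
  then have "Q (w k) x = Q (\<lambda>x. 1 * (Q ^^ k) g x + h * (\<Sum>j<k. (Q ^^ (k - j)) (\<lambda>x. f (w j x)) x)) x" by simp
  also have "\<dots> = (Q ^^ Suc k) g x + h * (\<Sum>j<k. (Q ^^ (Suc k - j)) (\<lambda>x. f (w j x)) x)"
    unfolding shift_average_lin[OF Q] shift_average_sum[OF Q] by (simp add: Suc_diff_le)
  finally have "Q (w k) x = \<dots>" .
  then show ?case
    by (simp add: shift_average_add[OF Q] shift_average_cmult[OF Q] algebra_simps)
qed simp

text \<open>The walk starts at time \<open>T\<close> and runs backwards, so after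
  \<open>N - k\<close> steps it is at time \<open>h * k\<close>; \<open>J k\<close> is the
  expectation under its law there.\<close>

definition J :: "nat \<Rightarrow> ((nat \<Rightarrow> real) \<Rightarrow> real) \<Rightarrow> real" where "J k F = I ((Q ^^ (N - k)) F)"

lemma J: "pos_functional (J k)"
  using pos_functional_comp[OF shift_average_funpow[OF Q] I] unfolding J_def[abs_def] .

text \<open>Markov property of the walk. It turns errors at step \<open>j\<close>, averaged back to
  step \<open>k\<close>, into errors under \<open>J j\<close>.\<close>

lemma J_Qpow: assumes "j \<le> k" "k \<le> N" shows "J k ((Q ^^ (k - j)) F) = J j F"
proof -
  have "N - j = (N - k) + (k - j)" using assms by simp
  then show ?thesis unfolding J_def by (simp add: funpow_add)
qed

lemma sample_initial:
  assumes "k \<le> N" "0 < m"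
  shows "\<exists>z. J k (\<lambda>x. ((\<Sum>i<m. g (shift (z i) x)) / real m - (Q ^^ k) g x)\<^sup>2) \<le> J 0 (\<lambda>x. (g x)\<^sup>2) / real m"
proof -
  obtain n z where nz: "0 < n" "\<And>F x. (Q ^^ k) F x = (\<Sum>i<n. F (shift (z i) x)) / real n"
    using shift_average_funpow[OF Q] unfolding shift_average_def by blast
  obtain \<theta> where "J k (\<lambda>x. ((\<Sum>i<m. g (shift (z (\<theta> i)) x)) / real m - (\<Sum>i<n. 1 / real n * g (shift (z i) x)))\<^sup>2)
      \<le> J k (\<lambda>x. \<Sum>i<n. 1 / real n * (g (shift (z i) x))\<^sup>2) / real m"
    using monte_carlo[OF J, of "{..<n}" "\<lambda>_. 1 / real n" "\<lambda>i x. g (shift (z i) x)" m k] nz(1) assms(2) cont_shift[OF g]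
    by auto
  moreover have "(\<Sum>i<n. 1 / real n * g (shift (z i) x)) = (Q ^^ k) g x" for x
    unfolding nz(2) by (simp add: sum_divide_distrib)
  moreover have "(\<lambda>x. \<Sum>i<n. 1 / real n * (g (shift (z i) x))\<^sup>2) = (Q ^^ (k - 0)) (\<lambda>x. (g x)\<^sup>2)"
    by (simp add: nz(2)[of "\<lambda>x. (g x)\<^sup>2", abs_def] fun_eq_iff nz(2) sum_divide_distrib)
  ultimately show ?thesis using J_Qpow[of 0 k "\<lambda>x. (g x)\<^sup>2"] assms(1) by (intro exI[of _ "z \<circ> \<theta>"]) simp
qed

text \<open>A sample is a pair of a time \<open>j\<close>, uniform below \<open>k\<close>, and an
  increment of the walk over \<open>k - j\<close> steps. Sampling the time as well keeps the number
  of network copies independent of \<open>k\<close>.\<close>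

lemma sample_level:
  assumes k: "k \<le> N" "0 < k" and m: "0 < m" and G: "\<And>j. j < k \<Longrightarrow> cont (G j)"
  shows "\<exists>\<tau> z. (\<forall>i<m. \<tau> i < k) \<and>
    J k (\<lambda>x. ((\<Sum>i<m. G (\<tau> i) (shift (z i) x)) / real m - (\<Sum>j<k. (Q ^^ (k - j)) (G j) x) / real k)\<^sup>2)
      \<le> (\<Sum>j<k. J j (\<lambda>x. (G j x)\<^sup>2)) / real k / real m"
proof -
  have "\<exists>n z. 0 < n \<and> (\<forall>F x. (Q ^^ (k - j)) F x = (\<Sum>i<n. F (shift (z i) x)) / real n)" for j
    using shift_average_funpow[OF Q] unfolding shift_average_def by blast
  then obtain n z where nz: "\<And>j. 0 < n j" "\<And>j F x. (Q ^^ (k - j)) F x = (\<Sum>i<n j. F (shift (z j i) x)) / real (n j :: nat)"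
    by metis
  define A where "A = (SIGMA j:{..<k}. {..<n j})"
  define p where "p q = 1 / (real k * real (n (fst q)))" for q :: "nat \<times> nat"
  have mean: "(\<Sum>q\<in>A. p q * F (fst q) (shift (z (fst q) (snd q)) x)) = (\<Sum>j<k. (Q ^^ (k - j)) (F j) x) / real k" for F x
  proof -
    have "(\<Sum>q\<in>A. R q) = (\<Sum>j<k. \<Sum>i<n j. R (j, i))" for R :: "nat \<times> nat \<Rightarrow> real"
      unfolding A_def by (subst sum.Sigma) auto
    then show ?thesis unfolding p_def nz(2) by (simp add: sum_divide_distrib mult.commute)
  qed
  have "sum p A = 1" using mean[of "\<lambda>_ _. 1" "\<lambda>_. 0"] k
    by (simp add: shift_average_const[OF shift_average_funpow[OF Q]])
  moreover have "finite A" by (simp add: A_def)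
  moreover have "cont (\<lambda>x. G (fst q) (shift (z (fst q) (snd q)) x))" if "q \<in> A" for q
    by (rule cont_shift) (use that G in \<open>auto simp: A_def\<close>)
  ultimately obtain \<theta> where \<theta>: "\<And>i. i < m \<Longrightarrow> \<theta> i \<in> A"
    "J k (\<lambda>x. ((\<Sum>i<m. G (fst (\<theta> i)) (shift (z (fst (\<theta> i)) (snd (\<theta> i))) x)) / real m
        - (\<Sum>q\<in>A. p q * G (fst q) (shift (z (fst q) (snd q)) x)))\<^sup>2)
      \<le> J k (\<lambda>x. \<Sum>q\<in>A. p q * (G (fst q) (shift (z (fst q) (snd q)) x))\<^sup>2) / real m"
    using monte_carlo[OF J, of A p "\<lambda>q x. G (fst q) (shift (z (fst q) (snd q)) x)" m k] m
    by (auto simp: p_def)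
  have "J k (\<lambda>x. \<Sum>q\<in>A. p q * (G (fst q) (shift (z (fst q) (snd q)) x))\<^sup>2)
      = J k (\<lambda>x. \<Sum>j<k. 1 / real k * (Q ^^ (k - j)) (\<lambda>x. (G j x)\<^sup>2) x)"
    using mean[of "\<lambda>j x. (G j x)\<^sup>2"] by (simp add: sum_divide_distrib)
  also have "\<dots> = (\<Sum>j<k. 1 / real k * J k ((Q ^^ (k - j)) (\<lambda>x. (G j x)\<^sup>2)))"
    by (rule pos_functional_sum[OF J]) (auto intro!: cont_Qpow continuous_intros G)
  also have "\<dots> = (\<Sum>j<k. J j (\<lambda>x. (G j x)\<^sup>2)) / real k"
    using k by (simp add: J_Qpow sum_divide_distrib)
  finally show ?thesis using \<theta> unfolding mean[of G]
    by (intro exI[of _ "\<lambda>i. fst (\<theta> i)"] exI[of _ "\<lambda>i. z (fst (\<theta> i)) (snd (\<theta> i))"]) (force simp: A_def)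
qed
end

text \<open>The weighted sum obeys \<open>S (n + 1) = 2 * S n + 4 * D ^ (n + 1)\<close>, so the
  induction closes under \<open>2 + 4 * c \<le> D\<close>.\<close>

lemma geometric_weights_le:
  fixes D c :: real
  assumes "2 + 4 * c \<le> D" "0 \<le> c"
  shows "c * (\<Sum>l<Suc n. 2 ^ (n + 2 - l) * D ^ l) \<le> D ^ Suc n"
proof (induction n)
  case (Suc n)
  have "(\<Sum>l<Suc n. 2 ^ (Suc n + 2 - l) * D ^ l) = 2 * (\<Sum>l<Suc n. 2 ^ (n + 2 - l) * D ^ l)"
    unfolding sum_distrib_left
  proof (rule sum.cong)
    fix l assume "l \<in> {..<Suc n}"
    then have "Suc n + 2 - l = Suc (n + 2 - l)" by auto
    then show "2 ^ (Suc n + 2 - l) * D ^ l = 2 * (2 ^ (n + 2 - l) * D ^ l)" by simp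
  qed simp
  then have "(\<Sum>l<Suc (Suc n). 2 ^ (Suc n + 2 - l) * D ^ l) =
      2 * (\<Sum>l<Suc n. 2 ^ (n + 2 - l) * D ^ l) + 4 * D ^ Suc n" by simp
  then have "c * (\<Sum>l<Suc (Suc n). 2 ^ (Suc n + 2 - l) * D ^ l) =
      2 * (c * (\<Sum>l<Suc n. 2 ^ (n + 2 - l) * D ^ l)) + 4 * c * D ^ Suc n" by (simp add: algebra_simps)
  also have "\<dots> \<le> 2 * D ^ Suc n + 4 * c * D ^ Suc n" using Suc by linarith
  also have "\<dots> = (2 + 4 * c) * D ^ Suc n" by (simp add: algebra_simps)
  also have "\<dots> \<le> D * D ^ Suc n" by (rule mult_right_mono) (use assms in auto)
  finally show ?case by simp
qed (use assms in auto)

text \<open>The left side is the width of a new level in units of the base width: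
  \<open>M ^ Suc n\<close> copies of \<open>g\<close>, and \<open>M ^ (n - l)\<close> copies of the
  levels \<open>Suc l\<close> and \<open>l\<close>. After the factor \<open>M ^ Suc n\<close> is
  taken out, a sum of powers of 3 remains.\<close>

lemma geometric_width_le:
  fixes M :: nat assumes "1 \<le> M"
  shows "M ^ Suc n + (\<Sum>l<n. M ^ (n - l) * ((3 * M) ^ Suc l + (3 * M) ^ l)) \<le> (3 * M) ^ Suc n"
proof -
  have "M ^ (n - l) * ((3 * M) ^ Suc l + (3 * M) ^ l) \<le> M ^ Suc n * (3 ^ Suc l + 3 ^ l)" if "l < n" for l
  proof -
    have "M ^ (n - l) * M ^ Suc l = M ^ Suc n" "M ^ (n - l) * M ^ l = M ^ n"
      using that by (simp_all flip: power_add)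
    moreover have "M ^ n \<le> M ^ Suc n" using assms by (intro power_increasing) auto
    moreover have "M ^ (n - l) * ((3 * M) ^ Suc l + (3 * M) ^ l) =
        (M ^ (n - l) * M ^ Suc l) * 3 ^ Suc l + (M ^ (n - l) * M ^ l) * 3 ^ l"
      unfolding power_mult_distrib by (simp only: algebra_simps)
    ultimately show ?thesis by (simp add: distrib_left del: power_Suc)
  qed
  then have "M ^ Suc n + (\<Sum>l<n. M ^ (n - l) * ((3 * M) ^ Suc l + (3 * M) ^ l)) \<le>
     M ^ Suc n + (\<Sum>l<n. M ^ Suc n * (3 ^ Suc l + 3 ^ l))" by (intro add_left_mono sum_mono) auto
  also have "\<dots> = M ^ Suc n * (1 + (\<Sum>l<n. 3 ^ Suc l + 3 ^ l))" by (simp add: distrib_left sum_distrib_left)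
  also have "1 + (\<Sum>l<n. 3 ^ Suc l + 3 ^ l) \<le> (3::nat) ^ Suc n" by (induction n) auto
  finally show ?thesis by (simp add: power_mult_distrib mult_ac)
qed

context picard_scheme
begin

definition sq_err :: "((nat \<Rightarrow> real) \<Rightarrow> real) \<Rightarrow> nat \<Rightarrow> real" where
  "sq_err F k = J k (\<lambda>x. (F x - w k x)\<^sup>2)"

text \<open>By Lipschitz continuity and comparison of both \<open>F\<close> and \<open>G\<close>
  with \<open>w\<close>, the sampled correction between two levels is small once both levels are
  accurate.\<close>

lemma level_second_moment:
  assumes "k \<le> N" "0 < k" and cont: "\<And>j. j < k \<Longrightarrow> cont (F j)" "\<And>j. j < k \<Longrightarrow> cont (G j)"
  shows "(\<Sum>j<k. J j (\<lambda>x. (h * real k * (f (F j x) - f (G j x)))\<^sup>2)) / real k \<le>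
     2 * T * \<kappa>\<^sup>2 * (h * (\<Sum>j<k. sq_err (F j) j + sq_err (G j) j))"
proof -
  have hk: "0 < h * real k" "h * real k \<le> T" using assms h by (auto simp flip: hN)
  define c where "c = 2 * (h * real k)\<^sup>2 * \<kappa>\<^sup>2"
  have c: "0 \<le> c" by (simp add: c_def)
  have "J j (\<lambda>x. (h * real k * (f (F j x) - f (G j x)))\<^sup>2) \<le> c * (sq_err (F j) j + sq_err (G j) j)"
    if j: "j < k" for j
  proof -
    have "J j (\<lambda>x. (h * real k * (f (F j x) - f (G j x)))\<^sup>2) \<le> J j (\<lambda>x. c * (F j x - w j x)\<^sup>2 + c * (G j x - w j x)\<^sup>2)"
    proof (rule pos_functional_mono[OF J])
      fix x
      have "(f (F j x) - f (G j x))\<^sup>2 \<le> (\<kappa> * \<bar>F j x - G j x\<bar>)\<^sup>2"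
        using lip[of "F j x" "G j x"] by (simp add: abs_le_square_iff[symmetric] \<kappa>_nonneg abs_mult)
      also have "\<dots> = \<kappa>\<^sup>2 * (F j x - G j x)\<^sup>2" by (simp add: power_mult_distrib)
      also have "\<dots> \<le> \<kappa>\<^sup>2 * (2 * (F j x - w j x)\<^sup>2 + 2 * (G j x - w j x)\<^sup>2)"
        using zero_le_power2[of "F j x + G j x - 2 * w j x"]
        by (intro mult_left_mono) (auto simp: power2_eq_square algebra_simps)
      finally have "(h * real k)\<^sup>2 * (f (F j x) - f (G j x))\<^sup>2 \<le> (h * real k)\<^sup>2 * (\<kappa>\<^sup>2 * (2 * (F j x - w j x)\<^sup>2 + 2 * (G j x - w j x)\<^sup>2))"
        by (rule mult_left_mono) simp
      then show "(h * real k * (f (F j x) - f (G j x)))\<^sup>2 \<le> c * (F j x - w j x)\<^sup>2 + c * (G j x - w j x)\<^sup>2"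
        unfolding power_mult_distrib[of "h * real k" "f (F j x) - f (G j x)"]
        by (simp add: c_def algebra_simps)
    qed (use j in \<open>auto intro!: continuous_intros cont cont_f cont_w\<close>)
    also have "\<dots> = c * sq_err (F j) j + c * sq_err (G j) j" unfolding sq_err_def
      by (rule pos_functional_lin[OF J]) (use j in \<open>auto intro!: continuous_intros cont cont_w\<close>)
    finally show ?thesis by (simp add: distrib_left)
  qed
  then have "(\<Sum>j<k. J j (\<lambda>x. (h * real k * (f (F j x) - f (G j x)))\<^sup>2)) / real k \<le>
     (\<Sum>j<k. c * (sq_err (F j) j + sq_err (G j) j)) / real k"
    by (intro divide_right_mono sum_mono) auto
  \<comment> \<open>One factor \<open>h * real k\<close> cancels the mean over \<open>k\<close>
    times and leaves a Riemann sum with step \<open>h\<close>; the other is bounded by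
    \<open>T\<close>.\<close>
  also have "\<dots> = (h * real k) * (2 * \<kappa>\<^sup>2 * (h * (\<Sum>j<k. sq_err (F j) j + sq_err (G j) j)))"
    using assms(2) by (simp add: c_def power2_eq_square flip: sum_distrib_left)
  also have "\<dots> \<le> T * (2 * \<kappa>\<^sup>2 * (h * (\<Sum>j<k. sq_err (F j) j + sq_err (G j) j)))"
    using h cont by (intro mult_right_mono[OF hk(2)] mult_nonneg_nonneg sum_nonneg add_nonneg_nonneg)
      (auto simp: sq_err_def intro!: pos_functional_nonneg[OF J] continuous_intros cont_w)
  finally show ?thesis by (simp add: mult_ac)
qed

text \<open>The bias of a Picard step that uses \<open>F\<close> in place of \<open>w\<close>:
  Cauchy-Schwarz over the times, Jensen for each average, then \<open>J_Qpow\<close>.\<close>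

lemma bias_second_moment:
  assumes "k \<le> N" "0 < k" and cont: "\<And>j. j < k \<Longrightarrow> cont (F j)"
  shows "J k (\<lambda>x. (h * (\<Sum>j<k. (Q ^^ (k - j)) (\<lambda>x. f (F j x) - f (w j x)) x))\<^sup>2) \<le>
     T * \<kappa>\<^sup>2 * (h * (\<Sum>j<k. sq_err (F j) j))"
proof -
  have hk: "0 < h * real k" "h * real k \<le> T" using assms h by (auto simp flip: hN)
  define c where "c = h\<^sup>2 * real k * \<kappa>\<^sup>2"
  have "J k (\<lambda>x. (h * (\<Sum>j<k. (Q ^^ (k - j)) (\<lambda>x. f (F j x) - f (w j x)) x))\<^sup>2) \<le>
     J k (\<lambda>x. \<Sum>j<k. c * (Q ^^ (k - j)) (\<lambda>x. (F j x - w j x)\<^sup>2) x)"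
  proof (rule pos_functional_mono[OF J])
    fix x
    define y where "y j = (Q ^^ (k - j)) (\<lambda>x. f (F j x) - f (w j x)) x" for j
    have y: "(y j)\<^sup>2 \<le> \<kappa>\<^sup>2 * (Q ^^ (k - j)) (\<lambda>x. (F j x - w j x)\<^sup>2) x" for j
    proof -
      have "(y j)\<^sup>2 \<le> (Q ^^ (k - j)) (\<lambda>x. (f (F j x) - f (w j x))\<^sup>2) x" unfolding y_def
        by (rule shift_average_square[OF shift_average_funpow[OF Q]])
      also have "\<dots> \<le> (Q ^^ (k - j)) (\<lambda>x. \<kappa>\<^sup>2 * (F j x - w j x)\<^sup>2) x"
      proof (rule shift_average_mono[OF shift_average_funpow[OF Q]])
        fix x
        have "(f (F j x) - f (w j x))\<^sup>2 \<le> (\<kappa> * \<bar>F j x - w j x\<bar>)\<^sup>2"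
          using lip[of "F j x" "w j x"] by (simp add: abs_le_square_iff[symmetric] \<kappa>_nonneg abs_mult)
        then show "(f (F j x) - f (w j x))\<^sup>2 \<le> \<kappa>\<^sup>2 * (F j x - w j x)\<^sup>2" by (simp add: power_mult_distrib)
      qed
      finally show ?thesis by (simp add: shift_average_cmult[OF shift_average_funpow[OF Q]])
    qed
    have "(\<Sum>j<k. y j * 1)\<^sup>2 \<le> (\<Sum>j<k. (y j)\<^sup>2) * (\<Sum>j<k. 1\<^sup>2)" by (rule Cauchy_Schwarz_ineq_sum)
    also have "\<dots> \<le> (\<Sum>j<k. \<kappa>\<^sup>2 * (Q ^^ (k - j)) (\<lambda>x. (F j x - w j x)\<^sup>2) x) * real k"
      using y by (simp add: mult_right_mono sum_mono)
    finally have "h\<^sup>2 * (\<Sum>j<k. y j)\<^sup>2 \<le> h\<^sup>2 * ((\<Sum>j<k. \<kappa>\<^sup>2 * (Q ^^ (k - j)) (\<lambda>x. (F j x - w j x)\<^sup>2) x) * real k)"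
      by (intro mult_left_mono) auto
    then show "(h * (\<Sum>j<k. (Q ^^ (k - j)) (\<lambda>x. f (F j x) - f (w j x)) x))\<^sup>2 \<le>
        (\<Sum>j<k. c * (Q ^^ (k - j)) (\<lambda>x. (F j x - w j x)\<^sup>2) x)"
      unfolding y_def power_mult_distrib[of h] by (simp add: c_def mult_ac sum_distrib_left)
  qed (auto intro!: continuous_intros cont_Qpow cont cont_f cont_w)
  also have "\<dots> = (\<Sum>j<k. c * J k ((Q ^^ (k - j)) (\<lambda>x. (F j x - w j x)\<^sup>2)))"
    by (rule pos_functional_sum[OF J]) (auto intro!: continuous_intros cont_Qpow cont cont_w)
  also have "\<dots> = (h * real k) * (\<kappa>\<^sup>2 * (h * (\<Sum>j<k. sq_err (F j) j)))"
    using assms by (simp add: c_def J_Qpow sq_err_def power2_eq_square flip: sum_distrib_left)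
  also have "\<dots> \<le> T * (\<kappa>\<^sup>2 * (h * (\<Sum>j<k. sq_err (F j) j)))"
    using h cont by (intro mult_right_mono[OF hk(2)] mult_nonneg_nonneg sum_nonneg add_nonneg_nonneg)
      (auto simp: sq_err_def intro!: pos_functional_nonneg[OF J] continuous_intros cont_w)
  finally show ?thesis by (simp add: mult_ac)
qed

text \<open>
  The full-history multilevel Picard step, with deterministic samples. The weight
  \<open>exp (M * t)\<close> turns every time integration into a gain of \<open>1 / M\<close>, so that a level contracts by
  the same factor by which its sample size shrinks.
\<close>

lemma multilevel_step:
  fixes U :: "nat \<Rightarrow> nat \<Rightarrow> (nat \<Rightarrow> real) \<Rightarrow> real" and M V H n m d :: nat and A D :: real
  assumes k: "k \<le> N" and M: "1 \<le> M" and V: "2 \<le> V" "m \<le> V" and gn: "g \<in> nn d V H" and fr: "relu_sum m f"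
    and U0: "\<And>j. U 0 j = (\<lambda>x. 0)"
    and Unn: "\<And>l j. l \<le> n \<Longrightarrow> j \<le> N \<Longrightarrow> U l j \<in> nn d (V * (3 * M) ^ l) (H + l)"
    and Uerr: "\<And>l j. l \<le> n \<Longrightarrow> j \<le> N \<Longrightarrow> sq_err (U l j) j \<le> A * (D / real M) ^ l * exp (real M * (h * real j))"
    and A: "J 0 (\<lambda>x. (g x)\<^sup>2) \<le> A" and D: "6 + 32 * T * \<kappa>\<^sup>2 \<le> D"
  shows "\<exists>F\<in>nn d (V * (3 * M) ^ Suc n) (H + Suc n).
     sq_err F k \<le> A * (D / real M) ^ Suc n * exp (real M * (h * real k))"
proof (cases "k = 0")
  \<comment> \<open>At time 0 there is nothing to integrate: \<open>g\<close> itself, padded to the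
    required size, has error 0.\<close>
  case True
  have A0: "0 \<le> A" using A pos_functional_nonneg[OF J, of "\<lambda>x. (g x)\<^sup>2" 0] g by (force intro!: continuous_intros)
  have "0 \<le> T" using h by (simp flip: hN)
  then have "0 \<le> T * \<kappa>\<^sup>2" by simp
  then have D0: "0 \<le> D" using D by linarith
  have "1 \<le> (3 * M) ^ Suc n" using M by (intro one_le_power) simp
  then have gV: "V \<le> V * (3 * M) ^ Suc n" by simp
  have "g \<in> nn d (V * (3 * M) ^ Suc n) (H + Suc n)" by (rule nn_mono[OF nn_pad[OF gn V(1)] gV]) simp
  moreover have "sq_err g k = 0" using True pos_functional_zero[OF J] by (simp add: sq_err_def)
  ultimately show ?thesis using A0 D0 M by (intro bexI[of _ g]) auto
next
  case False
  then have k0: "0 < k" by simp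
  have T: "0 \<le> T" using h by (simp flip: hN)
  \<comment> \<open>\<open>K\<close> is twice the factor \<open>2 * T * \<kappa>\<^sup>2\<close> of
    \<open>level_second_moment\<close>, as two levels contribute. Indices up to \<open>n\<close>
    will cost \<open>1 + K\<close> and the bias another \<open>K\<close>, hence \<open>c\<close>;
    then \<open>2 + 4 * c = 6 + 8 * K\<close> is exactly the lower bound assumed for
    \<open>D\<close>.\<close>
  define K where "K = 4 * T * \<kappa>\<^sup>2"
  define c where "c = 1 + 2 * K"
  have K: "0 \<le> K" "2 + 4 * c \<le> D" "0 \<le> c" using T D by (auto simp: K_def c_def)
  have D1: "1 \<le> D" using K by linarith
  have A0: "0 \<le> A" using A pos_functional_nonneg[OF J, of "\<lambda>x. (g x)\<^sup>2" 0] g by (force intro!: continuous_intros)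
  define e where "e = exp (real M * (h * real k))"
  have e: "1 \<le> e" using h by (simp add: e_def)
  have M0: "0 < real M" using M by simp
  have contU: "cont (U l j)" if "l \<le> n" "j \<le> N" for l j using nn_continuous[OF Unn[OF that]] .
  \<comment> \<open>The factor \<open>h * real k\<close> is the length of the time interval,
    compensating the uniform law of the sampled time.\<close>
  define G where "G l j x = h * real k * (f (U (Suc l) j x) - f (U l j x))" for l j x
  have contG: "cont (G l j)" if "l < n" "j < k" for l j
    unfolding G_def[abs_def] using that k by (auto intro!: continuous_intros cont_f contU)
  obtain z0 where z0: "J k (\<lambda>x. ((\<Sum>i<M ^ Suc n. g (shift (z0 i) x)) / real (M ^ Suc n) - (Q ^^ k) g x)\<^sup>2)
      \<le> J 0 (\<lambda>x. (g x)\<^sup>2) / real (M ^ Suc n)"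
    using sample_initial[OF k, of "M ^ Suc n"] M by auto
  define ok where "ok l \<tau> z \<longleftrightarrow> (\<forall>i<M ^ (n - l). \<tau> i < k) \<and>
    J k (\<lambda>x. ((\<Sum>i<M ^ (n - l). G l (\<tau> i) (shift (z i) x)) / real (M ^ (n - l)) - (\<Sum>j<k. (Q ^^ (k - j)) (G l j) x) / real k)\<^sup>2)
      \<le> (\<Sum>j<k. J j (\<lambda>x. (G l j x)\<^sup>2)) / real k / real (M ^ (n - l))" for l \<tau> z
  have "\<exists>\<tau> z. ok l \<tau> z" if "l < n" for l
    unfolding ok_def using sample_level[OF k k0, of "M ^ (n - l)" "G l"] contG[OF that] M by auto
  then obtain \<tau> z where ok: "\<And>l. l < n \<Longrightarrow> ok l (\<tau> l) (z l)" by metis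
  have \<tau>: "\<tau> l i < k" if "l < n" "i < M ^ (n - l)" for l i using ok[OF that(1)] that(2) unfolding ok_def by blast
  have z: "J k (\<lambda>x. ((\<Sum>i<M ^ (n - l). G l (\<tau> l i) (shift (z l i) x)) / real (M ^ (n - l)) - (\<Sum>j<k. (Q ^^ (k - j)) (G l j) x) / real k)\<^sup>2)
      \<le> (\<Sum>j<k. J j (\<lambda>x. (G l j x)\<^sup>2)) / real k / real (M ^ (n - l))" if "l < n" for l
    using ok[OF that] unfolding ok_def by blast
  define Sg where "Sg x = (\<Sum>i<M ^ Suc n. g (shift (z0 i) x)) / real (M ^ Suc n)" for x
  define SG where "SG l x = (\<Sum>i<M ^ (n - l). G l (\<tau> l i) (shift (z l i) x)) / real (M ^ (n - l))" for l x
  \<comment> \<open>\<open>h * real k * f 0\<close> is the Picard integral for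
    \<open>U 0 = 0\<close>, which needs no sampling.\<close>
  define F where "F x = Sg x + h * real k * f 0 + (\<Sum>l<n. SG l x)" for x
  \<comment> \<open>Index 0 is the sampling error of \<open>g\<close>, index \<open>i\<close> from 1
    to \<open>n\<close> that of the correction from level \<open>i - 1\<close> to \<open>i\<close>,
    and index \<open>n + 1\<close> the bias from using \<open>U n\<close> instead of
    \<open>w\<close>. The means of the corrections telescope.\<close>
  define err where "err i x = (if i = 0 then Sg x - (Q ^^ k) g x
     else if i \<le> n then SG (i - 1) x - (\<Sum>j<k. (Q ^^ (k - j)) (G (i - 1) j) x) / real k
     else h * (\<Sum>j<k. (Q ^^ (k - j)) (\<lambda>x. f (U n j x) - f (w j x)) x))" for i x
  have contSg: "cont Sg" unfolding Sg_def[abs_def] using g M by (auto intro!: continuous_intros cont_shift)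
  have contSG: "cont (SG l)" if "l < n" for l
    unfolding SG_def[abs_def] using that M contG[OF that \<tau>[OF that]] by (auto intro!: continuous_intros cont_shift)
  have contF: "cont F" unfolding F_def[abs_def] using contSg contSG by (auto intro!: continuous_intros)
  have conterr: "cont (err i)" for i
    unfolding err_def[abs_def] using k k0
    by (cases "i = 0"; cases "i \<le> n")
      (auto intro!: continuous_intros contSg contSG cont_Qpow g contG contU cont_f cont_w)
  have split: "F x - w k x = (\<Sum>i<Suc (Suc n). err i x)" for x
  proof -
    define Y where "Y l = h * (\<Sum>j<k. (Q ^^ (k - j)) (\<lambda>x. f (U l j x)) x)" for l
    have "(\<Sum>j<k. (Q ^^ (k - j)) (G l j) x) / real k = Y (Suc l) - Y l" for l
    proof -
      have "(\<Sum>j<k. (Q ^^ (k - j)) (G l j) x) =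
         (\<Sum>j<k. h * real k * ((Q ^^ (k - j)) (\<lambda>x. f (U (Suc l) j x)) x - (Q ^^ (k - j)) (\<lambda>x. f (U l j x)) x))"
        unfolding G_def[abs_def] shift_average_cmult[OF shift_average_funpow[OF Q]]
          shift_average_diff[OF shift_average_funpow[OF Q]] ..
      then show ?thesis
        using k0 by (simp add: Y_def sum_subtractf right_diff_distrib diff_divide_distrib flip: sum_distrib_left)
    qed
    then have "(\<Sum>l<n. (\<Sum>j<k. (Q ^^ (k - j)) (G l j) x) / real k) = Y n - Y 0"
      by (simp add: sum_lessThan_telescope)
    moreover have "Y 0 = h * real k * f 0"
      by (simp add: Y_def U0 shift_average_const[OF shift_average_funpow[OF Q]])
    moreover have "err (Suc n) x = Y n - h * (\<Sum>j<k. (Q ^^ (k - j)) (\<lambda>x. f (w j x)) x)"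
      by (simp add: err_def Y_def shift_average_diff[OF shift_average_funpow[OF Q]] sum_subtractf right_diff_distrib)
    moreover have "(\<Sum>i<Suc (Suc n). err i x) = err 0 x + (\<Sum>l<n. err (Suc l) x) + err (Suc n) x"
      by (subst sum.lessThan_Suc_shift) simp
    moreover have "(\<Sum>l<n. err (Suc l) x) = (\<Sum>l<n. SG l x) - (\<Sum>l<n. (\<Sum>j<k. (Q ^^ (k - j)) (G l j) x) / real k)"
      unfolding sum_subtractf[symmetric] by (rule sum.cong) (auto simp: err_def)
    ultimately show ?thesis unfolding F_def w_mild[of k x] by (simp add: err_def)
  qed
  have expsum: "h * (\<Sum>j<k. sq_err (U l j) j) \<le> A * (D / real M) ^ l * e / real M" if "l \<le> n" for l
  proof -
    have "h * (\<Sum>j<k. sq_err (U l j) j) \<le> h * (\<Sum>j<k. A * (D / real M) ^ l * exp (real M * (h * real j)))"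
      using Uerr[OF that] h k by (intro mult_left_mono sum_mono) auto
    also have "\<dots> = A * (D / real M) ^ l * (h * (\<Sum>j<k. exp (real M * (h * real j))))"
      by (simp add: sum_distrib_left mult_ac)
    also have "\<dots> \<le> A * (D / real M) ^ l * (e / real M)"
      unfolding e_def using sum_exp_le[OF M0 h, of k] A0 D1 by (intro mult_left_mono) auto
    finally show ?thesis by simp
  qed
  \<comment> \<open>The common size of all error terms: the bounds below differ from
    \<open>a\<close> only by \<open>K\<close> and a power of \<open>D\<close>.\<close>
  define a where "a = A / real M ^ Suc n * e"
  have a0: "0 \<le> a" using A0 M0 e by (simp add: a_def)
  have err0: "J k (\<lambda>x. (err 0 x)\<^sup>2) \<le> a"
  proof -
    have "J k (\<lambda>x. (err 0 x)\<^sup>2) \<le> A / real M ^ Suc n * 1"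
      using z0 A divide_right_mono[OF A, of "real (M ^ Suc n)"] by (simp add: err_def Sg_def)
    also have "\<dots> \<le> a" unfolding a_def by (rule mult_left_mono[OF e]) (use A0 M0 in auto)
    finally show ?thesis .
  qed
  have errS: "J k (\<lambda>x. (err (Suc l) x)\<^sup>2) \<le> a * (K * D ^ Suc l)" if l: "l < n" for l
  proof -
    \<comment> \<open>Sample size, level error and time integration together yield the same power of
      \<open>M\<close> at every level.\<close>
    have MM: "real M ^ (n - l) * real M ^ Suc l = real M ^ Suc n" using l by (simp flip: power_add)
    have "(D / real M) ^ Suc l = D ^ Suc l / (real M ^ l * real M)" by (simp add: power_divide)
    also have "\<dots> \<le> D ^ Suc l / (real M ^ l * 1)"
      using D1 M by (intro divide_left_mono mult_left_mono) auto
    finally have p1: "(D / real M) ^ Suc l \<le> D ^ Suc l / real M ^ l" by simp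
    have p2: "(D / real M) ^ l \<le> D ^ Suc l / real M ^ l"
      unfolding power_divide using D1 M by (intro divide_right_mono power_increasing) auto
    have "J k (\<lambda>x. (err (Suc l) x)\<^sup>2) \<le> (\<Sum>j<k. J j (\<lambda>x. (G l j x)\<^sup>2)) / real k / real (M ^ (n - l))"
      using z[OF l] l by (simp add: err_def SG_def)
    also have "\<dots> \<le> 2 * T * \<kappa>\<^sup>2 * (h * (\<Sum>j<k. sq_err (U (Suc l) j) j + sq_err (U l j) j)) / real (M ^ (n - l))"
      unfolding G_def using l k
      by (intro divide_right_mono level_second_moment[OF k k0] contU) auto
    also have "\<dots> \<le> 2 * T * \<kappa>\<^sup>2 * (2 * (A * (D ^ Suc l / real M ^ l) * e / real M)) / real (M ^ (n - l))"
    proof (intro divide_right_mono mult_left_mono)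
      have "h * (\<Sum>j<k. sq_err (U (Suc l) j) j + sq_err (U l j) j) =
         h * (\<Sum>j<k. sq_err (U (Suc l) j) j) + h * (\<Sum>j<k. sq_err (U l j) j)"
        by (simp add: sum.distrib distrib_left)
      also have "\<dots> \<le> A * (D / real M) ^ Suc l * e / real M + A * (D / real M) ^ l * e / real M"
        using expsum[of "Suc l"] expsum[of l] l by (intro add_mono) auto
      also have "\<dots> \<le> A * (D ^ Suc l / real M ^ l) * e / real M + A * (D ^ Suc l / real M ^ l) * e / real M"
        using p1 p2 A0 e M0 by (intro add_mono divide_right_mono mult_right_mono mult_left_mono) auto
      finally show "h * (\<Sum>j<k. sq_err (U (Suc l) j) j + sq_err (U l j) j) \<le> 2 * (A * (D ^ Suc l / real M ^ l) * e / real M)"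
        by linarith
    qed (use T in auto)
    also have "\<dots> = A * K * D ^ Suc l * e / (real M ^ (n - l) * real M ^ Suc l)"
      by (simp add: K_def field_simps)
    also have "\<dots> = a * (K * D ^ Suc l)" unfolding MM a_def by simp
    finally show ?thesis .
  qed
  have errn: "J k (\<lambda>x. (err (Suc n) x)\<^sup>2) \<le> a * (K * D ^ n)"
  proof -
    have "J k (\<lambda>x. (err (Suc n) x)\<^sup>2) \<le> T * \<kappa>\<^sup>2 * (h * (\<Sum>j<k. sq_err (U n j) j))"
      unfolding err_def using bias_second_moment[OF k k0, of "U n"] contU k by simp
    also have "\<dots> \<le> K * (A * (D / real M) ^ n * e / real M)"
    proof (rule mult_mono)
      show "T * \<kappa>\<^sup>2 \<le> K" "0 \<le> K" using T by (auto simp: K_def)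
      show "h * (\<Sum>j<k. sq_err (U n j) j) \<le> A * (D / real M) ^ n * e / real M" by (rule expsum) simp
      show "0 \<le> h * (\<Sum>j<k. sq_err (U n j) j)"
        using h contU k by (intro mult_nonneg_nonneg sum_nonneg)
          (auto simp: sq_err_def intro!: pos_functional_nonneg[OF J] continuous_intros cont_w)
    qed
    also have "\<dots> = a * (K * D ^ n)" by (simp add: a_def power_divide mult_ac)
    finally show ?thesis .
  qed
  have "sq_err F k = J k (\<lambda>x. (\<Sum>i<Suc (Suc n). err i x)\<^sup>2)" unfolding sq_err_def split ..
  also have "\<dots> \<le> J k (\<lambda>x. \<Sum>i<Suc (Suc n). 2 ^ (Suc (Suc n) - i) * (err i x)\<^sup>2)"
    by (rule pos_functional_mono[OF J _ _ sum_square_le_geometric]) (intro continuous_intros conterr)+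
  also have "\<dots> = (\<Sum>i<Suc (Suc n). 2 ^ (Suc (Suc n) - i) * J k (\<lambda>x. (err i x)\<^sup>2))"
    by (rule pos_functional_sum[OF J]) (auto intro!: continuous_intros conterr)
  also have "\<dots> = (\<Sum>i<Suc n. 2 ^ (n + 2 - i) * J k (\<lambda>x. (err i x)\<^sup>2)) + 2 * J k (\<lambda>x. (err (Suc n) x)\<^sup>2)"
    by simp
  also have "\<dots> \<le> (\<Sum>i<Suc n. 2 ^ (n + 2 - i) * (a * ((1 + K) * D ^ i))) + 2 * (a * (K * D ^ n))"
  proof (intro add_mono sum_mono mult_left_mono errn)
    fix i assume i: "i \<in> {..<Suc n}"
    show "J k (\<lambda>x. (err i x)\<^sup>2) \<le> a * ((1 + K) * D ^ i)"
    proof (cases i)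
      case 0
      have "a * ((1 + K) * D ^ 0) = a + a * K" by (simp add: algebra_simps)
      then show ?thesis unfolding 0 using err0 mult_nonneg_nonneg[OF a0 K(1)] by linarith
    next
      case (Suc l)
      have "a * (K * D ^ Suc l) \<le> a * ((1 + K) * D ^ Suc l)"
        using a0 D1 by (intro mult_left_mono mult_right_mono) auto
      then show ?thesis using errS[of l] i Suc by force
    qed
  qed auto
  also have "\<dots> = a * ((1 + K) * (\<Sum>i<Suc n. 2 ^ (n + 2 - i) * D ^ i) + K * (2 * D ^ n))"
    by (simp add: sum_distrib_left distrib_left mult_ac del: sum.lessThan_Suc)
  \<comment> \<open>The bias is absorbed by the summand with \<open>i = n\<close>, whose weight is
    4.\<close>
  also have "\<dots> \<le> a * ((1 + K) * (\<Sum>i<Suc n. 2 ^ (n + 2 - i) * D ^ i) + K * (\<Sum>i<Suc n. 2 ^ (n + 2 - i) * D ^ i))"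
  proof (intro mult_left_mono add_left_mono)
    have "2 * D ^ n \<le> 2 ^ (n + 2 - n) * D ^ n" using D1 by simp
    also have "\<dots> \<le> (\<Sum>i<Suc n. 2 ^ (n + 2 - i) * D ^ i)"
      by (rule member_le_sum) (use D1 in auto)
    finally show "2 * D ^ n \<le> (\<Sum>i<Suc n. 2 ^ (n + 2 - i) * D ^ i)" .
  qed (use a0 K in auto)
  also have "\<dots> = a * (c * (\<Sum>i<Suc n. 2 ^ (n + 2 - i) * D ^ i))"
    by (simp add: c_def algebra_simps)
  also have "\<dots> \<le> a * D ^ Suc n"
    by (rule mult_left_mono[OF geometric_weights_le[OF K(2,3)] a0])
  also have "\<dots> = A * (D / real M) ^ Suc n * e" by (simp add: a_def power_divide)
  finally have main: "sq_err F k \<le> A * (D / real M) ^ Suc n * e" .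
  have "F \<in> nn d (V * (3 * M) ^ Suc n) (H + Suc n)"
  proof -
    have VM: "V \<le> V * (3 * M) ^ l" for l using M by simp
    have nng: "(\<lambda>x. 0 + (\<Sum>i<M ^ Suc n. 1 / real (M ^ Suc n) * g (shift (z0 i) x))) \<in> nn d (\<Sum>i<M ^ Suc n. V) (H + Suc n)"
      by (rule nn_sum) (auto intro!: nn_shift nn_pad[OF gn V(1)])
    \<comment> \<open>Level \<open>l\<close> has depth \<open>H + l\<close> and \<open>f\<close>
      adds one layer; padding then gives all summands the depth \<open>H + Suc n\<close>.\<close>
    have fU: "(\<lambda>x. f (U l j x)) \<in> nn d (V * (3 * M) ^ l) (H + Suc n)" if "l \<le> n" "j < k" for l j
    proof (rule nn_pad[OF nn_compose[OF Unn fr]])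
      show "m \<le> V * (3 * M) ^ l" "2 \<le> V * (3 * M) ^ l" using VM V le_trans by blast+
    qed (use that k in auto)
    have nnG: "G l j \<in> nn d (V * (3 * M) ^ Suc l + V * (3 * M) ^ l) (H + Suc n)" if "l < n" "j < k" for l j
      using nn_add[OF fU[of "Suc l" j] fU[of l j], of "h * real k" "- (h * real k)" 0] that
      unfolding G_def[abs_def] by (simp add: algebra_simps)
    have nnSG: "SG l \<in> nn d (V * (M ^ (n - l) * ((3 * M) ^ Suc l + (3 * M) ^ l))) (H + Suc n)" if l: "l < n" for l
    proof -
      have "(\<lambda>x. 0 + (\<Sum>i<M ^ (n - l). 1 / real (M ^ (n - l)) * G l (\<tau> l i) (shift (z l i) x)))
         \<in> nn d (\<Sum>i<M ^ (n - l). V * (3 * M) ^ Suc l + V * (3 * M) ^ l) (H + Suc n)"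
        by (rule nn_sum) (use nnG[OF l \<tau>[OF l]] in \<open>auto intro!: nn_shift\<close>)
      moreover have "(\<lambda>x. 0 + (\<Sum>i<M ^ (n - l). 1 / real (M ^ (n - l)) * G l (\<tau> l i) (shift (z l i) x))) = SG l"
        by (simp add: SG_def[abs_def] sum_divide_distrib)
      moreover have "(\<Sum>i<M ^ (n - l). V * (3 * M) ^ Suc l + V * (3 * M) ^ l) = V * (M ^ (n - l) * ((3 * M) ^ Suc l + (3 * M) ^ l))"
        by (simp add: algebra_simps)
      ultimately show ?thesis by (simp only:)
    qed
    have "(\<lambda>x. h * real k * f 0 + (\<Sum>l<n. 1 * SG l x)) \<in> nn d (\<Sum>l<n. V * (M ^ (n - l) * ((3 * M) ^ Suc l + (3 * M) ^ l))) (H + Suc n)"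
      by (rule nn_sum) (use nnSG in auto)
    then have "(\<lambda>x. 1 * Sg x + 1 * (h * real k * f 0 + (\<Sum>l<n. SG l x)) + 0)
        \<in> nn d ((\<Sum>i<M ^ Suc n. V) + (\<Sum>l<n. V * (M ^ (n - l) * ((3 * M) ^ Suc l + (3 * M) ^ l)))) (H + Suc n)"
      using nng by (intro nn_add) (auto simp: Sg_def[abs_def] sum_divide_distrib)
    moreover have "(\<lambda>x. 1 * Sg x + 1 * (h * real k * f 0 + (\<Sum>l<n. SG l x)) + 0) = F"
      by (auto simp: F_def)
    moreover have "(\<Sum>i<M ^ Suc n. V) + (\<Sum>l<n. V * (M ^ (n - l) * ((3 * M) ^ Suc l + (3 * M) ^ l)))
        = V * (M ^ Suc n + (\<Sum>l<n. M ^ (n - l) * ((3 * M) ^ Suc l + (3 * M) ^ l)))"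
      by (simp add: distrib_left sum_distrib_left del: power_Suc)
    moreover have "\<dots> \<le> V * (3 * M) ^ Suc n" by (rule mult_left_mono[OF geometric_width_le[OF M]]) simp
    ultimately show ?thesis using nn_mono by metis
  qed
  then show ?thesis using main unfolding e_def by blast
qed

text \<open>The induction carries the table of all levels and times, because a new level samples all
  earlier levels at earlier times. At level 0 the zero function has the second moment of
  \<open>w k\<close> as its error, hence the second bound by \<open>A\<close>; at
  \<open>k = N\<close> the functional \<open>J N\<close> is \<open>I\<close>.\<close>

lemma multilevel_picard:
  assumes M: "1 \<le> M" and V: "2 \<le> V" "m \<le> V" and gn: "g \<in> nn d V H" and fr: "relu_sum m f"
    and A: "J 0 (\<lambda>x. (g x)\<^sup>2) \<le> A" "\<And>k. k \<le> N \<Longrightarrow> J k (\<lambda>x. (w k x)\<^sup>2) \<le> A"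
    and D: "6 + 32 * T * \<kappa>\<^sup>2 \<le> D"
  shows "\<exists>F\<in>nn d (V * (3 * M) ^ n) (H + n). I (\<lambda>x. (F x - w N x)\<^sup>2) \<le> A * (D / real M) ^ n * exp (real M * T)"
proof -
  have A0: "0 \<le> A" using A pos_functional_nonneg[OF J, of "\<lambda>x. (g x)\<^sup>2" 0] g by (force intro!: continuous_intros)
  define P where "P U l \<longleftrightarrow> (\<forall>j\<le>N. U j \<in> nn d (V * (3 * M) ^ l) (H + l) \<and>
     sq_err (U j) j \<le> A * (D / real M) ^ l * exp (real M * (h * real j)))" for U l
  have "\<exists>U. (\<forall>j. U 0 j = (\<lambda>x. 0)) \<and> (\<forall>l\<le>n. P (U l) l)"
  proof (induction n)
    case 0
    have "sq_err (\<lambda>x. 0) j \<le> A * exp (real M * (h * real j))" if "j \<le> N" for j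
    proof -
      have "sq_err (\<lambda>x. 0) j \<le> A * 1" using A(2)[OF that] by (simp add: sq_err_def)
      also have "\<dots> \<le> A * exp (real M * (h * real j))" using A0 h by (intro mult_left_mono) auto
      finally show ?thesis .
    qed
    moreover have "(\<lambda>x. 0) \<in> nn d V H" using nn_mono[OF nn_const] by auto
    ultimately show ?case by (intro exI[of _ "\<lambda>_ _ _. 0"]) (auto simp: P_def)
  next
    case (Suc n)
    then obtain U where U: "\<And>j. U 0 j = (\<lambda>x. 0)" "\<And>l. l \<le> n \<Longrightarrow> P (U l) l" by blast
    have "\<exists>F. j \<le> N \<longrightarrow> F \<in> nn d (V * (3 * M) ^ Suc n) (H + Suc n) \<and>
        sq_err F j \<le> A * (D / real M) ^ Suc n * exp (real M * (h * real j))" for j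
      using multilevel_step[of j M V m d H U n A D] M V gn fr A D U unfolding P_def by blast
    then obtain W where "P W (Suc n)" unfolding P_def by metis
    then show ?case using U by (intro exI[of _ "U(Suc n := W)"]) (auto simp: le_Suc_eq)
  qed
  then obtain U where "P (U n) n" by blast
  then show ?thesis unfolding P_def sq_err_def J_def using hN
    by (intro bexI[of _ "U n N"]) auto
qed

end

section \<open>Random walk averages and weights\<close>

definition avg_step :: "nat \<Rightarrow> real \<Rightarrow> ((nat \<Rightarrow> real) \<Rightarrow> real) \<Rightarrow> ((nat \<Rightarrow> real) \<Rightarrow> real)" where
  "avg_step d s F x = (\<Sum>i<d. F (x(i := x i + s)) + F (x(i := x i - s))) / (2 * real d)"

lemma shift_average_avg_step:
  assumes "1 \<le> d" shows "shift_average (avg_step d s)"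
proof (rule shift_averageI)
  define z where "z p = (\<lambda>j. if j = fst p then snd p * s else 0)" for p :: "nat \<times> real"
  show "finite ({..<d} \<times> {1, - 1 :: real})" "{..<d} \<times> {1, - 1 :: real} \<noteq> {}" using assms by (auto simp: lessThan_empty_iff)
  have z: "(\<lambda>j. x j + z (i, r) j) = x(i := x i + r * s)" for x i r
    by (auto simp: z_def)
  have "(\<Sum>p\<in>{..<d} \<times> {1, - 1}. F (\<lambda>j. x j + z p j)) = (\<Sum>i<d. \<Sum>r\<in>{1, - 1}. F (\<lambda>j. x j + z (i, r) j))" for F :: "(nat \<Rightarrow> real) \<Rightarrow> real" and x
    by (subst sum.cartesian_product) auto
  then show "avg_step d s F x = (\<Sum>p\<in>{..<d} \<times> {1, - 1}. F (\<lambda>j. x j + z p j)) / real (card ({..<d} \<times> {1, - 1 :: real}))" for F x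
    by (simp add: avg_step_def z card_cartesian_product mult.commute)
qed

text \<open>Rate \<open>a = 1\<close> measures growth and rate \<open>a = 2\<close> gives the
  barrier. Taking \<open>cosh\<close> instead of an exponential of the modulus is what makes the
  weight an eigenfunction.\<close>

definition weight :: "nat \<Rightarrow> real \<Rightarrow> (nat \<Rightarrow> real) \<Rightarrow> real" where
  "weight d a x = (\<Sum>i<d. cosh (a * x i))"

lemma cont_weight: "cont (weight d a)"
  unfolding weight_def[abs_def]
  by (intro continuous_intros continuous_on_product_coordinates)

lemma weight_ge: "real d \<le> weight d a x"
proof -
  have "(\<Sum>i<d. 1) \<le> weight d a x" unfolding weight_def by (intro sum_mono cosh_real_ge_1)
  then show ?thesis by simp
qed

lemma cosh_le_quadratic:
  fixes y :: real assumes "\<bar>y\<bar> \<le> 1" shows "cosh y \<le> 1 + 2 * y\<^sup>2"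
proof -
  have e: "exp z \<le> 1 + z + 2 * z\<^sup>2" if z: "\<bar>z\<bar> \<le> 1" for z :: real
  proof -
    obtain t where t: "\<bar>t\<bar> \<le> \<bar>z\<bar>" "exp z = (\<Sum>m<2. z ^ m / fact m) + exp t / fact 2 * z ^ 2"
      using Maclaurin_exp_le[of z 2] by blast
    have "exp t \<le> exp 1" using t z by simp
    then have "exp t \<le> 3" using exp_le by linarith
    then have "exp t / fact 2 * z ^ 2 \<le> 2 * z ^ 2" by (intro mult_right_mono) auto
    then show ?thesis using t(2) by (simp add: eval_nat_numeral)
  qed
  show ?thesis using e[of y] e[of "- y"] assms unfolding cosh_field_def by simp
qed

text \<open>The weights are eigenfunctions of the averaging step, with a rate that is free of the dimension.\<close>

lemma avg_step_weight:
  assumes "1 \<le> d"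
  shows "avg_step d s (weight d a) x = (1 + (cosh (a * s) - 1) / real d) * weight d a x"
proof -
  have u: "weight d a (x(i := y)) = weight d a x - cosh (a * x i) + cosh (a * y)" if "i < d" for i y
  proof -
    have "(\<Sum>j\<in>{..<d} - {i}. cosh (a * (x(i := y)) j)) = (\<Sum>j\<in>{..<d} - {i}. cosh (a * x j))"
      by (rule sum.cong) auto
    then show ?thesis using that unfolding weight_def by (simp add: sum.remove[of "{..<d}" i])
  qed
  have "(\<Sum>i<d. weight d a (x(i := x i + s)) + weight d a (x(i := x i - s))) =
     (\<Sum>i<d. 2 * weight d a x + 2 * (cosh (a * s) - 1) * cosh (a * x i))"
    by (rule sum.cong) (auto simp: u cosh_add cosh_diff algebra_simps)
  also have "\<dots> = 2 * real d * weight d a x + 2 * (cosh (a * s) - 1) * weight d a x"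
    by (simp add: sum.distrib weight_def flip: sum_distrib_left)
  finally show ?thesis using assms unfolding avg_step_def by (simp add: field_simps)
qed

text \<open>The factor \<open>d\<close> in \<open>s\<^sup>2\<close> cancels the \<open>1 / d\<close>
  that comes from moving one coordinate out of \<open>d\<close>.\<close>

lemma avg_step_weight_le:
  assumes "1 \<le> d" "s\<^sup>2 = 2 * real d * h" "\<bar>a * s\<bar> \<le> 1"
  shows "avg_step d s (weight d a) x \<le> (1 + 4 * a\<^sup>2 * h) * weight d a x"
proof -
  have "(cosh (a * s) - 1) / real d \<le> 2 * (a * s)\<^sup>2 / real d"
    using cosh_le_quadratic[OF assms(3)] by (intro divide_right_mono) auto
  also have "\<dots> = 4 * a\<^sup>2 * h" using assms(1) by (simp add: power_mult_distrib assms(2))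
  finally have "1 + (cosh (a * s) - 1) / real d \<le> 1 + 4 * a\<^sup>2 * h" by simp
  then show ?thesis unfolding avg_step_weight[OF assms(1)]
    using weight_ge[of d a x] by (intro mult_right_mono) auto
qed

lemma cosh_ge_exp: "exp \<bar>y\<bar> \<le> 2 * cosh (y :: real)"
  unfolding cosh_field_def by (cases "0 \<le> y") auto

lemma weight_1_le_2: "weight d 1 x \<le> weight d 2 x"
  unfolding weight_def
proof (rule sum_mono)
  fix i
  have "1 * cosh (x i) \<le> (cosh (x i))\<^sup>2" "1 \<le> (cosh (x i))\<^sup>2"
    using cosh_real_ge_1[of "x i"] unfolding power2_eq_square by (auto intro: mult_right_mono mult_ge1_I)
  then have "cosh (x i) \<le> cosh (2 * x i)" unfolding cosh_double_cosh by linarith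
  then show "cosh (1 * x i) \<le> cosh (2 * x i)" by simp
qed

lemma weight_1_square: "(weight d 1 x)\<^sup>2 \<le> real d * weight d 2 x"
proof -
  have "(\<Sum>i<d. cosh (x i) * 1)\<^sup>2 \<le> (\<Sum>i<d. (cosh (x i))\<^sup>2) * (\<Sum>i<d. 1\<^sup>2)" by (rule Cauchy_Schwarz_ineq_sum)
  also have "\<dots> \<le> (\<Sum>i<d. cosh (2 * x i)) * real d"
  proof -
    have "(cosh (x i))\<^sup>2 \<le> cosh (2 * x i)" for i
      unfolding cosh_double_cosh using cosh_real_ge_1[of "x i"] one_le_power[of "cosh (x i)" 2] by linarith
    then show ?thesis by (simp add: mult_right_mono sum_mono)
  qed
  finally show ?thesis by (simp add: weight_def mult.commute)
qed

lemma weight_cube: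
  assumes "x \<in> unit_cube d" "0 \<le> a" shows "weight d a x \<le> real d * cosh a"
proof -
  have "cosh (a * x i) \<le> cosh a" if "i < d" for i
  proof -
    have "0 \<le> x i" "x i \<le> 1" using assms(1) that by (auto simp: PiE_iff)
    then show ?thesis using assms(2) by (subst cosh_real_nonneg_le_iff) (auto simp: mult_left_le)
  qed
  then have "weight d a x \<le> (\<Sum>i<d. cosh a)" unfolding weight_def by (intro sum_mono) auto
  then show ?thesis by simp
qed

lemma powr_le_exp:
  fixes r q :: real assumes "0 < q" "0 \<le> r" shows "r powr q \<le> q powr q * exp r"
proof -
  have "r / q \<le> exp (r / q)" using exp_ge_add_one_self[of "r / q"] by linarith
  then have "r \<le> q * exp (r / q)" using assms by (simp add: field_simps)
  then have "r powr q \<le> (q * exp (r / q)) powr q" using assms by (intro powr_mono2) auto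
  also have "\<dots> = q powr q * exp r" using assms by (simp add: powr_mult exp_powr_real)
  finally show ?thesis .
qed

text \<open>The norm is at most \<open>d\<close> times the largest modulus of a coordinate, whose
  \<open>q\<close>-th power is dominated by its exponential. Applied with
  \<open>q = \<kappa>\<close>, where the factor is polynomial in \<open>d\<close>, and with
  \<open>q = c d\<close>, where its size does not matter.\<close>

lemma L2_growth:
  assumes "0 < q" "1 \<le> d"
  shows "1 + L2_set x {..<d} powr q \<le> (1 + 2 * q powr q) * real d powr q * weight d 1 x"
proof -
  have ne: "finite ((\<lambda>i. \<bar>x i\<bar>) ` {..<d})" "(\<lambda>i. \<bar>x i\<bar>) ` {..<d} \<noteq> {}" using assms(2) by (auto simp: lessThan_empty_iff)
  obtain i where i: "i < d" "\<bar>x i\<bar> = Max ((\<lambda>i. \<bar>x i\<bar>) ` {..<d})"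
    using Max_in[OF ne] by auto
  have le: "\<bar>x j\<bar> \<le> \<bar>x i\<bar>" if "j < d" for j unfolding i(2) using that ne by (intro Max_ge) auto
  have "L2_set x {..<d} \<le> (\<Sum>j<d. \<bar>x j\<bar>)" by (rule L2_set_le_sum_abs)
  also have "\<dots> \<le> (\<Sum>j<d. \<bar>x i\<bar>)" using le by (intro sum_mono) auto
  finally have "L2_set x {..<d} \<le> real d * \<bar>x i\<bar>" by simp
  then have "L2_set x {..<d} powr q \<le> (real d * \<bar>x i\<bar>) powr q"
    using assms by (intro powr_mono2) (auto simp: L2_set_nonneg)
  also have "\<dots> = real d powr q * \<bar>x i\<bar> powr q" by (simp add: powr_mult)
  also have "\<dots> \<le> real d powr q * (q powr q * exp \<bar>x i\<bar>)"
    using powr_le_exp[OF assms(1), of "\<bar>x i\<bar>"] by (intro mult_left_mono) auto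
  also have "\<dots> \<le> real d powr q * (q powr q * (2 * weight d 1 x))"
  proof (intro mult_left_mono)
    have "cosh (1 * x i) \<le> weight d 1 x" unfolding weight_def using i(1)
      by (intro member_le_sum[of i "{..<d}" "\<lambda>i. cosh (1 * x i)"]) auto
    then show "exp \<bar>x i\<bar> \<le> 2 * weight d 1 x" using cosh_ge_exp[of "x i"] by simp
  qed auto
  finally have 1: "L2_set x {..<d} powr q \<le> 2 * q powr q * real d powr q * weight d 1 x" by (simp add: mult_ac)
  have "1 \<le> weight d 1 x" using weight_ge[of d 1 x] assms(2) by linarith
  moreover have "1 \<le> real d powr q" using assms by (simp add: ge_one_powr_ge_zero)
  ultimately have "1 * 1 \<le> real d powr q * weight d 1 x" by (intro mult_mono) auto
  then show ?thesis using 1 by (simp add: distrib_right)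
qed

section \<open>The cube integral as a positive functional\<close>

abbreviation cube_integral :: "nat \<Rightarrow> ((nat \<Rightarrow> real) \<Rightarrow> real) \<Rightarrow> real" where
  "cube_integral d F \<equiv> (LINT x:unit_cube d|lebesgue_Rd d. F x)"

text \<open>On the space of \<open>lebesgue_Rd d\<close> every coordinate from \<open>d\<close> on
  has the constant value \<open>undefined\<close>, so the inclusion into the full product is
  measurable; for countably many factors the product sigma-algebra is the Borel one.\<close>

lemma borel_measurable_cont:
  assumes "cont F" shows "F \<in> borel_measurable (lebesgue_Rd d)"
proof -
  have "(\<lambda>x. x) \<in> measurable (lebesgue_Rd d) (Pi\<^sub>M UNIV (\<lambda>_. borel :: real measure))"
  proof (rule measurable_PiM_single')
    fix i :: nat
    show "(\<lambda>x. x i) \<in> measurable (lebesgue_Rd d) (borel :: real measure)"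
    proof (cases "i < d")
      case True
      have "(\<lambda>x. x i) \<in> measurable (lebesgue_Rd d) lborel"
        by (rule measurable_component_singleton) (use True in simp)
      then show ?thesis by simp
    next
      case False
      have "(\<lambda>x. x i) \<in> measurable (lebesgue_Rd d) (borel :: real measure) \<longleftrightarrow>
         (\<lambda>x. undefined) \<in> measurable (lebesgue_Rd d) (borel :: real measure)"
        by (rule measurable_cong) (use False in \<open>auto simp: space_PiM PiE_iff extensional_def\<close>)
      then show ?thesis by simp
    qed
  qed auto
  then have "(\<lambda>x. x) \<in> measurable (lebesgue_Rd d) borel"
    using measurable_cong_sets[OF refl sets_PiM_equal_borel] by blast
  from measurable_compose[OF this borel_measurable_continuous_onI[OF assms]] show ?thesis by simp
qed

lemma emeasure_unit_cube: "emeasure (lebesgue_Rd d) (unit_cube d) = 1"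
proof -
  interpret product_sigma_finite "\<lambda>_ :: nat. lborel :: real measure" ..
  show ?thesis by (subst emeasure_PiM) auto
qed

lemma sets_unit_cube: "unit_cube d \<in> sets (lebesgue_Rd d)"
  by (rule sets_PiM_I_finite) auto

text \<open>Tychonoff: the box is a full product in which the coordinates from \<open>d\<close> on
  range over the singleton of \<open>undefined\<close>.\<close>

lemma compact_box: "compact ({..<d :: nat} \<rightarrow>\<^sub>E {a..b :: real})"
proof -
  have "compactin (product_topology (\<lambda>_ :: nat. euclidean :: real topology) UNIV)
     (PiE UNIV (\<lambda>i. if i < d then {a..b} else {undefined}))"
    unfolding compactin_PiE by auto
  moreover have "PiE UNIV (\<lambda>i. if i < d then {a..b} else {undefined}) = {..<d} \<rightarrow>\<^sub>E {a..b}"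
  proof (rule Set.set_eqI)
    fix x :: "nat \<Rightarrow> real"
    have "x i \<in> (if i < d then {a..b} else {undefined}) \<longleftrightarrow>
        (i < d \<longrightarrow> x i \<in> {a..b}) \<and> (\<not> i < d \<longrightarrow> x i = undefined)" for i by simp
    then show "x \<in> PiE UNIV (\<lambda>i. if i < d then {a..b} else {undefined}) \<longleftrightarrow> x \<in> {..<d} \<rightarrow>\<^sub>E {a..b}"
      unfolding PiE_iff extensional_def by blast
  qed
  ultimately show ?thesis by (simp add: euclidean_product_topology)
qed

lemma set_integrable_cube:
  assumes "cont F" shows "set_integrable (lebesgue_Rd d) (unit_cube d) F"
proof -
  have "bounded (F ` unit_cube d)"
    by (rule compact_imp_bounded[OF compact_continuous_image[OF continuous_on_subset[OF assms] compact_box]]) simp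
  then obtain B where "\<And>x. x \<in> unit_cube d \<Longrightarrow> norm (F x) \<le> B" unfolding bounded_iff by auto
  then show ?thesis unfolding set_integrable_def
    using borel_measurable_cont[OF assms] sets_unit_cube emeasure_unit_cube
    by (intro integrableI_bounded_set_indicator[where B = B]) auto
qed

lemma pos_functional_cube: "pos_functional (cube_integral d)"
  unfolding pos_functional_def
proof (intro conjI allI impI)
  fix F G a b assume FG: "cont F" "cont G"
  show "cube_integral d (\<lambda>x. a * F x + b * G x) = a * cube_integral d F + b * cube_integral d G"
    using set_integrable_cube[OF FG(1)] set_integrable_cube[OF FG(2)] by (subst set_integral_add) auto
next
  fix F G assume FG: "cont F" "cont G" "\<forall>x. F x \<le> G x"
  then show "cube_integral d F \<le> cube_integral d G"
    using set_integrable_cube by (intro set_integral_mono) auto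
qed

lemma cube_integral_le:
  assumes "cont F" "\<And>x. x \<in> unit_cube d \<Longrightarrow> F x \<le> C"
  shows "cube_integral d F \<le> C"
proof -
  have "cube_integral d F \<le> cube_integral d (\<lambda>x. C)"
    by (intro set_integral_mono set_integrable_cube assms) auto
  also have "\<dots> = measure (lebesgue_Rd d) (unit_cube d) * C"
    using set_integral_const[of "unit_cube d" "lebesgue_Rd d" C] sets_unit_cube emeasure_unit_cube by simp
  also have "\<dots> = C" by (simp add: measure_def emeasure_unit_cube)
  finally show ?thesis .
qed

section \<open>Convergence of the random walk scheme\<close>

text \<open>Symmetrizing in \<open>y\<close> removes the first-order term; the second-order Taylor
  remainder then needs only a modulus of continuity of the second derivative, which is all that
  \<open>C12\<close> offers.\<close>

lemma second_difference:
  fixes \<phi> :: "real \<Rightarrow> real"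
  assumes "\<And>y. (\<phi> has_real_derivative \<phi>' y) (at y)" "\<And>y. (\<phi>' has_real_derivative \<phi>'' y) (at y)"
    and "0 < s" "\<And>y. \<bar>y\<bar> \<le> s \<Longrightarrow> \<bar>\<phi>'' y - \<phi>'' 0\<bar> \<le> e"
  shows "\<bar>\<phi> s + \<phi> (- s) - 2 * \<phi> 0 - s\<^sup>2 * \<phi>'' 0\<bar> \<le> s\<^sup>2 * e"
proof -
  define dd where "dd m y = (if m = 0 then \<phi> y + \<phi> (- y) else if m = 1 then \<phi>' y - \<phi>' (- y)
     else \<phi>'' y + \<phi>'' (- y))" for m :: nat and y
  have c1: "((\<lambda>y. \<phi> (- y)) has_real_derivative - \<phi>' (- y)) (at y)" for y
    using DERIV_chain'[OF DERIV_minus[OF DERIV_ident] assms(1)] by simp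
  have c2: "((\<lambda>y. \<phi>' (- y)) has_real_derivative - \<phi>'' (- y)) (at y)" for y
    using DERIV_chain'[OF DERIV_minus[OF DERIV_ident] assms(2)] by simp
  have "\<exists>t>0. t < s \<and> \<phi> s + \<phi> (- s) = (\<Sum>m<2. dd m 0 / fact m * s ^ m) + dd 2 t / fact 2 * s ^ 2"
  proof (rule Maclaurin)
    show "\<forall>m t. m < 2 \<and> 0 \<le> t \<and> t \<le> s \<longrightarrow> DERIV (dd m) t :> dd (Suc m) t"
      using DERIV_add[OF assms(1) c1] DERIV_diff[OF assms(2) c2] by (auto simp: dd_def[abs_def] less_2_cases_iff)
  qed (use assms(3) in \<open>auto simp: dd_def\<close>)
  then obtain t where t: "0 < t" "t < s" "\<phi> s + \<phi> (- s) = 2 * \<phi> 0 + (\<phi>'' t + \<phi>'' (- t)) / 2 * s\<^sup>2"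
    by (auto simp: dd_def eval_nat_numeral)
  define q where "q = ((\<phi>'' t - \<phi>'' 0) + (\<phi>'' (- t) - \<phi>'' 0)) / 2"
  have "\<phi> s + \<phi> (- s) - 2 * \<phi> 0 - s\<^sup>2 * \<phi>'' 0 = s\<^sup>2 * q"
    unfolding t(3) q_def by (simp add: field_simps)
  moreover have "\<bar>q\<bar> \<le> e"
    using assms(4)[of t] assms(4)[of "- t"] t by (simp add: q_def abs_le_iff)
  ultimately show ?thesis by (simp add: abs_mult mult_left_mono)
qed

text \<open>The metric on functions is a series over the coordinates with weights
  \<open>(1/2)^n\<close>; bounding every term by the change gives the factor 2.\<close>

lemma dist_fun_upd: "dist (x(i := y)) (x :: nat \<Rightarrow> real) \<le> 2 * \<bar>y - x i\<bar>"
proof -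
  have le: "(1/2)^n * min (dist ((x(i := y)) (from_nat n)) (x (from_nat n))) 1 \<le> (1/2)^n * \<bar>y - x i\<bar>" for n
    by (intro mult_left_mono) (auto simp: dist_real_def)
  have g: "summable (\<lambda>n. (1/2)^n * \<bar>y - x i\<bar>)" by (intro summable_mult2 summable_geometric) auto
  have "dist (x(i := y)) x \<le> (\<Sum>n. (1/2)^n * \<bar>y - x i\<bar>)"
    unfolding dist_fun_def
  proof (rule suminf_le[OF le _ g])
    show "summable (\<lambda>n. (1/2)^n * min (dist ((x(i := y)) (from_nat n)) (x (from_nat n))) 1)"
      by (rule summable_comparison_test'[OF g, of 0]) (use le in \<open>auto simp: abs_mult\<close>)
  qed
  also have "\<dots> = 2 * \<bar>y - x i\<bar>" by (simp add: suminf_mult2[symmetric] summable_geometric suminf_geometric)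
  finally show ?thesis .
qed

lemma restrict_fun_upd: "i \<in> A \<Longrightarrow> restrict (x(i := y)) A = (restrict x A)(i := y)"
  by (auto simp: restrict_def)

text \<open>Invariance under \<open>restrict\<close> moves \<open>x\<close> into an extensional box,
  which is compact; the box is enlarged by 1 to contain the displaced points.\<close>

lemma uniform_local_continuity:
  fixes G :: "real \<Rightarrow> (nat \<Rightarrow> real) \<Rightarrow> real"
  assumes cont: "continuous_on ({0..T} \<times> UNIV) (\<lambda>(t, x). G t x)"
    and restr: "\<And>t x. G t (restrict x {..<d}) = G t x" and "0 < e"
  shows "\<exists>\<delta>>0. \<forall>t\<in>{0..T}. \<forall>t'\<in>{0..T}. \<forall>x i s. (\<forall>j<d. \<bar>x j\<bar> \<le> R) \<longrightarrow> i < d \<longrightarrow> \<bar>t' - t\<bar> < \<delta> \<longrightarrow> \<bar>s\<bar> < \<delta> \<longrightarrow>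
     \<bar>G t' (x(i := x i + s)) - G t x\<bar> \<le> e"
proof -
  let ?K = "{0..T} \<times> ({..<d} \<rightarrow>\<^sub>E {-R-1..R+1})"
  have "uniformly_continuous_on ?K (\<lambda>(t, x). G t x)"
    by (rule compact_uniformly_continuous[OF continuous_on_subset[OF cont] compact_Times[OF compact_Icc compact_box]]) auto
  then obtain \<delta>0 where \<delta>0: "0 < \<delta>0" "\<And>p q. p \<in> ?K \<Longrightarrow> q \<in> ?K \<Longrightarrow> dist q p < \<delta>0 \<Longrightarrow> dist ((\<lambda>(t, x). G t x) q) ((\<lambda>(t, x). G t x) p) < e"
    using \<open>0 < e\<close> unfolding uniformly_continuous_on_def by metis
  \<comment> \<open>The two arguments are at distance at most
    \<open>\<bar>t' - t\<bar> + 2 * \<bar>s\<bar> < 3 * \<delta>\<close>, which is below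
    \<open>\<delta>0\<close>.\<close>
  define \<delta> where "\<delta> = min 1 (\<delta>0 / 4)"
  have "\<bar>G t' (x(i := x i + s)) - G t x\<bar> \<le> e"
    if t: "t \<in> {0..T}" "t' \<in> {0..T}" and x: "\<forall>j<d. \<bar>x j\<bar> \<le> R" and i: "i < d" and s: "\<bar>t' - t\<bar> < \<delta>" "\<bar>s\<bar> < \<delta>"
    for t t' x i s
  proof -
    let ?y = "restrict x {..<d}" and ?z = "(restrict x {..<d})(i := x i + s)"
    have "?y j \<in> {-R-1..R+1}" "?z j \<in> {-R-1..R+1}" if "j < d" for j
      using x[rule_format, OF that] x[rule_format, OF i] s that by (auto simp: \<delta>_def abs_le_iff)
    then have K: "(t, ?y) \<in> ?K" "(t', ?z) \<in> ?K" using t i by (auto simp: PiE_iff extensional_def)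
    have "dist (t', ?z) (t, ?y) \<le> dist t' t + dist ?z ?y"
      unfolding dist_prod_def using sqrt_sum_squares_le_sum[of "dist t' t" "dist ?z ?y"] by simp
    also have "\<dots> \<le> \<bar>t' - t\<bar> + 2 * \<bar>s\<bar>" using dist_fun_upd[of ?y i "x i + s"] i by (simp add: dist_real_def)
    also have "\<dots> < \<delta>0" using s unfolding \<delta>_def by linarith
    finally have "\<bar>G t' ?z - G t ?y\<bar> < e" using \<delta>0(2)[OF K] by (simp add: dist_real_def)
    moreover have "?z = restrict (x(i := x i + s)) {..<d}" using i by (simp add: restrict_fun_upd)
    ultimately show ?thesis using restr by (metis less_imp_le)
  qed
  moreover have "0 < \<delta>" using \<delta>0(1) by (simp add: \<delta>_def)
  ultimately show ?thesis by blast
qed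

text \<open>All functions depend on the first \<open>d\<close> coordinates only but are total, so
  they live on the same space as \<open>nn\<close> and \<open>cont\<close>. \<open>P1 i\<close> and
  \<open>P2 i\<close> are the first and the pure second derivatives in direction
  \<open>i\<close>.\<close>

locale heat_solution =
  fixes d :: nat and T \<kappa> :: real and f :: "real \<Rightarrow> real" and u :: "real \<Rightarrow> (nat \<Rightarrow> real) \<Rightarrow> real"
    and P1 P2 :: "nat \<Rightarrow> real \<Rightarrow> (nat \<Rightarrow> real) \<Rightarrow> real"
  assumes d: "1 \<le> d" and T: "0 < T"
    and lip: "\<And>v w. \<bar>f v - f w\<bar> \<le> \<kappa> * \<bar>v - w\<bar>"
    and u_cont: "continuous_on ({0..T} \<times> UNIV) (\<lambda>(t, x). u t x)"
    and P2_cont: "\<And>i. i < d \<Longrightarrow> continuous_on ({0..T} \<times> UNIV) (\<lambda>(t, x). P2 i t x)"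
    and u_restrict: "\<And>t x. u t (restrict x {..<d}) = u t x"
    and P2_restrict: "\<And>i t x. P2 i t (restrict x {..<d}) = P2 i t x"
    and P1: "\<And>i t x r. i < d \<Longrightarrow> t \<in> {0..T} \<Longrightarrow> ((\<lambda>r. u t (x(i := r))) has_real_derivative P1 i t (x(i := r))) (at r)"
    and P2: "\<And>i t x r. i < d \<Longrightarrow> t \<in> {0..T} \<Longrightarrow> ((\<lambda>r. P1 i t (x(i := r))) has_real_derivative P2 i t (x(i := r))) (at r)"
    and pde: "\<And>t x. 0 < t \<Longrightarrow> t < T \<Longrightarrow> ((\<lambda>s. u s x) has_real_derivative (\<Sum>i<d. P2 i t x) + f (u t x)) (at t)"
begin

lemma \<kappa>_nonneg: "0 \<le> \<kappa>" using lip[of 1 0] by simp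

lemma uniform_modulus:
  assumes "0 < e"
  shows "\<exists>\<delta>>0. \<forall>t\<in>{0..T}. \<forall>t'\<in>{0..T}. \<forall>x i s. (\<forall>j<d. \<bar>x j\<bar> \<le> R) \<longrightarrow> i < d \<longrightarrow> \<bar>t' - t\<bar> < \<delta> \<longrightarrow> \<bar>s\<bar> < \<delta> \<longrightarrow>
     \<bar>u t' (x(i := x i + s)) - u t x\<bar> \<le> e \<and> (\<forall>l<d. \<bar>P2 l t' (x(i := x i + s)) - P2 l t x\<bar> \<le> e)"
proof -
  define good where "good G \<delta> \<longleftrightarrow> (\<forall>t\<in>{0..T}. \<forall>t'\<in>{0..T}. \<forall>x i s. (\<forall>j<d. \<bar>x j\<bar> \<le> R) \<longrightarrow> i < d \<longrightarrow> \<bar>t' - t\<bar> < \<delta> \<longrightarrow> \<bar>s\<bar> < \<delta> \<longrightarrow>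
     \<bar>G t' (x(i := x i + s)) - G t x\<bar> \<le> e)" for G :: "real \<Rightarrow> (nat \<Rightarrow> real) \<Rightarrow> real" and \<delta>
  obtain \<delta>u where \<delta>u: "0 < \<delta>u" "good u \<delta>u"
    using uniform_local_continuity[OF u_cont u_restrict assms] unfolding good_def by blast
  have "\<exists>\<delta>>0. l < d \<longrightarrow> good (P2 l) \<delta>" for l
  proof (cases "l < d")
    case True
    show ?thesis using uniform_local_continuity[OF P2_cont[OF True] P2_restrict assms] unfolding good_def by blast
  qed (auto intro: exI[of _ 1])
  then obtain \<delta>P where \<delta>P: "\<And>l. 0 < \<delta>P l" "\<And>l. l < d \<Longrightarrow> good (P2 l) (\<delta>P l)" by metis
  define \<delta> where "\<delta> = min \<delta>u (Min (\<delta>P ` {..<d}))"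
  have fin: "finite (\<delta>P ` {..<d})" "\<delta>P ` {..<d} \<noteq> {}" using d by (auto simp: lessThan_empty_iff)
  have le: "\<delta> \<le> \<delta>u" "\<And>l. l < d \<Longrightarrow> \<delta> \<le> \<delta>P l"
    unfolding \<delta>_def using fin by (auto intro!: min.coboundedI2 Min_le)
  have "0 < \<delta>" unfolding \<delta>_def using \<delta>u(1) \<delta>P(1) fin by (simp add: Min_gr_iff)
  then show ?thesis
  proof (intro exI[of _ \<delta>] conjI ballI allI impI)
    fix t t' x i s assume *: "t \<in> {0..T}" "t' \<in> {0..T}" "\<forall>j<d. \<bar>x j\<bar> \<le> R" "i < d" "\<bar>t' - t\<bar> < \<delta>" "\<bar>s\<bar> < \<delta>"
    show "\<bar>u t' (x(i := x i + s)) - u t x\<bar> \<le> e"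
      using \<delta>u(2) * le(1) unfolding good_def by (meson less_le_trans)
    fix l assume "l < d"
    then show "\<bar>P2 l t' (x(i := x i + s)) - P2 l t x\<bar> \<le> e"
      using \<delta>P(2)[of l] * le(2)[of l] unfolding good_def by (meson less_le_trans)
  qed
qed

text \<open>A second difference close to \<open>s\<^sup>2 * P2 i\<close>, divided by
  \<open>2 * d\<close>, is close to \<open>h * P2 i\<close>: averaging acts as an Euler step for the
  Laplacian.\<close>

lemma avg_step_second_order:
  assumes t: "t \<in> {0..T}" and s: "0 < s" "s\<^sup>2 = 2 * real d * h"
    and P: "\<And>i y. i < d \<Longrightarrow> \<bar>y\<bar> \<le> s \<Longrightarrow> \<bar>P2 i t (x(i := x i + y)) - P2 i t x\<bar> \<le> e"
  shows "\<bar>avg_step d s (u t) x - u t x - h * (\<Sum>i<d. P2 i t x)\<bar> \<le> h * (real d * e)"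
proof -
  define r where "r i = u t (x(i := x i + s)) + u t (x(i := x i - s)) - 2 * u t x - s\<^sup>2 * P2 i t x" for i
  have r: "\<bar>r i\<bar> \<le> s\<^sup>2 * e" if i: "i < d" for i
  proof -
    have 1: "((\<lambda>y. u t (x(i := x i + y))) has_real_derivative P1 i t (x(i := x i + y))) (at y)" for y
      using DERIV_chain'[OF DERIV_add[OF DERIV_const DERIV_ident] P1[OF i t, of x "x i + y"]] by simp
    have 2: "((\<lambda>y. P1 i t (x(i := x i + y))) has_real_derivative P2 i t (x(i := x i + y))) (at y)" for y
      using DERIV_chain'[OF DERIV_add[OF DERIV_const DERIV_ident] P2[OF i t, of x "x i + y"]] by simp
    have "\<bar>P2 i t (x(i := x i + y)) - P2 i t (x(i := x i + 0))\<bar> \<le> e" if "\<bar>y\<bar> \<le> s" for y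
      using P[OF i that] by simp
    from second_difference[OF 1 2 s(1) this] show ?thesis by (simp add: r_def)
  qed
  have "avg_step d s (u t) x - u t x - h * (\<Sum>i<d. P2 i t x) = (\<Sum>i<d. r i) / (2 * real d)"
  proof -
    have "(\<Sum>i<d. r i) = (\<Sum>i<d. u t (x(i := x i + s)) + u t (x(i := x i - s))) - 2 * real d * u t x - s\<^sup>2 * (\<Sum>i<d. P2 i t x)"
      by (simp add: r_def sum_subtractf sum_distrib_left)
    then show ?thesis using d unfolding avg_step_def s(2) by (simp add: field_simps)
  qed
  also have "\<bar>\<dots>\<bar> \<le> (\<Sum>i<d. s\<^sup>2 * e) / (2 * real d)"
  proof -
    have "\<bar>\<Sum>i<d. r i\<bar> \<le> (\<Sum>i<d. s\<^sup>2 * e)" by (rule order_trans[OF sum_abs sum_mono]) (use r in auto)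
    then show ?thesis unfolding abs_divide using d by (intro frac_le) auto
  qed
  also have "\<dots> = h * (real d * e)" using d by (simp add: s(2))
  finally show ?thesis .
qed

lemma avg_step_near:
  assumes "\<And>i y. i < d \<Longrightarrow> \<bar>y\<bar> \<le> s \<Longrightarrow> \<bar>F (x(i := x i + y)) - c\<bar> \<le> e" "0 \<le> s"
  shows "\<bar>avg_step d s F x - c\<bar> \<le> e"
proof -
  have "avg_step d s F x - c = (\<Sum>i<d. (F (x(i := x i + s)) - c) + (F (x(i := x i - s)) - c)) / (2 * real d)"
    using d by (simp add: avg_step_def sum.distrib sum_subtractf field_simps)
  also have "\<bar>\<dots>\<bar> \<le> (\<Sum>i<d. 2 * e) / (2 * real d)"
  proof -
    have "\<bar>\<Sum>i<d. (F (x(i := x i + s)) - c) + (F (x(i := x i - s)) - c)\<bar> \<le>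
        (\<Sum>i<d. \<bar>(F (x(i := x i + s)) - c) + (F (x(i := x i - s)) - c)\<bar>)" by (rule sum_abs)
    also have "\<dots> \<le> (\<Sum>i<d. 2 * e)"
    proof (rule sum_mono)
      fix i assume "i \<in> {..<d}"
      then show "\<bar>(F (x(i := x i + s)) - c) + (F (x(i := x i - s)) - c)\<bar> \<le> 2 * e"
        using assms(1)[of i s] assms(1)[of i "- s"] assms(2) by simp
    qed
    finally have "\<bar>\<Sum>i<d. (F (x(i := x i + s)) - c) + (F (x(i := x i - s)) - c)\<bar> / (2 * real d) \<le> (\<Sum>i<d. 2 * e) / (2 * real d)"
      by (rule divide_right_mono) simp
    then show ?thesis by (simp only: abs_divide abs_mult abs_of_nat abs_numeral)
  qed
  also have "\<dots> = e" using d by simp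
  finally show ?thesis .
qed

text \<open>The mean value theorem gives a time derivative at some \<open>\<xi>\<close> between
  \<open>t\<close> and \<open>t + h\<close>; uniform continuity on a box brings it back to
  \<open>t\<close>, without any rate.\<close>

lemma consistency:
  assumes "0 < \<rho>"
  shows "\<exists>h0>0. \<forall>h s t x. 0 < h \<longrightarrow> h < h0 \<longrightarrow> 0 < s \<longrightarrow> s\<^sup>2 = 2 * real d * h \<longrightarrow> 0 \<le> t \<longrightarrow> t + h \<le> T \<longrightarrow>
     (\<forall>j<d. \<bar>x j\<bar> \<le> R) \<longrightarrow> \<bar>u (t + h) x - avg_step d s (\<lambda>x. u t x + h * f (u t x)) x\<bar> \<le> h * \<rho>"
proof -
  \<comment> \<open>Error budget: \<open>d * e\<close> each for moving the Laplacian from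
    \<open>\<xi>\<close> to \<open>t\<close> and for the second differences,
    \<open>\<kappa> * e\<close> each for moving \<open>f\<close> in time and for averaging
    it.\<close>
  define e where "e = \<rho> / (2 * real d + 2 * \<kappa>)"
  have pos: "0 < 2 * real d + 2 * \<kappa>" using d \<kappa>_nonneg by (simp add: add_pos_nonneg)
  then have e: "0 < e" "e * (2 * real d + 2 * \<kappa>) = \<rho>" using assms by (auto simp: e_def)
  obtain \<delta> where \<delta>: "0 < \<delta>" "\<And>t t' x i s. t \<in> {0..T} \<Longrightarrow> t' \<in> {0..T} \<Longrightarrow> \<forall>j<d. \<bar>x j\<bar> \<le> R \<Longrightarrow> i < d \<Longrightarrow> \<bar>t' - t\<bar> < \<delta> \<Longrightarrow> \<bar>s\<bar> < \<delta> \<Longrightarrow>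
     \<bar>u t' (x(i := x i + s)) - u t x\<bar> \<le> e \<and> (\<forall>l<d. \<bar>P2 l t' (x(i := x i + s)) - P2 l t x\<bar> \<le> e)"
    using uniform_modulus[OF e(1), of R] by metis
  \<comment> \<open>The second bound forces \<open>s < \<delta>\<close>, since
    \<open>s\<^sup>2 = 2 * d * h\<close>.\<close>
  define h0 where "h0 = min \<delta> (\<delta>\<^sup>2 / (2 * real d))"
  have h0: "0 < h0" using \<delta>(1) d by (simp add: h0_def)
  have "\<bar>u (t + h) x - avg_step d s (\<lambda>x. u t x + h * f (u t x)) x\<bar> \<le> h * \<rho>"
    if h: "0 < h" "h < h0" and s: "0 < s" "s\<^sup>2 = 2 * real d * h" and t: "0 \<le> t" "t + h \<le> T" and x: "\<forall>j<d. \<bar>x j\<bar> \<le> R"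
    for h s t x
  proof -
    have h\<delta>: "h < \<delta>" using h by (simp add: h0_def)
    have "s\<^sup>2 < \<delta>\<^sup>2" unfolding s(2) using h d by (simp add: h0_def field_simps)
    then have s\<delta>: "s < \<delta>" using \<delta>(1) by (intro power_less_imp_less_base[of s 2 \<delta>]) auto
    have tT: "t \<in> {0..T}" using t h by auto
    have der: "((\<lambda>s. u s x) has_real_derivative (\<Sum>i<d. P2 i \<xi> x) + f (u \<xi> x)) (at \<xi>)" if "t < \<xi>" "\<xi> < t + h" for \<xi>
      using pde[of \<xi> x] t that by simp
    have "continuous_on {t..t + h} ((\<lambda>(t, x). u t x) \<circ> (\<lambda>s. (s, x)))"
      by (rule continuous_on_compose[OF _ continuous_on_subset[OF u_cont]]) (use t in \<open>auto intro!: continuous_intros\<close>)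
    then have "continuous_on {t..t + h} (\<lambda>s. u s x)" by (simp add: comp_def)
    from MVT[OF _ this] obtain l \<xi> where \<xi>: "t < \<xi>" "\<xi> < t + h" "DERIV (\<lambda>s. u s x) \<xi> :> l" "u (t + h) x - u t x = (t + h - t) * l"
      using der h(1) unfolding real_differentiable_def by force
    have "l = (\<Sum>i<d. P2 i \<xi> x) + f (u \<xi> x)" by (rule DERIV_unique[OF \<xi>(3) der[OF \<xi>(1,2)]])
    with \<xi> have \<xi>: "t < \<xi>" "\<xi> < t + h" "u (t + h) x - u t x = h * ((\<Sum>i<d. P2 i \<xi> x) + f (u \<xi> x))" by auto
    have near: "\<bar>u \<xi> x - u t x\<bar> \<le> e" "\<And>l. l < d \<Longrightarrow> \<bar>P2 l \<xi> x - P2 l t x\<bar> \<le> e"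
      using \<delta>(2)[OF tT, of \<xi> x 0 0] x \<xi> t h\<delta> d \<delta>(1) by auto
    have "\<bar>(\<Sum>i<d. P2 i \<xi> x) - (\<Sum>i<d. P2 i t x)\<bar> \<le> real d * e"
      unfolding sum_subtractf[symmetric]
      using order_trans[OF sum_abs sum_mono[of "{..<d}" "\<lambda>i. \<bar>P2 i \<xi> x - P2 i t x\<bar>" "\<lambda>_. e"]] near(2) by simp
    moreover have "\<bar>avg_step d s (u t) x - u t x - h * (\<Sum>i<d. P2 i t x)\<bar> \<le> h * (real d * e)"
      by (rule avg_step_second_order[OF tT s]) (use \<delta>(2)[OF tT tT x] s\<delta> \<delta>(1) in auto)
    moreover have "\<bar>avg_step d s (\<lambda>x. f (u t x)) x - f (u t x)\<bar> \<le> \<kappa> * e"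
    proof (rule avg_step_near)
      fix i y assume "i < d" "\<bar>y\<bar> \<le> s"
      then have "\<bar>u t (x(i := x i + y)) - u t x\<bar> \<le> e" using \<delta>(2)[OF tT tT x] s\<delta> \<delta>(1) by auto
      then show "\<bar>f (u t (x(i := x i + y))) - f (u t x)\<bar> \<le> \<kappa> * e"
        using lip order_trans mult_left_mono[OF _ \<kappa>_nonneg] by meson
    qed (use s in simp)
    moreover have "\<bar>f (u \<xi> x) - f (u t x)\<bar> \<le> \<kappa> * e"
      using lip[of "u \<xi> x" "u t x"] mult_left_mono[OF near(1) \<kappa>_nonneg] by linarith
    ultimately have "\<bar>((\<Sum>i<d. P2 i \<xi> x) - (\<Sum>i<d. P2 i t x)) + (f (u \<xi> x) - f (u t x)) - (avg_step d s (\<lambda>x. f (u t x)) x - f (u t x))\<bar> \<le> real d * e + \<kappa> * e + \<kappa> * e"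
      and b: "\<bar>avg_step d s (u t) x - u t x - h * (\<Sum>i<d. P2 i t x)\<bar> \<le> h * (real d * e)" by linarith+
    then have a: "\<bar>h * (((\<Sum>i<d. P2 i \<xi> x) - (\<Sum>i<d. P2 i t x)) + (f (u \<xi> x) - f (u t x)) - (avg_step d s (\<lambda>x. f (u t x)) x - f (u t x)))\<bar> \<le> h * (real d * e + \<kappa> * e + \<kappa> * e)"
      using h by (simp add: abs_mult)
    have "u (t + h) x - avg_step d s (\<lambda>x. u t x + h * f (u t x)) x =
      h * (((\<Sum>i<d. P2 i \<xi> x) - (\<Sum>i<d. P2 i t x)) + (f (u \<xi> x) - f (u t x)) - (avg_step d s (\<lambda>x. f (u t x)) x - f (u t x)))
      - (avg_step d s (u t) x - u t x - h * (\<Sum>i<d. P2 i t x))"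
      using \<xi>(3) shift_average_add[OF shift_average_avg_step[OF d], of s "u t" "\<lambda>x. h * f (u t x)" x]
        shift_average_cmult[OF shift_average_avg_step[OF d], of s h "\<lambda>x. f (u t x)" x]
      by (simp add: algebra_simps)
    also have "\<bar>\<dots>\<bar> \<le> h * (real d * e + \<kappa> * e + \<kappa> * e) + h * (real d * e)" using a b by linarith
    also have "\<dots> = h * (e * (2 * real d + 2 * \<kappa>))" by (simp add: algebra_simps)
    finally show ?thesis using e(2) by simp
  qed
  then show ?thesis using h0 by blast
qed

end

text \<open>One step of a discrete Gronwall estimate: \<open>a\<close> is the growth rate of the
  weight under averaging, \<open>b\<close> the Lipschitz constant, \<open>Z\<close> the source per
  unit of time.\<close>

lemma growth_step:
  fixes E Z a b h :: real
  assumes "0 \<le> E" "0 \<le> Z" "0 \<le> a" "0 \<le> b" "0 \<le> h"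
  shows "(1 + a * h) * ((1 + b * h) * ((E + real k * h * Z) * exp ((a + b) * (real k * h))) + h * Z)
     \<le> (E + real (Suc k) * h * Z) * exp ((a + b) * (real (Suc k) * h))"
proof -
  define y where "y = (a + b) * (real k * h)"
  define X where "X = E + real k * h * Z"
  have X: "0 \<le> X" and y: "0 \<le> y" using assms by (auto simp: X_def y_def)
  have ab: "(1 + a * h) * (1 + b * h) \<le> exp ((a + b) * h)"
  proof -
    have "(1 + a * h) * (1 + b * h) \<le> exp (a * h) * exp (b * h)"
      using assms by (intro mult_mono exp_ge_add_one_self) auto
    then show ?thesis by (simp add: distrib_right exp_add)
  qed
  have "(1 + a * h) * ((1 + b * h) * (X * exp y) + h * Z) =
      (1 + a * h) * (1 + b * h) * (X * exp y) + (1 + a * h) * 1 * (h * Z)" by (simp add: algebra_simps)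
  also have "\<dots> \<le> exp ((a + b) * h) * (X * exp y) + exp ((a + b) * h) * (h * Z * exp y)"
  proof (rule add_mono)
    show "(1 + a * h) * (1 + b * h) * (X * exp y) \<le> exp ((a + b) * h) * (X * exp y)"
      using ab X by (intro mult_right_mono) auto
    have "(1 + a * h) * 1 \<le> (1 + a * h) * (1 + b * h)" using assms by (intro mult_left_mono) auto
    with ab have 1: "(1 + a * h) * 1 \<le> exp ((a + b) * h)" by linarith
    have 2: "h * Z \<le> h * Z * exp y" using assms y mult_left_mono[of 1 "exp y" "h * Z"] by simp
    show "(1 + a * h) * 1 * (h * Z) \<le> exp ((a + b) * h) * (h * Z * exp y)"
      by (rule mult_mono[OF 1 2]) (use assms in auto)
  qed
  also have "\<dots> = (X + h * Z) * exp (y + (a + b) * h)" by (simp add: exp_add algebra_simps)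
  also have "\<dots> = (E + real (Suc k) * h * Z) * exp ((a + b) * (real (Suc k) * h))"
    by (simp add: X_def y_def algebra_simps)
  finally show ?thesis unfolding X_def y_def .
qed

text \<open>Relative to \<open>weight d 1\<close> the scheme obeys a Gronwall bound with rate
  \<open>4 + \<kappa>\<close>, where 4 is \<open>4 * a\<^sup>2\<close> at \<open>a = 1\<close>; the
  rate does not depend on \<open>d\<close>.\<close>

lemma scheme_bound:
  assumes ps: "picard_scheme (avg_step d s) I f g \<kappa> h T N"
    and d: "1 \<le> d" and s: "s\<^sup>2 = 2 * real d * h" "\<bar>s\<bar> \<le> 1" and gG: "\<And>x. \<bar>g x\<bar> \<le> G * weight d 1 x" and G: "0 \<le> G"
  shows "\<bar>picard_scheme.w (avg_step d s) f g h k x\<bar> \<le> (G + real k * h * \<bar>f 0\<bar>) * exp ((4 + \<kappa>) * (real k * h)) * weight d 1 x"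
proof -
  interpret picard_scheme "avg_step d s" I f g \<kappa> h T N by (rule ps)
  define E where "E k = (G + real k * h * \<bar>f 0\<bar>) * exp ((4 + \<kappa>) * (real k * h))" for k
  have wt1: "1 \<le> weight d 1 x" for x using weight_ge[of d 1 x] d by linarith
  have "\<bar>w k x\<bar> \<le> E k * weight d 1 x"
  proof (induction k arbitrary: x)
    case 0 then show ?case using gG by (simp add: E_def)
  next
    case (Suc k)
    define Z where "Z = (1 + \<kappa> * h) * E k + h * \<bar>f 0\<bar>"
    have E0: "0 \<le> E k" using G h by (simp add: E_def)
    have Z0: "0 \<le> Z" using E0 h \<kappa>_nonneg by (simp add: Z_def)
    have "\<bar>w k y + h * f (w k y)\<bar> \<le> Z * weight d 1 y" for y
    proof -
      have "\<bar>f (w k y)\<bar> \<le> \<bar>f 0\<bar> + \<kappa> * \<bar>w k y\<bar>" using lip[of "w k y" 0] by simp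
      then have "\<bar>h * f (w k y)\<bar> \<le> h * (\<bar>f 0\<bar> + \<kappa> * \<bar>w k y\<bar>)" using h by (simp add: abs_mult)
      then have "\<bar>w k y + h * f (w k y)\<bar> \<le> (1 + \<kappa> * h) * \<bar>w k y\<bar> + h * \<bar>f 0\<bar> * 1"
        by (simp add: algebra_simps)
      also have "\<dots> \<le> (1 + \<kappa> * h) * (E k * weight d 1 y) + h * \<bar>f 0\<bar> * weight d 1 y"
        using Suc[of y] wt1[of y] h \<kappa>_nonneg by (intro add_mono mult_left_mono) auto
      finally show ?thesis by (simp add: Z_def algebra_simps)
    qed
    then have "\<bar>w (Suc k) x\<bar> \<le> avg_step d s (\<lambda>y. Z * weight d 1 y) x"
      by (simp add: order_trans[OF shift_average_abs[OF Q] shift_average_mono[OF Q]])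
    also have "\<dots> = Z * avg_step d s (weight d 1) x" by (rule shift_average_cmult[OF Q])
    also have "\<dots> \<le> Z * ((1 + 4 * 1\<^sup>2 * h) * weight d 1 x)"
      by (rule mult_left_mono[OF avg_step_weight_le[OF d s(1)] Z0]) (use s in simp)
    also have "\<dots> = ((1 + 4 * h) * Z) * weight d 1 x" by simp
    also have "\<dots> \<le> E (Suc k) * weight d 1 x"
      unfolding Z_def E_def using growth_step[of G "\<bar>f 0\<bar>" 4 \<kappa> h k] G h \<kappa>_nonneg wt1[of x]
      by (intro mult_right_mono) auto
    finally show ?case .
  qed
  then show ?thesis unfolding E_def .
qed

text \<open>
  A discrete maximum principle with \<open>weight d 2\<close> as barrier: outside a large box the a priori growth
  bounds make the error small relative to the barrier, inside the box the scheme is consistent.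
\<close>

lemma (in heat_solution) scheme_error:
  assumes lip': "\<And>v w. \<bar>f' v - f' w\<bar> \<le> \<kappa> * \<bar>v - w\<bar>" and ff': "\<And>v. \<bar>f v - f' v\<bar> \<le> \<beta> * (1 + v\<^sup>2)" and \<beta>: "0 \<le> \<beta>"
    and g: "cont g" "\<And>x. \<bar>g x\<bar> \<le> G * weight d 1 x" "0 \<le> G"
    and u0: "\<And>x. \<bar>u 0 x - g x\<bar> \<le> E0 * weight d 2 x" "0 < E0"
    and growth: "\<And>t x. 0 < t \<Longrightarrow> t < T \<Longrightarrow> \<bar>u t x\<bar> \<le> C0 * weight d 1 x" "0 \<le> C0"
    and L: "(G + T * \<bar>f' 0\<bar>) * exp ((4 + \<kappa>) * T) \<le> L"
    and I: "pos_functional I"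
  shows "\<exists>N h s. picard_scheme (avg_step d s) I f' g \<kappa> h T N \<and> s\<^sup>2 = 2 * real d * h \<and> \<bar>s\<bar> \<le> 1 \<and> \<bar>2 * s\<bar> \<le> 1 \<and>
     (\<forall>x. (\<forall>j<d. \<bar>x j\<bar> \<le> 1) \<longrightarrow> \<bar>u T x - picard_scheme.w (avg_step d s) f' g h N x\<bar> \<le>
        (E0 + T * (\<beta> * (1 + L\<^sup>2) * real d + E0)) * exp ((16 + \<kappa>) * T) * weight d 2 x) \<and>
     (\<forall>k\<le>N. \<forall>x. \<bar>picard_scheme.w (avg_step d s) f' g h k x\<bar> \<le> L * weight d 1 x)"
proof -
  have "0 \<le> (G + T * \<bar>f' 0\<bar>) * exp ((4 + \<kappa>) * T)" using T g(3) by simp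
  with L have L0: "0 \<le> L" by linarith
  have d0: "0 < real d" using d by simp
  define B where "B = \<beta> * (1 + L\<^sup>2) * real d"
  have B: "0 \<le> B" using \<beta> by (simp add: B_def)
  \<comment> \<open>If some coordinate exceeds \<open>R\<close> in modulus, then
    \<open>weight d 1 x \<ge> R / 2\<close>, so \<open>(C0 + L) * weight d 1 x \<le> E0 * (weight d
    1 x)\<^sup>2 / d \<le> E0 * weight d 2 x\<close>. Thus \<open>C0\<close> affects only
    \<open>h0\<close>.\<close>
  define R where "R = max 1 (2 * real d * (C0 + L) / E0)"
  from consistency[OF u0(2), of R] obtain h0 where h0: "0 < h0" "\<forall>h s t x. 0 < h \<longrightarrow> h < h0 \<longrightarrow> 0 < s \<longrightarrow> s\<^sup>2 = 2 * real d * h \<longrightarrow> 0 \<le> t \<longrightarrow> t + h \<le> T \<longrightarrow>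
     (\<forall>j<d. \<bar>x j\<bar> \<le> R) \<longrightarrow> \<bar>u (t + h) x - avg_step d s (\<lambda>x. u t x + h * f (u t x)) x\<bar> \<le> h * E0"
    by (elim exE conjE)
  \<comment> \<open>Enough steps for \<open>h < h0\<close> and for \<open>8 * d * h \<le> 1\<close>,
    which amounts to \<open>\<bar>2 * s\<bar> \<le> 1\<close>.\<close>
  obtain N0 :: nat where N0: "max (T / h0) (8 * real d * T) < real N0" using reals_Archimedean2 by blast
  define N where "N = Suc N0"
  define h where "h = T / real N"
  define s where "s = sqrt (2 * real d * h)"
  have h: "0 < h" "h * real N = T" using T by (simp_all add: h_def N_def)
  have "T / h0 < real N" "8 * real d * T < real N" using N0 by (simp_all add: N_def)
  then have hh0: "h < h0" "8 * real d * h \<le> 1" using h0(1) by (simp_all add: h_def field_simps N_def)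
  have s: "0 < s" "s\<^sup>2 = 2 * real d * h" using h d by (simp_all add: s_def)
  have "(2 * s)\<^sup>2 \<le> 1\<^sup>2" unfolding power_mult_distrib s(2) using hh0 by simp
  then have s2: "\<bar>2 * s\<bar> \<le> 1" using abs_le_square_iff[of "2 * s" 1] by simp
  then have s1: "\<bar>s\<bar> \<le> 1" by simp
  have ps: "picard_scheme (avg_step d s) I f' g \<kappa> h T N"
    by unfold_locales (use shift_average_avg_step[OF d] I lip' g h in auto)
  interpret pic: picard_scheme "avg_step d s" I f' g \<kappa> h T N by (rule ps)
  have wt1: "1 \<le> weight d a x" for a x using weight_ge[of d a x] d by linarith
  have kT: "real k * h \<le> T" if "k \<le> N" for k
    using mult_right_mono[of "real k" "real N" h] that h by (simp add: mult.commute)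
  have wL: "\<bar>pic.w k x\<bar> \<le> L * weight d 1 x" if "k \<le> N" for k x
  proof -
    have "\<bar>pic.w k x\<bar> \<le> (G + real k * h * \<bar>f' 0\<bar>) * exp ((4 + \<kappa>) * (real k * h)) * weight d 1 x"
      by (rule scheme_bound[OF ps d s(2) s1 g(2,3)])
    also have "\<dots> \<le> (G + T * \<bar>f' 0\<bar>) * exp ((4 + \<kappa>) * T) * weight d 1 x"
      using kT[OF that] \<kappa>_nonneg g(3) wt1[of 1 x] h
      by (intro mult_right_mono mult_mono add_left_mono) (auto intro!: mult_left_mono mult_right_mono)
    also have "\<dots> \<le> L * weight d 1 x" using wt1[of 1 x] by (intro mult_right_mono[OF L]) auto
    finally show ?thesis .
  qed
  \<comment> \<open>The quadratic growth of the interpolation error calls for the larger weight,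
    through \<open>weight_1_square\<close>.\<close>
  have fw: "\<bar>f (pic.w k x) - f' (pic.w k x)\<bar> \<le> B * weight d 2 x" if "k \<le> N" for k x
  proof -
    have "(pic.w k x)\<^sup>2 \<le> (L * weight d 1 x)\<^sup>2" using wL[OF that, of x] by (simp add: abs_le_square_iff[symmetric])
    moreover have "1 \<le> (weight d 1 x)\<^sup>2" using wt1 by simp
    ultimately have "1 + (pic.w k x)\<^sup>2 \<le> (1 + L\<^sup>2) * (weight d 1 x)\<^sup>2" by (simp add: power_mult_distrib distrib_right)
    also have "\<dots> \<le> (1 + L\<^sup>2) * (real d * weight d 2 x)" by (intro mult_left_mono weight_1_square) auto
    finally have "\<beta> * (1 + (pic.w k x)\<^sup>2) \<le> B * weight d 2 x" using mult_left_mono[OF _ \<beta>] by (fastforce simp: B_def mult_ac)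
    then show ?thesis using ff'[of "pic.w k x"] by linarith
  qed
  define Z where "Z = B + E0"
  define E where "E k = (E0 + real k * h * Z) * exp ((16 + \<kappa>) * (real k * h))" for k
  have Z: "0 \<le> Z" using B u0 by (simp add: Z_def)
  have E0E: "E0 \<le> E k" for k
  proof -
    have "E0 * 1 \<le> (E0 + real k * h * Z) * exp ((16 + \<kappa>) * (real k * h))"
      using u0 Z h \<kappa>_nonneg by (intro mult_mono) auto
    then show ?thesis by (simp add: E_def)
  qed
  have step: "\<bar>u (real (Suc k) * h) x - pic.w (Suc k) x\<bar> \<le> E (Suc k) * weight d 2 x"
    if k: "k < N" and IH: "\<And>x. \<bar>u (real k * h) x - pic.w k x\<bar> \<le> E k * weight d 2 x" and x: "\<forall>j<d. \<bar>x j\<bar> \<le> R" for k x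
  proof -
    let ?t = "real k * h"
    have t: "0 \<le> ?t" "?t + h \<le> T" "?t + h = real (Suc k) * h" using h kT[of "Suc k"] k by (auto simp: distrib_right)
    define Y where "Y = (1 + \<kappa> * h) * E k + h * B"
    have Ek: "0 \<le> E k" using E0E[of k] u0 by linarith
    have Y0: "0 \<le> Y" using Ek B h \<kappa>_nonneg by (simp add: Y_def)
    have "\<bar>(u ?t y + h * f (u ?t y)) - (pic.w k y + h * f' (pic.w k y))\<bar> \<le> Y * weight d 2 y" for y
    proof -
      have "\<bar>f (u ?t y) - f' (pic.w k y)\<bar> \<le> \<kappa> * \<bar>u ?t y - pic.w k y\<bar> + B * weight d 2 y"
        using lip[of "u ?t y" "pic.w k y"] fw[of k y] k by linarith
      then have "\<bar>h * (f (u ?t y) - f' (pic.w k y))\<bar> \<le> h * (\<kappa> * \<bar>u ?t y - pic.w k y\<bar> + B * weight d 2 y)"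
        using h by (simp add: abs_mult)
      then have "\<bar>(u ?t y + h * f (u ?t y)) - (pic.w k y + h * f' (pic.w k y))\<bar> \<le> (1 + \<kappa> * h) * \<bar>u ?t y - pic.w k y\<bar> + h * B * weight d 2 y"
        by (simp add: algebra_simps)
      also have "\<dots> \<le> (1 + \<kappa> * h) * (E k * weight d 2 y) + h * B * weight d 2 y"
        using h \<kappa>_nonneg by (intro add_right_mono mult_left_mono IH) auto
      finally show ?thesis by (simp add: Y_def algebra_simps)
    qed
    then have "\<bar>avg_step d s (\<lambda>y. (u ?t y + h * f (u ?t y)) - (pic.w k y + h * f' (pic.w k y))) x\<bar> \<le> avg_step d s (\<lambda>y. Y * weight d 2 y) x"
      by (intro order_trans[OF shift_average_abs[OF pic.Q] shift_average_mono[OF pic.Q]])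
    also have "\<dots> = Y * avg_step d s (weight d 2) x" by (rule shift_average_cmult[OF pic.Q])
    also have "\<dots> \<le> Y * ((1 + 4 * 2\<^sup>2 * h) * weight d 2 x)"
      by (rule mult_left_mono[OF avg_step_weight_le[OF d s(2) s2] Y0])
    finally have a: "\<bar>avg_step d s (\<lambda>y. u ?t y + h * f (u ?t y)) x - pic.w (Suc k) x\<bar> \<le> (1 + 16 * h) * Y * weight d 2 x"
      unfolding shift_average_diff[OF pic.Q] by (simp add: mult_ac)
    have "\<bar>u (?t + h) x - avg_step d s (\<lambda>y. u ?t y + h * f (u ?t y)) x\<bar> \<le> h * E0"
      by (rule h0(2)[rule_format, OF h(1) hh0(1) s t(1,2)]) (use x in auto)
    also have "\<dots> \<le> (1 + 16 * h) * (h * E0) * weight d 2 x"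
    proof -
      have "h * E0 * 1 * 1 \<le> h * E0 * (1 + 16 * h) * weight d 2 x"
        using h u0 wt1[of 2 x] by (intro mult_mono) auto
      then show ?thesis by (simp add: mult_ac)
    qed
    finally have "\<bar>u (real (Suc k) * h) x - pic.w (Suc k) x\<bar> \<le> (1 + 16 * h) * Y * weight d 2 x + (1 + 16 * h) * (h * E0) * weight d 2 x"
      using a unfolding t(3) by linarith
    also have "\<dots> = ((1 + 16 * h) * ((1 + \<kappa> * h) * E k + h * Z)) * weight d 2 x"
      by (simp add: Y_def Z_def algebra_simps)
    also have "\<dots> \<le> E (Suc k) * weight d 2 x"
      unfolding E_def using growth_step[of E0 Z 16 \<kappa> h k] u0 Z h \<kappa>_nonneg wt1[of 2 x]
      by (intro mult_right_mono) auto
    finally show ?thesis .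
  qed
  \<comment> \<open>Only for \<open>k < N\<close>, as the growth bound is available only before time
    \<open>T\<close>. The last step is needed only on the cube, which lies in the box where
    \<open>step\<close> applies.\<close>
  have all: "\<bar>u (real k * h) x - pic.w k x\<bar> \<le> E k * weight d 2 x" if "k < N" for k x
    using that
  proof (induction k arbitrary: x)
    case 0
    then show ?case using u0(1)[of x] by (simp add: E_def)
  next
    case (Suc k)
    show ?case
    proof (cases "\<forall>j<d. \<bar>x j\<bar> \<le> R")
      case True
      then show ?thesis using step[of k x] Suc by simp
    next
      case False
      then obtain j where j: "j < d" "R < \<bar>x j\<bar>" by force
      have "0 < real (Suc k) * h" using h by simp
      moreover have "real (Suc k) * h < T"
        using mult_strict_right_mono[of "real (Suc k)" "real N" h] Suc.prems h by (simp add: mult.commute)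
      ultimately have "\<bar>u (real (Suc k) * h) x\<bar> \<le> C0 * weight d 1 x" by (rule growth(1))
      then have "\<bar>u (real (Suc k) * h) x - pic.w (Suc k) x\<bar> \<le> (C0 + L) * weight d 1 x"
        using wL[of "Suc k" x] Suc.prems by (simp add: distrib_right)
      also have "\<dots> \<le> E0 * weight d 2 x"
      proof -
        have "R \<le> exp \<bar>x j\<bar>" using j(2) exp_ge_add_one_self[of "\<bar>x j\<bar>"] by linarith
        also have "\<dots> \<le> 2 * cosh (1 * x j)" using cosh_ge_exp[of "x j"] by simp
        also have "\<dots> \<le> 2 * weight d 1 x" unfolding weight_def
          using member_le_sum[of j "{..<d}" "\<lambda>i. cosh (1 * x i)"] j(1) by simp
        finally have RW: "R \<le> 2 * weight d 1 x" .
        have "2 * real d * (C0 + L) \<le> E0 * R" using u0(2) by (simp add: R_def max_def field_simps)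
        also have "\<dots> \<le> E0 * (2 * weight d 1 x)" using RW u0(2) by (intro mult_left_mono) auto
        finally have "real d * (C0 + L) * weight d 1 x \<le> E0 * weight d 1 x * weight d 1 x"
          using wt1[of 1 x] by (intro mult_right_mono) auto
        also have "\<dots> \<le> E0 * (real d * weight d 2 x)"
          using weight_1_square[of d x] u0(2) by (simp add: power2_eq_square mult.assoc)
        finally have "real d * ((C0 + L) * weight d 1 x) \<le> real d * (E0 * weight d 2 x)" by (simp add: mult_ac)
        then show ?thesis using d0 by simp
      qed
      also have "\<dots> \<le> E (Suc k) * weight d 2 x"
        using E0E[of "Suc k"] wt1[of 2 x] by (intro mult_right_mono) auto
      finally show ?thesis .
    qed
  qed
  have final: "\<bar>u T x - pic.w N x\<bar> \<le> (E0 + T * (B + E0)) * exp ((16 + \<kappa>) * T) * weight d 2 x" if "\<forall>j<d. \<bar>x j\<bar> \<le> 1" for x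
  proof -
    have "\<forall>j<d. \<bar>x j\<bar> \<le> R" using that by (fastforce simp: R_def)
    from step[of N0 x, OF _ all this] have "\<bar>u (real N * h) x - pic.w N x\<bar> \<le> E N * weight d 2 x"
      by (simp add: N_def)
    moreover have "real N * h = T" using h(2) by (simp add: mult.commute)
    ultimately show ?thesis by (simp add: E_def Z_def)
  qed
  show ?thesis
    using ps s(2) s1 s2 final wL unfolding B_def by blast
qed

section \<open>Choice of the number of levels and polynomial bounds\<close>

text \<open>
  Here \<open>q\<close> stands for the inverse squared accuracy and \<open>(3 n)^n\<close> for the growth of the network
  width; for the least admissible \<open>n\<close>, failure at \<open>n - 1\<close> bounds the width.
\<close>

lemma level_choice:
  fixes D :: real assumes D: "1 \<le> D"
  shows "\<exists>C\<ge>1. \<forall>q\<ge>1. \<exists>n\<ge>1. q * D ^ n \<le> real n ^ n \<and> (3 * real n) ^ n \<le> C * q\<^sup>2"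
proof -
  \<comment> \<open>In the final estimate \<open>3 * n \<le> 6 * m\<close> and
    \<open>m \<le> 2 ^ m\<close> produce the power \<open>(6 * 2 * D) ^ m\<close>.\<close>
  define E where "E = 12 * D"
  have E: "1 \<le> E" "D \<le> E" using D by (auto simp: E_def)
  \<comment> \<open>\<open>E\<^sup>2 \<le> b\<close> gives
    \<open>E ^ (2 * m) \<le> C1 * m ^ m\<close>; failure at \<open>m\<close> bounds
    \<open>m ^ m\<close> by \<open>q * D ^ m\<close>, and \<open>E ^ m \<le> C1 * q\<close>
    follows.\<close>
  define b where "b = nat \<lceil>E\<^sup>2\<rceil>"
  have b1: "E\<^sup>2 \<le> real b" unfolding b_def by (rule real_nat_ceiling_ge)
  have "1 \<le> E\<^sup>2" using E by simp
  with b1 have b: "E\<^sup>2 \<le> real b" "1 \<le> b" by linarith+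
  define C1 where "C1 = real b ^ b"
  have C1: "1 \<le> C1" using b by (simp add: C1_def)
  have bm: "real b ^ m \<le> C1 * real m ^ m" if "1 \<le> m" for m
  proof (cases "b \<le> m")
    case True
    then have "real b ^ m \<le> 1 * real m ^ m" by (simp add: power_mono)
    also have "\<dots> \<le> C1 * real m ^ m" using C1 by (intro mult_right_mono) auto
    finally show ?thesis .
  next
    case False
    then have "real b ^ m \<le> C1 * 1" unfolding C1_def using b by (simp add: power_increasing)
    also have "\<dots> \<le> C1 * real m ^ m" using C1 that by (intro mult_left_mono) auto
    finally show ?thesis .
  qed
  have "\<exists>n\<ge>1. q * D ^ n \<le> real n ^ n \<and> (3 * real n) ^ n \<le> (6 * C1 + 3) * q\<^sup>2" if q: "1 \<le> q" for q
  proof -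
    define P where "P n \<longleftrightarrow> 1 \<le> n \<and> q * D ^ n \<le> real n ^ n" for n :: nat
    \<comment> \<open>An admissible number of levels exists, since any \<open>k \<ge> q * D\<close>
      works; so there is a least one.\<close>
    define k where "k = nat \<lceil>q * D\<rceil>"
    have "1 * 1 \<le> q * D" using q D by (intro mult_mono) auto
    moreover have "q * D \<le> real k" unfolding k_def by (rule real_nat_ceiling_ge)
    ultimately have k: "q * D \<le> real k" "1 \<le> k" by linarith+
    have "q * D ^ k \<le> q ^ k * D ^ k" using q D k by (intro mult_right_mono self_le_power) auto
    also have "\<dots> \<le> real k ^ k" using k q D by (simp add: power_mono flip: power_mult_distrib)
    finally have "P k" using k by (simp add: P_def)
    define n where "n = (LEAST n. P n)"
    have n: "P n" unfolding n_def by (rule LeastI[of P, OF \<open>P k\<close>])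
    have q2: "1 \<le> q\<^sup>2" "q \<le> q\<^sup>2" using q self_le_power[of q 2] by auto
    have "(3 * real n) ^ n \<le> (6 * C1 + 3) * q\<^sup>2"
    proof (cases "n = 1")
      case True
      have "(6 * C1 + 3) * 1 \<le> (6 * C1 + 3) * q\<^sup>2" using C1 q2 by (intro mult_left_mono) auto
      moreover have "3 \<le> (6 * C1 + 3) * 1" using C1 by simp
      ultimately have "3 \<le> (6 * C1 + 3) * q\<^sup>2" by (rule order_trans[rotated])
      then show ?thesis using True by simp
    next
      case False
      define m where "m = n - 1"
      have m: "1 \<le> m" "n = Suc m" using False n by (auto simp: m_def P_def)
      have "\<not> P m" using not_less_Least[of m P] m(2) by (simp add: n_def)
      then have lt: "real m ^ m \<le> q * D ^ m" using m by (simp add: P_def)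
      have "(E ^ m) * (E ^ m) = (E\<^sup>2) ^ m" by (simp add: power2_eq_square power_mult_distrib)
      also have "\<dots> \<le> real b ^ m" using b E by (intro power_mono) auto
      also have "\<dots> \<le> C1 * (q * D ^ m)" using bm[OF m(1)] mult_left_mono[OF lt, of C1] C1 by linarith
      also have "\<dots> \<le> C1 * (q * E ^ m)" using C1 q E D by (intro mult_left_mono power_mono) auto
      finally have "(E ^ m) * (E ^ m) \<le> (C1 * q) * E ^ m" by (simp add: mult_ac)
      then have Em: "E ^ m \<le> C1 * q" using E by (simp add: mult_le_cancel_right)
      have "(3 * real n) ^ n \<le> (6 * real m) ^ n" using m by (intro power_mono) auto
      also have "\<dots> = 6 * real m * 6 ^ m * real m ^ m" by (simp add: m(2) power_mult_distrib)
      also have "\<dots> \<le> 6 * 2 ^ m * 6 ^ m * (q * D ^ m)"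
        using lt less_imp_le[OF of_nat_less_two_power[of m, where 'a = real]] q D
        by (intro mult_mono) auto
      also have "\<dots> = 6 * q * ((2 * 6 * D) ^ m)" by (simp only: power_mult_distrib mult_ac)
      also have "\<dots> = 6 * q * E ^ m" by (simp add: E_def)
      also have "\<dots> \<le> 6 * q * (C1 * q)" using Em q by (intro mult_left_mono) auto
      also have "\<dots> \<le> (6 * C1 + 3) * q\<^sup>2" using q2 by (simp add: power2_eq_square algebra_simps)
      finally show ?thesis .
    qed
    then show ?thesis using n unfolding P_def by blast
  qed
  moreover have "1 \<le> 6 * C1 + 3" using C1 by simp
  ultimately show ?thesis by blast
qed

section \<open>Approximation for one dimension and one accuracy\<close>

lemma avg_step_funpow_weight:
  assumes "1 \<le> d" "s\<^sup>2 = 2 * real d * h" "\<bar>a * s\<bar> \<le> 1" "0 \<le> h"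
  shows "(avg_step d s ^^ m) (weight d a) x \<le> exp (4 * a\<^sup>2 * (real m * h)) * weight d a x"
proof (induction m arbitrary: x)
  case (Suc m)
  note Q = shift_average_avg_step[OF assms(1)]
  have "avg_step d s ((avg_step d s ^^ m) (weight d a)) x \<le> avg_step d s (\<lambda>x. exp (4 * a\<^sup>2 * (real m * h)) * weight d a x) x"
    by (rule shift_average_mono[OF Q Suc])
  also have "\<dots> = exp (4 * a\<^sup>2 * (real m * h)) * avg_step d s (weight d a) x" by (rule shift_average_cmult[OF Q])
  also have "\<dots> \<le> exp (4 * a\<^sup>2 * (real m * h)) * ((1 + 4 * a\<^sup>2 * h) * weight d a x)"
    by (rule mult_left_mono[OF avg_step_weight_le]) (use assms in auto)
  also have "\<dots> \<le> exp (4 * a\<^sup>2 * (real m * h)) * (exp (4 * a\<^sup>2 * h) * weight d a x)"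
    using weight_ge[of d a x] by (intro mult_left_mono mult_right_mono exp_ge_add_one_self) auto
  also have "\<dots> = exp (4 * a\<^sup>2 * (real (Suc m) * h)) * weight d a x" by (simp add: exp_add algebra_simps)
  finally show ?case by simp
qed simp

lemma scalar_realization_restrict:
  assumes "in_dim \<Phi> = d" "\<Phi> \<noteq> []"
  shows "realization \<Phi> (restrict x {..<d}) = realization \<Phi> x"
proof -
  obtain l ls where \<Phi>: "\<Phi> = l # ls" using assms(2) by (cases \<Phi>) auto
  have "affine_layer l (restrict x {..<d}) = affine_layer l x"
    using assms(1) unfolding \<Phi> affine_layer_def in_dim_def by (auto simp: case_prod_beta fun_eq_iff intro!: sum.cong)
  then show ?thesis unfolding \<Phi> by (cases ls) auto
qed

lemma networks_not_Nil: "\<Phi> \<in> networks \<Longrightarrow> \<Phi> \<noteq> []"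
  unfolding networks_def by auto

text \<open>\<open>\<delta>\<close> is the accuracy of both the network for the initial value and
  the interpolant of \<open>f\<close>. Through \<open>\<Theta>\<close> it makes the scheme error at
  most \<open>\<epsilon> / 2\<close>; the levels contribute another \<open>\<epsilon> / 2\<close>.
  All constants are explicit, so that only their polynomial growth remains to be discussed.\<close>

lemma (in heat_solution) network_approximation:
  assumes \<epsilon>: "0 < \<epsilon>" and \<delta>: "0 < \<delta>" "\<delta> \<le> 1"
    and \<Phi>: "\<Phi> \<in> networks" "realization_in_C d 1 \<Phi>"
    and G: "\<And>x. \<bar>scalar_realization \<Phi> x\<bar> \<le> G * weight d 1 x" "0 < G"
    and u0: "\<And>x. \<bar>u 0 x - scalar_realization \<Phi> x\<bar> \<le> \<delta> * G * weight d 2 x"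
    and growth: "\<And>t x. 0 < t \<Longrightarrow> t < T \<Longrightarrow> \<bar>u t x\<bar> \<le> C0 * weight d 1 x" "0 \<le> C0"
    and L: "(G + T * (\<bar>f 0\<bar> + 2 * \<kappa>)) * exp ((4 + \<kappa>) * T) \<le> L" "G \<le> L"
    and \<Theta>: "\<delta> * ((G + T * (2 * \<kappa> * (1 + L\<^sup>2) * real d + G)) * exp ((16 + \<kappa>) * T) * (real d * cosh 2)) \<le> \<epsilon> / 2"
    and C: "\<And>q. 1 \<le> q \<Longrightarrow> \<exists>n\<ge>1. q * ((6 + 32 * T * \<kappa>\<^sup>2) * exp T) ^ n \<le> real n ^ n \<and> (3 * real n) ^ n \<le> C * q\<^sup>2"
    and X: "X = C * (4 * (L\<^sup>2 * real d * (exp (16 * T) * (real d * cosh 2))) / \<epsilon>\<^sup>2 + 1)\<^sup>2"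
    and V: "real (num_params \<Phi>) + 8 / \<delta>\<^sup>2 + 2 \<le> V"
  shows "\<exists>\<Psi>\<in>networks. realization_in_C d 1 \<Psi> \<and> real (num_params \<Psi>) \<le> (V + X + 1) * (V * X * (V * X + real d + 1)) \<and>
     cube_integral d (\<lambda>x. \<bar>u T x - scalar_realization \<Psi> x\<bar>\<^sup>2) \<le> \<epsilon>\<^sup>2"
proof -
  obtain f' m where f': "relu_sum m f'" "real m \<le> 8 / \<delta>\<^sup>2" "\<And>v w. \<bar>f' v - f' w\<bar> \<le> \<kappa> * \<bar>v - w\<bar>"
    "\<And>v. \<bar>f' v - f v\<bar> \<le> 2 * \<kappa> * \<delta> * (1 + v\<^sup>2)"
    using relu_interpolation[of f \<kappa> \<delta>] lip \<delta> by blast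
  define g where "g = scalar_realization \<Phi>"
  obtain H where H: "H \<le> num_params \<Phi>" "1 \<le> H" "g \<in> nn d (num_params \<Phi>) H"
    using network_nn[OF \<Phi>] unfolding g_def by blast
  have gc: "cont g" by (rule nn_continuous[OF H(3)])
  have f0: "\<bar>f' 0\<bar> \<le> \<bar>f 0\<bar> + 2 * \<kappa>"
  proof -
    have "2 * \<kappa> * \<delta> \<le> 2 * \<kappa> * 1" using \<kappa>_nonneg \<delta> by (intro mult_left_mono) auto
    then show ?thesis using f'(4)[of 0] by simp
  qed
  have L1: "(G + T * \<bar>f' 0\<bar>) * exp ((4 + \<kappa>) * T) \<le> L"
  proof -
    have "(G + T * \<bar>f' 0\<bar>) * exp ((4 + \<kappa>) * T) \<le> (G + T * (\<bar>f 0\<bar> + 2 * \<kappa>)) * exp ((4 + \<kappa>) * T)"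
      using T f0 by (intro mult_right_mono add_left_mono mult_left_mono) auto
    then show ?thesis using L by linarith
  qed
  have \<delta>G: "0 < \<delta> * G" using \<delta> G by simp
  have ff': "\<bar>f v - f' v\<bar> \<le> 2 * \<kappa> * \<delta> * (1 + v\<^sup>2)" for v using f'(4)[of v] by (simp add: abs_minus_commute)
  have \<beta>: "0 \<le> 2 * \<kappa> * \<delta>" using \<kappa>_nonneg \<delta> by simp
  have "\<exists>N h s. picard_scheme (avg_step d s) (cube_integral d) f' g \<kappa> h T N \<and> s\<^sup>2 = 2 * real d * h \<and> \<bar>s\<bar> \<le> 1 \<and> \<bar>2 * s\<bar> \<le> 1 \<and>
     (\<forall>x. (\<forall>j<d. \<bar>x j\<bar> \<le> 1) \<longrightarrow> \<bar>u T x - picard_scheme.w (avg_step d s) f' g h N x\<bar> \<le>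
        (\<delta> * G + T * (2 * \<kappa> * \<delta> * (1 + L\<^sup>2) * real d + \<delta> * G)) * exp ((16 + \<kappa>) * T) * weight d 2 x) \<and>
     (\<forall>k\<le>N. \<forall>x. \<bar>picard_scheme.w (avg_step d s) f' g h k x\<bar> \<le> L * weight d 1 x)"
    by (rule scheme_error[OF f'(3) ff' \<beta> gc _ _ _ \<delta>G growth L1 pos_functional_cube])
       (use G u0 in \<open>auto simp: g_def\<close>)
  then obtain N h s where ps: "picard_scheme (avg_step d s) (cube_integral d) f' g \<kappa> h T N"
    and s: "s\<^sup>2 = 2 * real d * h" "\<bar>2 * s\<bar> \<le> 1"
    and uw: "\<And>x. (\<And>j. j < d \<Longrightarrow> \<bar>x j\<bar> \<le> 1) \<Longrightarrow> \<bar>u T x - picard_scheme.w (avg_step d s) f' g h N x\<bar> \<le>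
        (\<delta> * G + T * (2 * \<kappa> * \<delta> * (1 + L\<^sup>2) * real d + \<delta> * G)) * exp ((16 + \<kappa>) * T) * weight d 2 x"
    and wL: "\<And>k x. k \<le> N \<Longrightarrow> \<bar>picard_scheme.w (avg_step d s) f' g h k x\<bar> \<le> L * weight d 1 x"
    by (elim exE conjE) blast
  interpret pic: picard_scheme "avg_step d s" "cube_integral d" f' g \<kappa> h T N by (rule ps)
  \<comment> \<open>Bounds all second moments: the square of a function below
    \<open>L * weight d 1\<close> costs \<open>L\<^sup>2 * d\<close>, the walk multiplies
    \<open>weight d 2\<close> by at most \<open>exp (16 * T)\<close>, and on the cube that weight is
    at most \<open>d * cosh 2\<close>.\<close>
  define A where "A = L\<^sup>2 * real d * (exp (16 * T) * (real d * cosh 2))"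
  have A0: "0 \<le> A" by (simp add: A_def)
  have JA: "pic.J k (\<lambda>x. (F x)\<^sup>2) \<le> A" if F: "cont F" "\<And>x. \<bar>F x\<bar> \<le> L * weight d 1 x" for F k
  proof -
    have L0: "0 \<le> L" using G L by linarith
    have "(F x)\<^sup>2 \<le> L\<^sup>2 * real d * weight d 2 x" for x
    proof -
      have "(F x)\<^sup>2 \<le> (L * weight d 1 x)\<^sup>2" using F(2)[of x] by (simp add: abs_le_square_iff[symmetric])
      also have "\<dots> \<le> L\<^sup>2 * (real d * weight d 2 x)"
        unfolding power_mult_distrib by (intro mult_left_mono weight_1_square) auto
      finally show ?thesis by simp
    qed
    then have "pic.J k (\<lambda>x. (F x)\<^sup>2) \<le> pic.J k (\<lambda>x. L\<^sup>2 * real d * weight d 2 x)"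
      using F(1) by (intro pos_functional_mono[OF pic.J]) (auto intro!: continuous_intros cont_weight)
    also have "\<dots> = L\<^sup>2 * real d * pic.J k (weight d 2)" by (rule pos_functional_cmult[OF pic.J cont_weight])
    also have "\<dots> \<le> L\<^sup>2 * real d * (exp (16 * T) * (real d * cosh 2))"
    proof (rule mult_left_mono)
      show "pic.J k (weight d 2) \<le> exp (16 * T) * (real d * cosh 2)"
        unfolding pic.J_def
      proof (rule cube_integral_le[OF pic.cont_Qpow[OF cont_weight]])
        fix x assume x: "x \<in> unit_cube d"
        have "real (N - k) * h \<le> real N * h" using pic.h by (intro mult_right_mono) auto
        then have kh: "real (N - k) * h \<le> T" using pic.hN by (simp add: mult.commute)
        have "(avg_step d s ^^ (N - k)) (weight d 2) x \<le> exp (4 * 2\<^sup>2 * (real (N - k) * h)) * weight d 2 x"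
          by (rule avg_step_funpow_weight[OF d s]) (use pic.h in simp)
        also have "\<dots> \<le> exp (16 * T) * (real d * cosh 2)"
          using kh weight_cube[OF x, of 2] weight_ge[of d 2 x] by (intro mult_mono) auto
        finally show "(avg_step d s ^^ (N - k)) (weight d 2) x \<le> exp (16 * T) * (real d * cosh 2)" .
      qed
    qed simp
    finally show ?thesis by (simp add: A_def)
  qed
  \<comment> \<open>Chosen so that \<open>A \<le> q * \<epsilon>\<^sup>2 / 4\<close>; the summand 1
    secures \<open>1 \<le> q\<close>.\<close>
  define q where "q = 4 * A / \<epsilon>\<^sup>2 + 1"
  have q: "1 \<le> q" using A0 by (simp add: q_def)
  define D where "D = 6 + 32 * T * \<kappa>\<^sup>2"
  \<comment> \<open>With base equal to the number of levels, \<open>exp (n * T) = exp T ^ n\<close>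
    is absorbed into the power of \<open>D * exp T\<close>.\<close>
  obtain n where n: "1 \<le> n" "q * (D * exp T) ^ n \<le> real n ^ n" "(3 * real n) ^ n \<le> C * q\<^sup>2"
    using C[OF q] unfolding D_def by blast
  have Xq: "X = C * q\<^sup>2" by (simp add: X q_def A_def)
  define Vn where "Vn = num_params \<Phi> + m + 2"
  have Vn: "real Vn \<le> V" "2 \<le> Vn" "m \<le> Vn" "1 \<le> Vn" using f'(2) V by (auto simp: Vn_def)
  have gVn: "g \<in> nn d Vn H" by (rule nn_mono[OF H(3)]) (simp add: Vn_def)
  have gL: "\<bar>g x\<bar> \<le> L * weight d 1 x" for x
    using G(1)[of x] mult_right_mono[OF L(2), of "weight d 1 x"] weight_ge[of d 1 x] unfolding g_def by linarith
  obtain F where F: "F \<in> nn d (Vn * (3 * n) ^ n) (H + n)"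
    "cube_integral d (\<lambda>x. (F x - pic.w N x)\<^sup>2) \<le> A * (D / real n) ^ n * exp (real n * T)"
    using pic.multilevel_picard[OF n(1) Vn(2,3) gVn f'(1) JA[OF gc gL] JA[OF pic.cont_w wL] order.refl, of n]
    unfolding D_def by blast
  have Fc: "cont F" by (rule nn_continuous[OF F(1)])
  have Ferr: "cube_integral d (\<lambda>x. (F x - pic.w N x)\<^sup>2) \<le> \<epsilon>\<^sup>2 / 4"
  proof -
    have n0: "0 < real n ^ n" using n(1) by simp
    have "A * (D / real n) ^ n * exp (real n * T) = A * (D * exp T) ^ n / real n ^ n"
      by (simp add: power_divide power_mult_distrib exp_of_nat_mult)
    also have "\<dots> \<le> \<epsilon>\<^sup>2 / 4"
    proof -
      have D0: "0 \<le> D * exp T" using T by (simp add: D_def)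
      have "A \<le> \<epsilon>\<^sup>2 / 4 * q" using \<epsilon> by (simp add: q_def field_simps)
      then have "A * (D * exp T) ^ n \<le> \<epsilon>\<^sup>2 / 4 * q * (D * exp T) ^ n" using D0 by (intro mult_right_mono) auto
      also have "\<dots> \<le> \<epsilon>\<^sup>2 / 4 * real n ^ n" unfolding mult.assoc by (intro mult_left_mono n(2)) auto
      finally show ?thesis using n0 by (simp add: divide_le_eq)
    qed
    finally show ?thesis using F(2) by linarith
  qed
  have "continuous_on UNIV ((\<lambda>(t, x). u t x) \<circ> (\<lambda>x. (T, x)))"
    by (rule continuous_on_compose[OF _ continuous_on_subset[OF u_cont]]) (use T in \<open>auto intro!: continuous_intros\<close>)
  then have uc: "cont (u T)" by (simp add: comp_def)
  have uerr: "cube_integral d (\<lambda>x. (u T x - pic.w N x)\<^sup>2) \<le> (\<epsilon> / 2)\<^sup>2"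
  proof (rule cube_integral_le)
    fix x assume x: "x \<in> unit_cube d"
    have "\<bar>x j\<bar> \<le> 1" if "j < d" for j using x that by (auto simp: PiE_iff)
    then have "\<bar>u T x - pic.w N x\<bar> \<le>
        (\<delta> * G + T * (2 * \<kappa> * \<delta> * (1 + L\<^sup>2) * real d + \<delta> * G)) * exp ((16 + \<kappa>) * T) * weight d 2 x" by (rule uw)
    also have "\<dots> \<le> (\<delta> * G + T * (2 * \<kappa> * \<delta> * (1 + L\<^sup>2) * real d + \<delta> * G)) * exp ((16 + \<kappa>) * T) * (real d * cosh 2)"
      using weight_cube[OF x, of 2] T \<delta> G(2) \<kappa>_nonneg by (intro mult_left_mono mult_nonneg_nonneg add_nonneg_nonneg) auto
    also have "\<dots> = \<delta> * ((G + T * (2 * \<kappa> * (1 + L\<^sup>2) * real d + G)) * exp ((16 + \<kappa>) * T) * (real d * cosh 2))"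
      by (simp add: algebra_simps)
    finally have "\<bar>u T x - pic.w N x\<bar> \<le> \<epsilon> / 2" using \<Theta> by linarith
    then show "(u T x - pic.w N x)\<^sup>2 \<le> (\<epsilon> / 2)\<^sup>2" using \<epsilon> abs_le_square_iff[of "u T x - pic.w N x" "\<epsilon> / 2"] by simp
  qed (intro continuous_intros uc pic.cont_w)
  have int: "cube_integral d (\<lambda>x. \<bar>u T x - F x\<bar>\<^sup>2) \<le> \<epsilon>\<^sup>2"
  proof -
    have "cube_integral d (\<lambda>x. \<bar>u T x - F x\<bar>\<^sup>2) \<le> cube_integral d (\<lambda>x. 2 * (u T x - pic.w N x)\<^sup>2 + 2 * (F x - pic.w N x)\<^sup>2)"
    proof (rule pos_functional_mono[OF pos_functional_cube])
      show "\<bar>u T x - F x\<bar>\<^sup>2 \<le> 2 * (u T x - pic.w N x)\<^sup>2 + 2 * (F x - pic.w N x)\<^sup>2" for x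
        using zero_le_power2[of "u T x + F x - 2 * pic.w N x"] by (simp add: power2_eq_square algebra_simps)
    qed (intro continuous_intros uc Fc pic.cont_w)+
    also have "\<dots> = 2 * cube_integral d (\<lambda>x. (u T x - pic.w N x)\<^sup>2) + 2 * cube_integral d (\<lambda>x. (F x - pic.w N x)\<^sup>2)"
      by (rule pos_functional_lin[OF pos_functional_cube]) (intro continuous_intros uc Fc pic.cont_w)+
    also have "\<dots> \<le> 2 * (\<epsilon> / 2)\<^sup>2 + 2 * (\<epsilon>\<^sup>2 / 4)" using uerr Ferr by linarith
    also have "\<dots> = \<epsilon>\<^sup>2" by (simp add: power_divide)
    finally show ?thesis .
  qed
  define W where "W = Vn * (3 * n) ^ n"
  have "1 \<le> (3 * n) ^ n" using n(1) by (intro one_le_power) simp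
  then have W1: "1 \<le> W" using Vn(4) by (simp add: W_def)
  have H1: "1 \<le> H + n" using n(1) by simp
  obtain \<Psi> where \<Psi>: "\<Psi> \<in> networks" "realization_in_C d 1 \<Psi>" "\<And>x. scalar_realization \<Psi> x = F x"
    "num_params \<Psi> \<le> (H + n + 1) * (W * (W + d + 1))"
    using nn_network[OF F(1)[folded W_def] d W1 H1] by blast
  have "real (num_params \<Psi>) \<le> real ((H + n + 1) * (W * (W + d + 1)))" using \<Psi>(4) by (rule of_nat_mono)
  also have "\<dots> = (real H + real n + 1) * (real W * (real W + real d + 1))"
    by (simp only: of_nat_mult of_nat_add of_nat_1)
  also have "\<dots> \<le> (V + X + 1) * (V * X * (V * X + real d + 1))"
  proof -
    have "real ((3 * n) ^ n) \<le> X" using n(3) by (simp add: Xq)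
    \<comment> \<open>By this \<open>X\<close> bounds not only the width factor but also the added
      depth.\<close>
    moreover have "real n \<le> real ((3 * n) ^ n)"
    proof -
      have "3 * n \<le> (3 * n) ^ n" using n(1) by (intro self_le_power) auto
      then have "n \<le> (3 * n) ^ n" by linarith
      then show ?thesis by (rule of_nat_mono)
    qed
    ultimately have nX: "real n \<le> X" "real ((3 * n) ^ n) \<le> X" by linarith+
    have "real W = real Vn * real ((3 * n) ^ n)" by (simp add: W_def)
    also have "\<dots> \<le> V * X" using Vn nX by (intro mult_mono) auto
    finally have WX: "real W \<le> V * X" .
    have HV: "real H \<le> V" using H(1) Vn(1) by (simp add: Vn_def)
    show ?thesis using nX(1) WX HV by (intro mult_mono add_mono mult_nonneg_nonneg add_nonneg_nonneg) auto
  qed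
  finally show ?thesis using \<Psi> int by (intro bexI[of _ \<Psi>]) auto
qed

text \<open>The single quantity \<open>d / \<epsilon>\<close> is at least 1, so exponents may be
  enlarged freely. The modulus makes the notion stable under products and real powers, so it can be
  checked along the syntax of an explicit bound.\<close>

definition poly_bounded :: "(nat \<Rightarrow> real \<Rightarrow> real) \<Rightarrow> bool" where
  "poly_bounded X \<longleftrightarrow> (\<exists>C p. 0 \<le> p \<and> (\<forall>d\<ge>1. \<forall>\<epsilon>\<in>{0<..1}. \<bar>X d \<epsilon>\<bar> \<le> C * (real d / \<epsilon>) powr p))"

lemma poly_boundedI:
  assumes "0 \<le> p" "\<And>d \<epsilon>. 1 \<le> d \<Longrightarrow> \<epsilon> \<in> {0<..1} \<Longrightarrow> \<bar>X d \<epsilon>\<bar> \<le> C * (real d / \<epsilon>) powr p"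
  shows "poly_bounded X"
  using assms unfolding poly_bounded_def by blast

lemma poly_boundedE:
  assumes "poly_bounded X"
  obtains C p where "0 \<le> C" "0 \<le> p" "\<And>d \<epsilon>. 1 \<le> d \<Longrightarrow> \<epsilon> \<in> {0<..1} \<Longrightarrow> \<bar>X d \<epsilon>\<bar> \<le> C * (real d / \<epsilon>) powr p"
proof -
  obtain C p where p: "0 \<le> p" and C: "\<And>d \<epsilon>. 1 \<le> d \<Longrightarrow> \<epsilon> \<in> {0<..1} \<Longrightarrow> \<bar>X d \<epsilon>\<bar> \<le> C * (real d / \<epsilon>) powr p"
    using assms unfolding poly_bounded_def by blast
  have "0 \<le> C" using C[of 1 1] by simp
  then show ?thesis using that p C by blast
qed

lemma ratio_ge_1: "1 \<le> d \<Longrightarrow> \<epsilon> \<in> {0<..1} \<Longrightarrow> 1 \<le> real d / \<epsilon>"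
  by (auto simp: field_simps)

lemma poly_bounded_const: "poly_bounded (\<lambda>d \<epsilon>. c)"
  by (rule poly_boundedI[of 0 _ "\<bar>c\<bar>"]) auto

lemma poly_bounded_dim: "poly_bounded (\<lambda>d \<epsilon>. real d)"
  by (rule poly_boundedI[of 1 _ 1]) (auto simp: field_simps mult_left_le)

lemma poly_bounded_inverse: "poly_bounded (\<lambda>d \<epsilon>. 1 / \<epsilon>)"
  by (rule poly_boundedI[of 1 _ 1]) (auto simp: field_simps)

lemma poly_bounded_add:
  assumes "poly_bounded X" "poly_bounded Y" shows "poly_bounded (\<lambda>d \<epsilon>. X d \<epsilon> + Y d \<epsilon>)"
proof -
  obtain C p where 1: "0 \<le> C" "0 \<le> p" "\<And>d \<epsilon>. 1 \<le> d \<Longrightarrow> \<epsilon> \<in> {0<..1} \<Longrightarrow> \<bar>X d \<epsilon>\<bar> \<le> C * (real d / \<epsilon>) powr p"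
    using poly_boundedE[OF assms(1)] by blast
  obtain C' p' where 2: "0 \<le> C'" "0 \<le> p'" "\<And>d \<epsilon>. 1 \<le> d \<Longrightarrow> \<epsilon> \<in> {0<..1} \<Longrightarrow> \<bar>Y d \<epsilon>\<bar> \<le> C' * (real d / \<epsilon>) powr p'"
    using poly_boundedE[OF assms(2)] by blast
  show ?thesis
  proof (rule poly_boundedI)
    fix d :: nat and \<epsilon> :: real assume d: "1 \<le> d" "\<epsilon> \<in> {0<..1}"
    have "C * (real d / \<epsilon>) powr p \<le> C * (real d / \<epsilon>) powr (max p p')" "C' * (real d / \<epsilon>) powr p' \<le> C' * (real d / \<epsilon>) powr (max p p')"
      using ratio_ge_1[OF d] 1(1) 2(1) by (auto intro!: mult_left_mono powr_mono)
    then show "\<bar>X d \<epsilon> + Y d \<epsilon>\<bar> \<le> (C + C') * (real d / \<epsilon>) powr (max p p')"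
      using 1(3)[OF d] 2(3)[OF d] by (simp add: distrib_right)
  qed (use 1 in auto)
qed

lemma poly_bounded_mult:
  assumes "poly_bounded X" "poly_bounded Y" shows "poly_bounded (\<lambda>d \<epsilon>. X d \<epsilon> * Y d \<epsilon>)"
proof -
  obtain C p where 1: "0 \<le> C" "0 \<le> p" "\<And>d \<epsilon>. 1 \<le> d \<Longrightarrow> \<epsilon> \<in> {0<..1} \<Longrightarrow> \<bar>X d \<epsilon>\<bar> \<le> C * (real d / \<epsilon>) powr p"
    using poly_boundedE[OF assms(1)] by blast
  obtain C' p' where 2: "0 \<le> C'" "0 \<le> p'" "\<And>d \<epsilon>. 1 \<le> d \<Longrightarrow> \<epsilon> \<in> {0<..1} \<Longrightarrow> \<bar>Y d \<epsilon>\<bar> \<le> C' * (real d / \<epsilon>) powr p'"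
    using poly_boundedE[OF assms(2)] by blast
  show ?thesis
  proof (rule poly_boundedI)
    fix d :: nat and \<epsilon> :: real assume d: "1 \<le> d" "\<epsilon> \<in> {0<..1}"
    have "\<bar>X d \<epsilon> * Y d \<epsilon>\<bar> \<le> (C * (real d / \<epsilon>) powr p) * (C' * (real d / \<epsilon>) powr p')"
      unfolding abs_mult using 1(1) by (intro mult_mono 1(3)[OF d] 2(3)[OF d]) auto
    then show "\<bar>X d \<epsilon> * Y d \<epsilon>\<bar> \<le> (C * C') * (real d / \<epsilon>) powr (p + p')" by (simp add: powr_add mult_ac)
  qed (use 1 2 in auto)
qed

lemma poly_bounded_power: "poly_bounded X \<Longrightarrow> poly_bounded (\<lambda>d \<epsilon>. X d \<epsilon> ^ n)"
  by (induction n) (auto intro: poly_bounded_const poly_bounded_mult)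

lemma poly_bounded_powr:
  assumes "poly_bounded X" "0 \<le> a" shows "poly_bounded (\<lambda>d \<epsilon>. \<bar>X d \<epsilon>\<bar> powr a)"
proof -
  obtain C p where 1: "0 \<le> C" "0 \<le> p" "\<And>d \<epsilon>. 1 \<le> d \<Longrightarrow> \<epsilon> \<in> {0<..1} \<Longrightarrow> \<bar>X d \<epsilon>\<bar> \<le> C * (real d / \<epsilon>) powr p"
    using poly_boundedE[OF assms(1)] by blast
  show ?thesis
  proof (rule poly_boundedI)
    fix d :: nat and \<epsilon> :: real assume d: "1 \<le> d" "\<epsilon> \<in> {0<..1}"
    have "\<bar>X d \<epsilon>\<bar> powr a \<le> (C * (real d / \<epsilon>) powr p) powr a"
      by (rule powr_mono2[OF assms(2) _ 1(3)[OF d]]) simp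
    also have "\<dots> = C powr a * (real d / \<epsilon>) powr (p * a)" using 1(1) by (simp add: powr_mult powr_powr)
    finally show "\<bar>\<bar>X d \<epsilon>\<bar> powr a\<bar> \<le> C powr a * (real d / \<epsilon>) powr (p * a)" by simp
  qed (use 1 assms in auto)
qed

lemmas poly_bounded_intros =
  poly_bounded_const poly_bounded_dim poly_bounded_inverse poly_bounded_add poly_bounded_mult
  poly_bounded_power poly_bounded_powr

lemma poly_bounded_exponent:
  assumes "poly_bounded X"
  shows "\<exists>\<eta>>0. \<forall>d\<ge>1. \<forall>\<epsilon>\<in>{0<..1}. X d \<epsilon> \<le> \<eta> * real d powr \<eta> * \<epsilon> powr (- \<eta>)"
proof -
  obtain C p where 1: "0 \<le> C" "0 \<le> p" "\<And>d \<epsilon>. 1 \<le> d \<Longrightarrow> \<epsilon> \<in> {0<..1} \<Longrightarrow> \<bar>X d \<epsilon>\<bar> \<le> C * (real d / \<epsilon>) powr p"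
    using poly_boundedE[OF assms] by blast
  \<comment> \<open>One number serves as factor and as exponent, so it has to dominate both
    \<open>C\<close> and \<open>p\<close>; the 1 makes it positive.\<close>
  define \<eta> where "\<eta> = C + p + 1"
  have "X d \<epsilon> \<le> \<eta> * real d powr \<eta> * \<epsilon> powr (- \<eta>)" if d: "1 \<le> d" "\<epsilon> \<in> {0<..1}" for d \<epsilon>
  proof -
    have "X d \<epsilon> \<le> C * (real d / \<epsilon>) powr p" using 1(3)[OF d] by linarith
    also have "\<dots> \<le> \<eta> * (real d / \<epsilon>) powr \<eta>"
      using 1 ratio_ge_1[OF d] by (intro mult_mono powr_mono) (auto simp: \<eta>_def)
    also have "\<dots> = \<eta> * real d powr \<eta> * \<epsilon> powr (- \<eta>)"
      using d by (simp add: powr_divide powr_minus_divide)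
    finally show ?thesis .
  qed
  moreover have "0 < \<eta>" using 1 by (simp add: \<eta>_def)
  ultimately show ?thesis by blast
qed

text \<open>Extensional points are replaced by total functions through restriction, which commutes
  with updating a coordinate below \<open>d\<close>.\<close>

lemma heat_solution_C12:
  assumes "1 \<le> d" "0 < T" and lip: "\<And>v w. \<bar>f v - f w\<bar> \<le> \<kappa> * \<bar>v - w\<bar>" and C: "C12 T d u"
    and pde: "\<And>t x. t \<in> {0<..<T} \<Longrightarrow> x \<in> Rd d \<Longrightarrow> deriv (\<lambda>s. u s x) t = laplacian d (u t) x + f (u t x)"
  shows "heat_solution d T \<kappa> f (\<lambda>t x. u t (restrict x {..<d})) (\<lambda>i t x. partial_deriv i (u t) (restrict x {..<d}))
     (\<lambda>i t x. partial_deriv i (partial_deriv i (u t)) (restrict x {..<d}))"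
proof
  have Rd: "restrict x {..<d} \<in> Rd d" for x :: "nat \<Rightarrow> real" by auto
  have cont: "continuous_on ({0..T} \<times> UNIV) (\<lambda>(t, x). G t (restrict x {..<d}))"
    if "continuous_on ({0..T} \<times> Rd d) (\<lambda>(t, x). G t x)" for G :: "real \<Rightarrow> (nat \<Rightarrow> real) \<Rightarrow> real"
  proof -
    have "continuous_on ({0..T} \<times> UNIV) (\<lambda>p :: real \<times> (nat \<Rightarrow> real). (fst p, restrict (snd p) {..<d}))"
      by (intro continuous_intros continuous_on_compose2[OF continuous_restrict_fun[of UNIV]]) auto
    moreover have "(\<lambda>p :: real \<times> (nat \<Rightarrow> real). (fst p, restrict (snd p) {..<d})) ` ({0..T} \<times> UNIV) \<subseteq> {0..T} \<times> Rd d"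
      by (auto split: if_splits)
    ultimately have "continuous_on ({0..T} \<times> UNIV) (\<lambda>p. (\<lambda>(t, x). G t x) (fst p, restrict (snd p) {..<d}))"
      by (rule continuous_on_compose2[OF that])
    then show ?thesis by (simp add: case_prod_beta)
  qed
  show "continuous_on ({0..T} \<times> UNIV) (\<lambda>(t, x). u t (restrict x {..<d}))"
    by (rule cont) (use C in \<open>simp add: C12_def\<close>)
  have der: "((\<lambda>r. h (restrict (x(i := r)) {..<d})) has_real_derivative partial_deriv i h (restrict (x(i := r)) {..<d})) (at r)"
    if "i < d" and diff: "\<And>y. y \<in> Rd d \<Longrightarrow> partial_differentiable i h y" for h x i r
  proof -
    have eq: "restrict (x(i := r)) {..<d} = (restrict x {..<d})(i := r)" for r using that(1) by (simp add: restrict_fun_upd)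
    have "(\<lambda>s. h ((restrict (x(i := r)) {..<d})(i := s))) differentiable (at r)"
      using diff[OF Rd, of "x(i := r)"] unfolding partial_differentiable_def eq by simp
    then show ?thesis unfolding partial_deriv_def eq by (simp add: DERIV_deriv_iff_real_differentiable)
  qed
  fix i t
  show "continuous_on ({0..T} \<times> UNIV) (\<lambda>(t, x). partial_deriv i (partial_deriv i (u t)) (restrict x {..<d}))" if "i < d"
    by (rule cont) (use C that in \<open>simp add: C12_def\<close>)
  show "((\<lambda>r. u t (restrict (x(i := r)) {..<d})) has_real_derivative partial_deriv i (u t) (restrict (x(i := r)) {..<d})) (at r)"
    if "i < d" "t \<in> {0..T}" for x r
    by (rule der) (use C that in \<open>auto simp: C12_def\<close>)
  show "((\<lambda>r. partial_deriv i (u t) (restrict (x(i := r)) {..<d})) has_real_derivative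
      partial_deriv i (partial_deriv i (u t)) (restrict (x(i := r)) {..<d})) (at r)"
    if "i < d" "t \<in> {0..T}" for x r
    by (rule der) (use C that in \<open>auto simp: C12_def\<close>)
  show "((\<lambda>s. u s (restrict x {..<d})) has_real_derivative
      (\<Sum>i<d. partial_deriv i (partial_deriv i (u t)) (restrict x {..<d})) + f (u t (restrict x {..<d}))) (at t)"
    if "0 < t" "t < T" for x
  proof -
    have "(\<lambda>s. u s (restrict x {..<d})) differentiable (at t within {0..T})"
      using C that Rd[of x] by (simp add: C12_def)
    \<comment> \<open>At interior times differentiability within the interval is two-sided, as
      \<open>deriv\<close> needs.\<close>
    then have "(\<lambda>s. u s (restrict x {..<d})) differentiable (at t)" using that by (simp add: at_within_Icc_at)
    then have "((\<lambda>s. u s (restrict x {..<d})) has_real_derivative deriv (\<lambda>s. u s (restrict x {..<d})) t) (at t)"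
      by (simp add: DERIV_deriv_iff_real_differentiable)
    then show ?thesis using pde[of t "restrict x {..<d}"] that Rd[of x] by (simp add: laplacian_def)
  qed
qed (use assms in auto)

theorem theorem1p1:
  fixes T \<kappa> :: real
    and f :: "real \<Rightarrow> real"
    and \<gg> :: "nat \<Rightarrow> real \<Rightarrow> layer list"
    and c :: "nat \<Rightarrow> real"
    and g :: "nat \<Rightarrow> (nat \<Rightarrow> real) \<Rightarrow> real"
    and u :: "nat \<Rightarrow> real \<Rightarrow> (nat \<Rightarrow> real) \<Rightarrow> real"
  assumes "T > 0" and "\<kappa> > 0"
    and "continuous_on UNIV f"
    and "\<And>d \<epsilon>. d \<ge> 1 \<Longrightarrow> \<epsilon> \<in> {0<..1} \<Longrightarrow> \<gg> d \<epsilon> \<in> networks"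
    and "\<And>d. d \<ge> 1 \<Longrightarrow> c d > 0"
    and "\<And>d. d \<ge> 1 \<Longrightarrow> continuous_on (Rd d) (g d)"
    and "\<And>d. d \<ge> 1 \<Longrightarrow> C12 T d (u d)"
    and "\<And>v w. \<bar>f v - f w\<bar> \<le> \<kappa> * \<bar>v - w\<bar>"
    and "\<And>d \<epsilon>. d \<ge> 1 \<Longrightarrow> \<epsilon> \<in> {0<..1} \<Longrightarrow> realization_in_C d 1 (\<gg> d \<epsilon>)"
    and "\<And>d \<epsilon> x. d \<ge> 1 \<Longrightarrow> \<epsilon> \<in> {0<..1} \<Longrightarrow> x \<in> Rd d \<Longrightarrow>
           \<bar>scalar_realization (\<gg> d \<epsilon>) x\<bar> \<le> \<kappa> * real d powr \<kappa> * (1 + L2_set x {..<d} powr \<kappa>)"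
    and "\<And>d \<epsilon> x. d \<ge> 1 \<Longrightarrow> \<epsilon> \<in> {0<..1} \<Longrightarrow> x \<in> Rd d \<Longrightarrow>
           \<bar>g d x - scalar_realization (\<gg> d \<epsilon>) x\<bar>
             \<le> \<epsilon> * \<kappa> * real d powr \<kappa> * (1 + L2_set x {..<d} powr \<kappa>)"
    and "\<And>d \<epsilon>. d \<ge> 1 \<Longrightarrow> \<epsilon> \<in> {0<..1} \<Longrightarrow>
           real (num_params (\<gg> d \<epsilon>)) \<le> \<kappa> * real d powr \<kappa> * \<epsilon> powr (- \<kappa>)"
    and "\<And>d t x. d \<ge> 1 \<Longrightarrow> t \<in> {0<..<T} \<Longrightarrow> x \<in> Rd d \<Longrightarrow>
           \<bar>u d t x\<bar> \<le> c d * (1 + L2_set x {..<d} powr c d)"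
    and "\<And>d x. d \<ge> 1 \<Longrightarrow> x \<in> Rd d \<Longrightarrow> u d 0 x = g d x"
    and "\<And>d t x. d \<ge> 1 \<Longrightarrow> t \<in> {0<..<T} \<Longrightarrow> x \<in> Rd d \<Longrightarrow>
           deriv (\<lambda>s. u d s x) t = laplacian d (u d t) x + f (u d t x)"
  shows "\<exists>(\<Psi> :: nat \<Rightarrow> real \<Rightarrow> layer list) (\<eta> :: real). \<eta> > 0 \<and>
     (\<forall>d\<ge>1. \<forall>\<epsilon>\<in>{0<..1}.
        \<Psi> d \<epsilon> \<in> networks \<and>
        realization_in_C d 1 (\<Psi> d \<epsilon>) \<and>
        real (num_params (\<Psi> d \<epsilon>)) \<le> \<eta> * real d powr \<eta> * \<epsilon> powr (- \<eta>) \<and>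
        sqrt (LINT x:unit_cube d|lebesgue_Rd d.
                \<bar>u d T x - scalar_realization (\<Psi> d \<epsilon>) x\<bar>\<^sup>2) \<le> \<epsilon>)"
proof -
  have L2_restrict: "L2_set (restrict x {..<d}) {..<d} = L2_set x {..<d}" for x :: "nat \<Rightarrow> real" and d
    by (rule L2_set_cong) auto
  have Rd: "restrict x {..<d} \<in> Rd d" for x :: "nat \<Rightarrow> real" and d by auto
  define c\<kappa> where "c\<kappa> = \<kappa> * (1 + 2 * \<kappa> powr \<kappa>)"
  \<comment> \<open>One power of \<open>d\<close> comes from the hypotheses, the other from
    \<open>L2_growth\<close>. The modulus gives the shape that \<open>poly_bounded_powr\<close>
    expects.\<close>
  define G where "G d = c\<kappa> * \<bar>real d\<bar> powr \<kappa> * \<bar>real d\<bar> powr \<kappa>" for d :: nat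
  define L where "L d = (G d + T * (\<bar>f 0\<bar> + 2 * \<kappa>)) * exp ((4 + \<kappa>) * T)" for d
  define \<Theta> where "\<Theta> d = (G d + T * (2 * \<kappa> * (1 + (L d)\<^sup>2) * real d + G d)) * exp ((16 + \<kappa>) * T) * (real d * cosh 2)" for d
  \<comment> \<open>The inverse of the data accuracy:
    \<open>\<delta> * \<Theta> d \<le> \<epsilon> / 2\<close> holds while
    \<open>1 / \<delta>\<close> stays polynomial in \<open>d\<close> and
    \<open>1 / \<epsilon>\<close>, so the size of the given network at \<open>\<delta>\<close> does
    too.\<close>
  define inv\<delta> where "inv\<delta> d \<epsilon> = 2 * (1 + \<Theta> d) * (1 / \<epsilon>)" for d and \<epsilon> :: real
  define V where "V d \<epsilon> = \<kappa> * \<bar>real d\<bar> powr \<kappa> * \<bar>inv\<delta> d \<epsilon>\<bar> powr \<kappa> + 8 * (inv\<delta> d \<epsilon>)\<^sup>2 + 2" for d \<epsilon>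
  have "1 * 1 \<le> (6 + 32 * T * \<kappa>\<^sup>2) * exp T" using assms(1) by (intro mult_mono) auto
  then have "1 \<le> (6 + 32 * T * \<kappa>\<^sup>2) * exp T" by simp
  from level_choice[OF this] obtain C where
    C: "\<And>q. 1 \<le> q \<Longrightarrow> \<exists>n\<ge>1. q * ((6 + 32 * T * \<kappa>\<^sup>2) * exp T) ^ n \<le> real n ^ n \<and> (3 * real n) ^ n \<le> C * q\<^sup>2" by blast
  define X where "X d \<epsilon> = C * (4 * ((L d)\<^sup>2 * real d * (exp (16 * T) * (real d * cosh 2))) * (1 / \<epsilon>)\<^sup>2 + 1)\<^sup>2" for d and \<epsilon> :: real
  define B where "B d \<epsilon> = (V d \<epsilon> + X d \<epsilon> + 1) * (V d \<epsilon> * X d \<epsilon> * (V d \<epsilon> * X d \<epsilon> + real d + 1))" for d \<epsilon>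
  have "poly_bounded B"
    unfolding B_def V_def X_def inv\<delta>_def \<Theta>_def L_def G_def using assms(2)
    by (intro poly_bounded_intros less_imp_le)
  then obtain \<eta> where \<eta>: "0 < \<eta>" "\<And>d \<epsilon>. 1 \<le> d \<Longrightarrow> \<epsilon> \<in> {0<..1} \<Longrightarrow> B d \<epsilon> \<le> \<eta> * real d powr \<eta> * \<epsilon> powr (- \<eta>)"
    using poly_bounded_exponent by blast
  have ex: "\<exists>\<Psi>\<in>networks. realization_in_C d 1 \<Psi> \<and> real (num_params \<Psi>) \<le> B d \<epsilon> \<and>
      cube_integral d (\<lambda>x. \<bar>u d T x - scalar_realization \<Psi> x\<bar>\<^sup>2) \<le> \<epsilon>\<^sup>2"
    if d: "1 \<le> d" and \<epsilon>: "\<epsilon> \<in> {0<..1}" for d \<epsilon>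
  proof -
    have pde: "deriv (\<lambda>s. u d s x) t = laplacian d (u d t) x + f (u d t x)" if "t \<in> {0<..<T}" "x \<in> Rd d" for t x
      using assms(15) d that by blast
    interpret heat_solution d T \<kappa> f "\<lambda>t x. u d t (restrict x {..<d})" "\<lambda>i t x. partial_deriv i (u d t) (restrict x {..<d})"
       "\<lambda>i t x. partial_deriv i (partial_deriv i (u d t)) (restrict x {..<d})"
      by (rule heat_solution_C12[OF d assms(1,8) assms(7)[OF d] pde])
    have c\<kappa>: "0 < c\<kappa>" using assms(2) by (simp add: c\<kappa>_def add_pos_nonneg)
    have G: "0 < G d" using d c\<kappa> by (simp add: G_def)
    have L: "G d \<le> L d"
    proof -
      have "G d * 1 \<le> (G d + T * (\<bar>f 0\<bar> + 2 * \<kappa>)) * exp ((4 + \<kappa>) * T)"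
        using G assms(1,2) by (intro mult_mono) auto
      then show ?thesis by (simp add: L_def)
    qed
    have \<Theta>: "0 \<le> \<Theta> d" using G assms(1,2) by (simp add: \<Theta>_def)
    define \<delta> where "\<delta> = 1 / inv\<delta> d \<epsilon>"
    have "1 * 1 \<le> 2 * (1 + \<Theta> d) * (1 / \<epsilon>)" using \<Theta> \<epsilon> by (intro mult_mono) auto
    then have inv: "1 \<le> inv\<delta> d \<epsilon>" by (simp add: inv\<delta>_def)
    then have \<delta>: "0 < \<delta>" "\<delta> \<le> 1" by (auto simp: \<delta>_def)
    then have \<delta>': "\<delta> \<in> {0<..1}" by simp
    note \<Phi> = assms(4)[OF d \<delta>'] assms(9)[OF d \<delta>']
    have sr: "scalar_realization (\<gg> d \<delta>) (restrict x {..<d}) = scalar_realization (\<gg> d \<delta>) x" for x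
      using scalar_realization_restrict[of "\<gg> d \<delta>" d] \<Phi> networks_not_Nil by (simp add: realization_in_C_def)
    have growth\<kappa>: "\<kappa> * real d powr \<kappa> * (1 + L2_set x {..<d} powr \<kappa>) \<le> G d * weight d 1 x" for x
    proof -
      have "\<kappa> * real d powr \<kappa> * (1 + L2_set x {..<d} powr \<kappa>) \<le>
          \<kappa> * real d powr \<kappa> * ((1 + 2 * \<kappa> powr \<kappa>) * real d powr \<kappa> * weight d 1 x)"
        using assms(2) by (intro mult_left_mono[OF L2_growth[OF assms(2) d]]) auto
      then show ?thesis by (simp add: G_def c\<kappa>_def mult_ac)
    qed
    have 1: "\<bar>scalar_realization (\<gg> d \<delta>) x\<bar> \<le> G d * weight d 1 x" for x
      using assms(10)[OF d \<delta>' Rd, of x] growth\<kappa>[of x] unfolding sr L2_restrict by linarith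
    have 2: "\<bar>u d 0 (restrict x {..<d}) - scalar_realization (\<gg> d \<delta>) x\<bar> \<le> \<delta> * G d * weight d 2 x" for x
    proof -
      have "\<bar>u d 0 (restrict x {..<d}) - scalar_realization (\<gg> d \<delta>) x\<bar> \<le> \<delta> * (\<kappa> * real d powr \<kappa> * (1 + L2_set x {..<d} powr \<kappa>))"
        using assms(11)[OF d \<delta>' Rd, of x] assms(14)[OF d Rd, of x] unfolding sr L2_restrict by (simp add: mult.assoc)
      also have "\<dots> \<le> \<delta> * (G d * weight d 2 x)"
      proof (rule mult_left_mono)
        have "G d * weight d 1 x \<le> G d * weight d 2 x" using G by (intro mult_left_mono weight_1_le_2) auto
        with growth\<kappa>[of x] show "\<kappa> * real d powr \<kappa> * (1 + L2_set x {..<d} powr \<kappa>) \<le> G d * weight d 2 x"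
          by linarith
      qed (use \<delta> in simp)
      finally show ?thesis by (simp add: mult.assoc)
    qed
    \<comment> \<open>Without control in \<open>d\<close>, since \<open>c d\<close> is arbitrary; it
      does not occur in \<open>B\<close>.\<close>
    define C0 where "C0 = c d * ((1 + 2 * c d powr c d) * real d powr c d)"
    have c: "0 < c d" by (rule assms(5)[OF d])
    have 3: "\<bar>u d t (restrict x {..<d})\<bar> \<le> C0 * weight d 1 x" if "0 < t" "t < T" for t x
    proof -
      have "\<bar>u d t (restrict x {..<d})\<bar> \<le> c d * (1 + L2_set x {..<d} powr c d)"
        using assms(13)[OF d _ Rd, of t x] that unfolding L2_restrict by simp
      also have "\<dots> \<le> c d * ((1 + 2 * c d powr c d) * real d powr c d * weight d 1 x)"
        using c by (intro mult_left_mono L2_growth d) auto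
      finally show ?thesis by (simp add: C0_def mult.assoc)
    qed
    have 4: "0 \<le> C0" using c by (simp add: C0_def)
    have 5: "\<delta> * \<Theta> d \<le> \<epsilon> / 2" using \<Theta> \<epsilon> by (simp add: \<delta>_def inv\<delta>_def field_simps)
    have 6: "X d \<epsilon> = C * (4 * ((L d)\<^sup>2 * real d * (exp (16 * T) * (real d * cosh 2))) / \<epsilon>\<^sup>2 + 1)\<^sup>2"
      by (simp add: X_def power_divide)
    have 7: "real (num_params (\<gg> d \<delta>)) + 8 / \<delta>\<^sup>2 + 2 \<le> V d \<epsilon>"
    proof -
      have "\<delta> powr (- \<kappa>) = inv\<delta> d \<epsilon> powr \<kappa>" using inv by (simp add: \<delta>_def powr_minus_divide powr_divide)
      then show ?thesis using assms(12)[OF d \<delta>'] inv by (simp add: V_def \<delta>_def power_divide)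
    qed
    have \<epsilon>0: "0 < \<epsilon>" using \<epsilon> by simp
    obtain \<Psi> where \<Psi>: "\<Psi> \<in> networks" "realization_in_C d 1 \<Psi>" "real (num_params \<Psi>) \<le> B d \<epsilon>"
      "cube_integral d (\<lambda>x. \<bar>u d T (restrict x {..<d}) - scalar_realization \<Psi> x\<bar>\<^sup>2) \<le> \<epsilon>\<^sup>2"
      using network_approximation[OF \<epsilon>0 \<delta> \<Phi> 1 G 2 3 4 _ L 5[unfolded \<Theta>_def] C 6 7, folded B_def]
      by (auto simp: L_def)
    have "cube_integral d (\<lambda>x. \<bar>u d T (restrict x {..<d}) - scalar_realization \<Psi> x\<bar>\<^sup>2) =
        cube_integral d (\<lambda>x. \<bar>u d T x - scalar_realization \<Psi> x\<bar>\<^sup>2)"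
      by (rule set_lebesgue_integral_cong[OF sets_unit_cube]) (auto simp: PiE_restrict)
    then show ?thesis using \<Psi> by (intro bexI[of _ \<Psi>]) auto
  qed
  define Q where "Q d \<epsilon> \<Psi> \<longleftrightarrow> \<Psi> \<in> networks \<and> realization_in_C d 1 \<Psi> \<and>
      real (num_params \<Psi>) \<le> \<eta> * real d powr \<eta> * \<epsilon> powr (- \<eta>) \<and>
      sqrt (cube_integral d (\<lambda>x. \<bar>u d T x - scalar_realization \<Psi> x\<bar>\<^sup>2)) \<le> \<epsilon>" for d \<epsilon> \<Psi>
  have "\<exists>\<Psi>. Q d \<epsilon> \<Psi>" if d: "1 \<le> d" and \<epsilon>: "\<epsilon> \<in> {0<..1}" for d \<epsilon>
  proof -
    obtain \<Psi> where \<Psi>: "\<Psi> \<in> networks" "realization_in_C d 1 \<Psi>" "real (num_params \<Psi>) \<le> B d \<epsilon>"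
      "cube_integral d (\<lambda>x. \<bar>u d T x - scalar_realization \<Psi> x\<bar>\<^sup>2) \<le> \<epsilon>\<^sup>2" using ex[OF d \<epsilon>] by blast
    have "sqrt (cube_integral d (\<lambda>x. \<bar>u d T x - scalar_realization \<Psi> x\<bar>\<^sup>2)) \<le> \<epsilon>"
      using real_sqrt_le_mono[OF \<Psi>(4)] \<epsilon> by simp
    then show ?thesis using \<Psi> \<eta>(2)[OF d \<epsilon>] unfolding Q_def by (meson order_trans)
  qed
  then have "\<forall>d\<ge>1. \<forall>\<epsilon>\<in>{0<..1}. Q d \<epsilon> (SOME \<Psi>. Q d \<epsilon> \<Psi>)" by (blast intro: someI_ex)
  then show ?thesis unfolding Q_def using \<eta>(1)
    by (intro exI[of _ "\<lambda>d \<epsilon>. SOME \<Psi>. Q d \<epsilon> \<Psi>"] exI[of _ \<eta>]) (auto simp: Q_def)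
qed

end
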